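(* Let $(X,d,\mu)$ be a metric measure space and let $L$ be a self-adjoint, non-negative operator on $L^2(X,\mu)$ which satisfies the finite propagation speed property for the corresponding wave equation. Suppose that for some exponents $\sigma>0$ and $\kappa\ge 0$ there is a constant $C$ such that $$\|V_t^{1/2}(I+t^2L)^{-\sigma}\|_{2\to\infty}\le C(1+t^2)^{\kappa}\quad\text{for all } t>0.$$ Then: (i) There exists a constant $C>0$ such that $$\|e^{i\xi tL}e^{-tL}\|_{1\to1}\le C(1+\xi^2)^{\sigma+\kappa+1/4}(1+t)^{\kappa}$$ for all $t>0$ and $\xi\in\mathbb{R}$. (ii) Let $s>2\sigma+2\kappa+1$. For every bounded Borel function $F$ with $\operatorname{supp}F\subset[-1,1]$ and $F\in H^s(\mathbb{R})$, the operator $F(L)$ is bounded on $L^p(X)$ for all $1\le p\le\infty$, and there exists a constant $C=C(s)>0$ such that $$\|F(tL)\|_{p\to p}\le C(1+t)^{\kappa}\|F\|_{H^s}$$ for all $t>0$.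
   Context: $B(x,r)$ is the ball with center $x$ and radius $r$; $V_r(x)=V(x,r)=\mu(B(x,r))$. A function $W:X\to\mathbb{R}$ is identified with the operator of multiplication by $W$, so $V_t^{1/2}T$ denotes the operator $f\mapsto V_t^{1/2}(x)\,(Tf)(x)$. $\|T\|_{p\to q}$ is the operator norm from $L^p(X,\mu)$ to $L^q(X,\mu)$ (of the extension of $T$, when $T$ is initially defined on $L^2$). For bounded Borel $F$, $F(L)=\int_0^\infty F(\lambda)\,dE_L(\lambda)$ is defined by the spectral theorem on $L^2(X,\mu)$; boundedness on $L^p$ means that $F(L)$ extends to a bounded operator on $L^p$. $H^s(\mathbb{R})$ is the $L^2$-based Sobolev space of order $s$. The finite propagation speed property means: $\langle\cos(r\sqrt L)f_1,f_2\rangle=0$ for all $r>0$ and all $f_i\in L^2(B_i,\mu)$, $i=1,2$, whenever $B_1,B_2$ are open balls in $X$ with $d(B_1,B_2)>r$. No doubling condition is assumed on $X$.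
   Formalization: In (ii) F is also assumed continuous (the continuous representative in H^s); for arbitrary Borel F the bound fails, e.g. X a point, L=0, F the indicator of {0}. Balls have finite measure and the complement of the support of μ is null. *)

theory Defs
  imports "HOL-Probability.Essential_Supremum"
begin

section \<open>Metric measure spaces\<close>

text \<open>
  The space X is the whole type. Finiteness of the measure of balls makes \<open>V\<^sub>r\<close> a real function.
  The last condition says that the complement of the support of \<open>\<mu>\<close> is a null set. It holds if
  all balls have positive measure, and also if X is separable; it only excludes measures that
  charge a non-separable, locally null set.
\<close>
definition metric_measure_space :: "'a::metric_space measure \<Rightarrow> bool" where
  "metric_measure_space \<mu> \<longleftrightarrow>
     sets \<mu> = sets borel \<and>
     (\<forall>x r. 0 < r \<longrightarrow> emeasure \<mu> (ball x r) < \<infinity>) \<and>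
     (AE x in \<mu>. \<forall>r>0. 0 < emeasure \<mu> (ball x r))"

definition vol :: "'a::metric_space measure \<Rightarrow> real \<Rightarrow> 'a \<Rightarrow> real" where
  "vol \<mu> r x = measure \<mu> (ball x r)"

section \<open>Lebesgue spaces and operators between them\<close>

text \<open>
  Elements of \<open>L\<^sup>p\<close> are functions, not classes; all operator identities are therefore stated
  almost everywhere.
\<close>
definition Lp :: "'a measure \<Rightarrow> ennreal \<Rightarrow> ('a \<Rightarrow> complex) set" where
  "Lp \<mu> p = {f \<in> borel_measurable \<mu>.
     if p = \<infinity> then esssup \<mu> (\<lambda>x. ennreal (norm (f x))) < \<infinity>
     else (\<integral>\<^sup>+x. ennreal (norm (f x) powr enn2real p) \<partial>\<mu>) < \<infinity>}"

definition Lp_norm :: "'a measure \<Rightarrow> ennreal \<Rightarrow> ('a \<Rightarrow> complex) \<Rightarrow> real" where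
  "Lp_norm \<mu> p f =
     (if p = \<infinity> then enn2real (esssup \<mu> (\<lambda>x. ennreal (norm (f x))))
      else enn2real (\<integral>\<^sup>+x. ennreal (norm (f x) powr enn2real p) \<partial>\<mu>) powr (1 / enn2real p))"

definition L2_inner :: "'a measure \<Rightarrow> ('a \<Rightarrow> complex) \<Rightarrow> ('a \<Rightarrow> complex) \<Rightarrow> complex" where
  "L2_inner \<mu> f g = (LINT x|\<mu>. f x * cnj (g x))"

definition linear_op ::
  "'a measure \<Rightarrow> ('a \<Rightarrow> complex) set \<Rightarrow> ('a \<Rightarrow> complex) set
    \<Rightarrow> (('a \<Rightarrow> complex) \<Rightarrow> ('a \<Rightarrow> complex)) \<Rightarrow> bool" where
  "linear_op \<mu> A B T \<longleftrightarrow>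
     (\<forall>f\<in>A. T f \<in> B) \<and>
     (\<forall>f\<in>A. \<forall>g\<in>A. (AE x in \<mu>. f x = g x) \<longrightarrow> (AE x in \<mu>. T f x = T g x)) \<and>
     (\<forall>f\<in>A. \<forall>g\<in>A. AE x in \<mu>. T (\<lambda>y. f y + g y) x = T f x + T g x) \<and>
     (\<forall>f\<in>A. \<forall>c. AE x in \<mu>. T (\<lambda>y. c * f y) x = c * T f x)"

text \<open>
  The norm \<open>\<parallel>T\<parallel>\<close> from \<open>L\<^sup>p\<close> to \<open>L\<^sup>q\<close> of the extension to \<open>L\<^sup>p\<close> of an operator given on \<open>L\<^sup>2\<close>;
  it is \<open>\<infinity>\<close> if there is no bounded extension. For \<open>p < \<infinity>\<close> the bounded extension is unique by
  density of \<open>L\<^sup>2 \<inter> L\<^sup>p\<close>. For \<open>p = \<infinity>\<close> the infimum over all extensions is the norm of the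
  weak-* continuous one, whenever that exists, because both equal the norm of \<open>T\<close> on
  \<open>L\<^sup>2 \<inter> L\<^sup>\<infinity>\<close>.
\<close>
definition op_norm ::
  "'a measure \<Rightarrow> ennreal \<Rightarrow> ennreal \<Rightarrow> (('a \<Rightarrow> complex) \<Rightarrow> ('a \<Rightarrow> complex)) \<Rightarrow> ennreal" where
  "op_norm \<mu> p q T = Inf {ennreal C | C. 0 \<le> C \<and>
     (\<exists>S. linear_op \<mu> (Lp \<mu> p) (Lp \<mu> q) S \<and>
          (\<forall>f\<in>Lp \<mu> 2 \<inter> Lp \<mu> p. AE x in \<mu>. S f x = T f x) \<and>
          (\<forall>f\<in>Lp \<mu> p. Lp_norm \<mu> q (S f) \<le> C * Lp_norm \<mu> p f))}"

section \<open>Self-adjoint operators and their functional calculus\<close>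

text \<open>An unbounded operator on \<open>L\<^sup>2\<close> is given by its domain \<open>D\<close> and a map \<open>L\<close> on \<open>D\<close>.\<close>

definition densely_defined_op ::
  "'a measure \<Rightarrow> ('a \<Rightarrow> complex) set \<Rightarrow> (('a \<Rightarrow> complex) \<Rightarrow> ('a \<Rightarrow> complex)) \<Rightarrow> bool" where
  "densely_defined_op \<mu> D L \<longleftrightarrow>
     D \<subseteq> Lp \<mu> 2 \<and>
     (\<forall>f\<in>D. \<forall>g\<in>D. (\<lambda>x. f x + g x) \<in> D) \<and> (\<forall>f\<in>D. \<forall>c. (\<lambda>x. c * f x) \<in> D) \<and>
     (\<forall>f\<in>Lp \<mu> 2. \<forall>\<epsilon>>0. \<exists>g\<in>D. Lp_norm \<mu> 2 (\<lambda>x. f x - g x) < \<epsilon>) \<and>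
     linear_op \<mu> D (Lp \<mu> 2) L"

definition adjoint_domain ::
  "'a measure \<Rightarrow> ('a \<Rightarrow> complex) set \<Rightarrow> (('a \<Rightarrow> complex) \<Rightarrow> ('a \<Rightarrow> complex))
    \<Rightarrow> ('a \<Rightarrow> complex) set" where
  "adjoint_domain \<mu> D L =
     {g \<in> Lp \<mu> 2. \<exists>h\<in>Lp \<mu> 2. \<forall>f\<in>D. L2_inner \<mu> (L f) g = L2_inner \<mu> f h}"

definition self_adjoint_op ::
  "'a measure \<Rightarrow> ('a \<Rightarrow> complex) set \<Rightarrow> (('a \<Rightarrow> complex) \<Rightarrow> ('a \<Rightarrow> complex)) \<Rightarrow> bool" where
  "self_adjoint_op \<mu> D L \<longleftrightarrow>
     densely_defined_op \<mu> D L \<and>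
     adjoint_domain \<mu> D L = D \<and>
     (\<forall>f\<in>D. \<forall>g\<in>D. L2_inner \<mu> (L f) g = L2_inner \<mu> f (L g))"

definition nonneg_op ::
  "'a measure \<Rightarrow> ('a \<Rightarrow> complex) set \<Rightarrow> (('a \<Rightarrow> complex) \<Rightarrow> ('a \<Rightarrow> complex)) \<Rightarrow> bool" where
  "nonneg_op \<mu> D L \<longleftrightarrow> (\<forall>f\<in>D. 0 \<le> Re (L2_inner \<mu> (L f) f))"

definition projection_valued_measure ::
  "'a measure \<Rightarrow> (real set \<Rightarrow> ('a \<Rightarrow> complex) \<Rightarrow> ('a \<Rightarrow> complex)) \<Rightarrow> bool" where
  "projection_valued_measure \<mu> E \<longleftrightarrow>
     (\<forall>A\<in>sets borel. linear_op \<mu> (Lp \<mu> 2) (Lp \<mu> 2) (E A)) \<and>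
     (\<forall>A\<in>sets borel. \<forall>f\<in>Lp \<mu> 2. \<forall>g\<in>Lp \<mu> 2. L2_inner \<mu> (E A f) g = L2_inner \<mu> f (E A g)) \<and>
     (\<forall>A\<in>sets borel. \<forall>B\<in>sets borel. \<forall>f\<in>Lp \<mu> 2. AE x in \<mu>. E A (E B f) x = E (A \<inter> B) f x) \<and>
     (\<forall>f\<in>Lp \<mu> 2. AE x in \<mu>. E UNIV f x = f x) \<and>
     (\<forall>A :: nat \<Rightarrow> real set. range A \<subseteq> sets borel \<longrightarrow> disjoint_family A \<longrightarrow>
        (\<forall>f\<in>Lp \<mu> 2. \<forall>g\<in>Lp \<mu> 2.
           (\<lambda>i. L2_inner \<mu> (E (A i) f) g) sums L2_inner \<mu> (E (\<Union>i. A i) f) g))"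

text \<open>The scalar measure \<open>A \<mapsto> \<langle>E(A) f, f\<rangle>\<close>.\<close>
definition scalar_measure ::
  "'a measure \<Rightarrow> (real set \<Rightarrow> ('a \<Rightarrow> complex) \<Rightarrow> ('a \<Rightarrow> complex)) \<Rightarrow> ('a \<Rightarrow> complex)
    \<Rightarrow> real measure" where
  "scalar_measure \<mu> E f =
     measure_of UNIV (sets borel) (\<lambda>A. ennreal (Re (L2_inner \<mu> (E A f) f)))"

text \<open>
  \<open>L = \<integral> \<lambda> dE(\<lambda>)\<close>. As for every operator on a complex Hilbert space, the quadratic form
  \<open>\<langle>L f, f\<rangle>\<close> on the domain determines \<open>\<langle>L f, g\<rangle>\<close> by polarisation.
\<close>
definition spectral_resolution ::
  "'a measure \<Rightarrow> ('a \<Rightarrow> complex) set \<Rightarrow> (('a \<Rightarrow> complex) \<Rightarrow> ('a \<Rightarrow> complex))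
    \<Rightarrow> (real set \<Rightarrow> ('a \<Rightarrow> complex) \<Rightarrow> ('a \<Rightarrow> complex)) \<Rightarrow> bool" where
  "spectral_resolution \<mu> D L E \<longleftrightarrow>
     projection_valued_measure \<mu> E \<and>
     D = {f \<in> Lp \<mu> 2. (\<integral>\<^sup>+u. ennreal (u\<^sup>2) \<partial>scalar_measure \<mu> E f) < \<infinity>} \<and>
     (\<forall>f\<in>D. L2_inner \<mu> (L f) f = complex_of_real (LINT u|scalar_measure \<mu> E f. u))"

text \<open>
  \<open>E\<^sub>L\<close>. By the spectral theorem a self-adjoint operator has a spectral resolution, unique up to
  null sets, so for such operators the second branch (a totalisation by zero) is never taken.
\<close>
definition spectral_measure ::
  "'a measure \<Rightarrow> ('a \<Rightarrow> complex) set \<Rightarrow> (('a \<Rightarrow> complex) \<Rightarrow> ('a \<Rightarrow> complex))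
    \<Rightarrow> (real set \<Rightarrow> ('a \<Rightarrow> complex) \<Rightarrow> ('a \<Rightarrow> complex))" where
  "spectral_measure \<mu> D L =
     (if \<exists>E. spectral_resolution \<mu> D L E then SOME E. spectral_resolution \<mu> D L E
      else (\<lambda>A f x. 0))"

text \<open>
  \<open>F(L) = \<integral>\<^sub>0\<^sup>\<infinity> F(\<lambda>) dE\<^sub>L(\<lambda>)\<close> for bounded Borel \<open>F\<close> (on the half line): the bounded operator on
  \<open>L\<^sup>2\<close> with \<open>\<langle>F(L) f, f\<rangle> = \<integral>\<^sub>0\<^sup>\<infinity> F(\<lambda>) d\<langle>E\<^sub>L(\<lambda>) f, f\<rangle>\<close>; it is unique up to null sets by
  polarisation.
\<close>
definition func_calc ::
  "'a measure \<Rightarrow> ('a \<Rightarrow> complex) set \<Rightarrow> (('a \<Rightarrow> complex) \<Rightarrow> ('a \<Rightarrow> complex))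
    \<Rightarrow> (real \<Rightarrow> complex) \<Rightarrow> (('a \<Rightarrow> complex) \<Rightarrow> ('a \<Rightarrow> complex))" where
  "func_calc \<mu> D L F = (SOME T.
     linear_op \<mu> (Lp \<mu> 2) (Lp \<mu> 2) T \<and>
     (\<exists>C. \<forall>f\<in>Lp \<mu> 2. Lp_norm \<mu> 2 (T f) \<le> C * Lp_norm \<mu> 2 f) \<and>
     (\<forall>f\<in>Lp \<mu> 2. L2_inner \<mu> (T f) f =
        (LINT u:{0..}|scalar_measure \<mu> (spectral_measure \<mu> D L) f. F u)))"

definition finite_propagation_speed ::
  "'a::metric_space measure \<Rightarrow> ('a \<Rightarrow> complex) set \<Rightarrow> (('a \<Rightarrow> complex) \<Rightarrow> ('a \<Rightarrow> complex))
    \<Rightarrow> bool" where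
  "finite_propagation_speed \<mu> D L \<longleftrightarrow>
     (\<forall>r>0. \<forall>x1 r1 x2 r2. setdist (ball x1 r1) (ball x2 r2) > r \<longrightarrow>
        (\<forall>f1\<in>Lp \<mu> 2. \<forall>f2\<in>Lp \<mu> 2.
           (\<forall>x. x \<notin> ball x1 r1 \<longrightarrow> f1 x = 0) \<longrightarrow> (\<forall>x. x \<notin> ball x2 r2 \<longrightarrow> f2 x = 0) \<longrightarrow>
           L2_inner \<mu> (func_calc \<mu> D L (\<lambda>u. complex_of_real (cos (r * sqrt u))) f1) f2 = 0))"

section \<open>Sobolev spaces on the line\<close>

text \<open>
  Fourier--Plancherel transform of \<open>F \<in> L\<^sup>2(\<real>)\<close>: the \<open>L\<^sup>2\<close> limit of the Fourier integrals
  of \<open>F\<close> truncated to \<open>[-n, n]\<close>, with the unitary normalisation.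
\<close>
definition is_plancherel_transform :: "(real \<Rightarrow> complex) \<Rightarrow> (real \<Rightarrow> complex) \<Rightarrow> bool" where
  "is_plancherel_transform F G \<longleftrightarrow>
     F \<in> Lp lborel 2 \<and> G \<in> Lp lborel 2 \<and>
     (\<lambda>n::nat. \<integral>\<^sup>+\<xi>. ennreal ((norm (G \<xi> -
          complex_of_real (1 / sqrt (2 * pi)) *
            (LINT x:{- real n..real n}|lborel. F x * exp (- (\<i> * of_real (x * \<xi>))))))\<^sup>2) \<partial>lborel)
       \<longlonglongrightarrow> 0"

definition plancherel_transform :: "(real \<Rightarrow> complex) \<Rightarrow> (real \<Rightarrow> complex)" where
  "plancherel_transform F = (SOME G. is_plancherel_transform F G)"

text \<open>
  Only \<open>s \<ge> 0\<close> is meaningful here. Membership does not see null sets: for \<open>s > 1/2\<close> the usual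
  identification of \<open>F \<in> H\<^sup>s(\<real>)\<close> with its continuous representative, which matters for \<open>F(L)\<close>
  because \<open>E\<^sub>L\<close> may charge points, has to be expressed by continuity of \<open>F\<close>.
\<close>

definition sobolev_space :: "real \<Rightarrow> (real \<Rightarrow> complex) set" where
  "sobolev_space s = {F \<in> Lp lborel 2.
     (\<integral>\<^sup>+\<xi>. ennreal ((1 + \<xi>\<^sup>2) powr s * (norm (plancherel_transform F \<xi>))\<^sup>2) \<partial>lborel) < \<infinity>}"

definition sobolev_norm :: "real \<Rightarrow> (real \<Rightarrow> complex) \<Rightarrow> real" where
  "sobolev_norm s F =
     sqrt (LINT \<xi>|lborel. (1 + \<xi>\<^sup>2) powr s * (norm (plancherel_transform F \<xi>))\<^sup>2)"

end

theory Submission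
  imports Defs "HOL-Probability.Probability"
begin

text \<open>
  Put \<open>b = 2 \<sigma> + 1/2\<close> and let \<open>B(y) = \<Sum>k. (- y / 4)\<^sup>k / (k! \<Gamma>(b + k))\<close>, a Bessel function.
  Since \<open>B(x\<^sup>2)\<close> is a superposition of \<open>cos (s x)\<close> with \<open>0 < s < 1\<close>, the operator \<open>B(v L)\<close> propagates
  at most by \<open>\<surd>v\<close>, and since \<open>B(x\<^sup>2) = O(x powr - 2 \<sigma>)\<close> it factors through \<open>(I + 4 v L) powr - \<sigma>\<close>. The
  hypothesis at \<open>t = 2 \<surd>v\<close> therefore bounds \<open>B(v L)\<close> on \<open>L\<^sup>1\<close> and on \<open>L\<^sup>\<infinity>\<close> by a multiple of
  \<open>(1 + v) powr \<kappa>\<close>. For \<open>Re p > 0\<close>,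
    \<open>exp (- u / (4 p)) = p powr b * \<integral> exp (- p v) v powr (b - 1) B(v u) dv\<close>  over \<open>v > 0\<close>,
  which bounds \<open>exp (- z L)\<close> for all complex \<open>z = 1 / (4 p)\<close> with \<open>Re z > 0\<close>; (i) is the case
  \<open>z = t (1 - \<i> \<xi>)\<close>. For (ii) take \<open>h\<close> smooth with \<open>h(u) = exp u\<close> for \<open>u \<le> 1\<close>. Then
  \<open>F(u) = F(u) h(u) exp (- u)\<close>, and Fourier inversion for \<open>F\<close> and \<open>h\<close> writes this as a superposition of
  the functions \<open>exp (\<i> (\<xi> + \<omega>) u) exp (- u)\<close>.

  Bounds on \<open>L\<^sup>p\<close> are carried by the forms \<open>\<langle>F(L) f, g\<rangle>\<close>, which are linear in \<open>F\<close>. A form bound against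
  \<open>L\<^sup>1 \<times> L\<^sup>\<infinity>\<close> and \<open>L\<^sup>\<infinity> \<times> L\<^sup>1\<close> yields an operator on \<open>L\<^sup>1 + L\<^sup>\<infinity>\<close>, and truncation at height \<open>s\<close> gives
  \<open>\<integral> (|S f| - M s)\<^sub>+ \<le> M \<integral> (|f| - s)\<^sub>+\<close>; integrating against \<open>s powr (p - 2) ds\<close> is the \<open>L\<^sup>p\<close> bound.
  No spectral theorem enters: the calculus does not use \<open>E(\<real>) = I\<close>, hence it also covers
  the totalisation of the spectral measure by zero.
\<close>

section \<open>Lebesgue spaces with exponents 1, 2 and infinity\<close>

lemma Lp_measurable: "f \<in> Lp \<mu> p \<Longrightarrow> f \<in> borel_measurable \<mu>"
  by (simp add: Lp_def)

lemmas L2_measurable = Lp_measurable[where p = 2]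

lemma Lp_norm_nonneg: "0 \<le> Lp_norm \<mu> p f"
  by (simp add: Lp_norm_def)

lemma Lp_norm_cong_AE:
  assumes "f \<in> borel_measurable \<mu>" "g \<in> borel_measurable \<mu>" "AE x in \<mu>. f x = g x"
  shows "Lp_norm \<mu> p f = Lp_norm \<mu> p g"
proof -
  have "esssup \<mu> (\<lambda>x. ennreal (norm (f x))) = esssup \<mu> (\<lambda>x. ennreal (norm (g x)))"
    using assms by (intro esssup_AE_cong) auto
  moreover have "(\<integral>\<^sup>+x. ennreal (norm (f x) powr q) \<partial>\<mu>) =
      (\<integral>\<^sup>+x. ennreal (norm (g x) powr q) \<partial>\<mu>)" for q
    using assms(3) by (intro nn_integral_cong_AE) auto
  ultimately show ?thesis by (simp add: Lp_norm_def)
qed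

lemma Lp_dominated:
  assumes f: "f \<in> Lp \<mu> p" and g[measurable]: "g \<in> borel_measurable \<mu>"
    and dominated: "AE x in \<mu>. norm (g x) \<le> norm (f x)"
  shows "g \<in> Lp \<mu> p"
proof -
  note [measurable] = Lp_measurable[OF f]
  have "esssup \<mu> (\<lambda>x. ennreal (norm (g x))) \<le> esssup \<mu> (\<lambda>x. ennreal (norm (f x)))"
    using dominated by (intro esssup_AE_mono) (auto elim!: eventually_mono intro: ennreal_leI)
  moreover have "(\<integral>\<^sup>+x. ennreal (norm (g x) powr enn2real p) \<partial>\<mu>) \<le>
      (\<integral>\<^sup>+x. ennreal (norm (f x) powr enn2real p) \<partial>\<mu>)"
    using dominated
    by (intro nn_integral_mono_AE) (auto elim!: eventually_mono intro!: ennreal_leI powr_mono2)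
  ultimately show ?thesis using f by (auto simp: Lp_def split: if_splits intro: le_less_trans)
qed

lemma Lp_cong_AE:
  assumes "f \<in> Lp \<mu> p" "g \<in> borel_measurable \<mu>" "AE x in \<mu>. f x = g x" shows "g \<in> Lp \<mu> p"
  using assms by (auto intro!: Lp_dominated[of f] elim: eventually_mono)

lemma Lp_indicator:
  assumes f: "f \<in> Lp \<mu> p" and A[measurable]: "A \<in> sets \<mu>" shows "(\<lambda>x. indicator A x * f x) \<in> Lp \<mu> p"
proof (rule Lp_dominated[OF f])
  note [measurable] = Lp_measurable[OF f]
  show "(\<lambda>x. indicator A x * f x) \<in> borel_measurable \<mu>" by measurable
qed (simp add: indicator_def)

lemma borel_measurable_cnj [measurable (raw)]:
  "f \<in> borel_measurable M \<Longrightarrow> (\<lambda>x. cnj (f x)) \<in> borel_measurable M"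
  by (rule borel_measurable_continuous_on[OF continuous_on_cnj[OF continuous_on_id]])

lemma Lp_cnj: "f \<in> Lp \<mu> p \<Longrightarrow> (\<lambda>x. cnj (f x)) \<in> Lp \<mu> p"
  by (auto simp: Lp_def split: if_splits)

lemma Lp_norm_cnj [simp]: "Lp_norm \<mu> p (\<lambda>x. cnj (f x)) = Lp_norm \<mu> p f"
  by (simp add: Lp_norm_def)

lemma Lp_1_iff: "f \<in> Lp \<mu> 1 \<longleftrightarrow> integrable \<mu> f"
  by (auto simp: Lp_def integrable_iff_bounded)

lemma Lp_2_iff: "f \<in> Lp \<mu> 2 \<longleftrightarrow> f \<in> borel_measurable \<mu> \<and> integrable \<mu> (\<lambda>x. (norm (f x))\<^sup>2)"
  by (auto simp: Lp_def integrable_iff_bounded)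

lemma Lp_norm_1: "f \<in> Lp \<mu> 1 \<Longrightarrow> Lp_norm \<mu> 1 f = (LINT x|\<mu>. norm (f x))"
  by (simp add: Lp_norm_def Lp_1_iff nn_integral_eq_integral)

lemma Lp_norm_2: "f \<in> Lp \<mu> 2 \<Longrightarrow> Lp_norm \<mu> 2 f = sqrt (LINT x|\<mu>. (norm (f x))\<^sup>2)"
  by (simp add: Lp_norm_def Lp_2_iff nn_integral_eq_integral powr_half_sqrt)

lemma Lp_norm_2_power2: "f \<in> Lp \<mu> 2 \<Longrightarrow> (Lp_norm \<mu> 2 f)\<^sup>2 = (LINT x|\<mu>. (norm (f x))\<^sup>2)"
  by (simp add: Lp_norm_2)

lemma esssup_norm_le:
  assumes "f \<in> borel_measurable \<mu>" "AE x in \<mu>. norm (f x) \<le> B"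
  shows "esssup \<mu> (\<lambda>x. ennreal (norm (f x))) \<le> ennreal B"
  using assms by (intro esssup_I) (auto elim!: eventually_mono intro!: ennreal_leI)

lemma Lp_infinityI:
  assumes "f \<in> borel_measurable \<mu>" "AE x in \<mu>. norm (f x) \<le> B"
  shows "f \<in> Lp \<mu> \<infinity>"
  using assms le_less_trans[OF esssup_norm_le[OF assms] ennreal_less_top] by (simp add: Lp_def)

lemma Lp_norm_infinity_le:
  assumes "f \<in> borel_measurable \<mu>" "0 \<le> B" "AE x in \<mu>. norm (f x) \<le> B"
  shows "Lp_norm \<mu> \<infinity> f \<le> B"
  using esssup_norm_le[OF assms(1,3)] assms(2) by (simp add: Lp_norm_def enn2real_leI)

lemma AE_norm_le_Lp_norm_infinity:
  assumes "f \<in> Lp \<mu> \<infinity>" shows "AE x in \<mu>. norm (f x) \<le> Lp_norm \<mu> \<infinity> f"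
proof -
  have "esssup \<mu> (\<lambda>x. ennreal (norm (f x))) < top" using assms by (simp add: Lp_def)
  then have "norm (f x) \<le> Lp_norm \<mu> \<infinity> f"
    if "ennreal (norm (f x)) \<le> esssup \<mu> (\<lambda>x. ennreal (norm (f x)))" for x
    using enn2real_mono[OF that] by (simp add: Lp_norm_def)
  from eventually_mono[OF esssup_AE this] show ?thesis .
qed

lemma
  assumes f: "f \<in> Lp \<mu> 1" and g: "g \<in> Lp \<mu> \<infinity>"
  shows L1_Linfinity_integrable_mult: "integrable \<mu> (\<lambda>x. f x * g x)"
    and L1_Linfinity_Holder_norm: "(LINT x|\<mu>. norm (f x * g x)) \<le> Lp_norm \<mu> 1 f * Lp_norm \<mu> \<infinity> g"
    and L1_Linfinity_Holder: "norm (LINT x|\<mu>. f x * g x) \<le> Lp_norm \<mu> 1 f * Lp_norm \<mu> \<infinity> g"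
proof -
  note [measurable] = Lp_measurable[OF f] Lp_measurable[OF g]
  have AE_le: "AE x in \<mu>. norm (f x * g x) \<le> norm (f x) * Lp_norm \<mu> \<infinity> g"
    using AE_norm_le_Lp_norm_infinity[OF g] by eventually_elim (simp add: norm_mult mult_left_mono)
  have dominating: "integrable \<mu> (\<lambda>x. norm (f x) * Lp_norm \<mu> \<infinity> g)" using f by (simp add: Lp_1_iff)
  show integrable_product: "integrable \<mu> (\<lambda>x. f x * g x)"
    by (rule Bochner_Integration.integrable_bound[OF dominating])
      (use AE_le in \<open>auto elim: eventually_mono\<close>)
  have "(LINT x|\<mu>. norm (f x * g x)) \<le> (LINT x|\<mu>. norm (f x) * Lp_norm \<mu> \<infinity> g)"
    by (rule integral_mono_AE[OF integrable_norm[OF integrable_product] dominating AE_le])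
  then show norm_le: "(LINT x|\<mu>. norm (f x * g x)) \<le> Lp_norm \<mu> 1 f * Lp_norm \<mu> \<infinity> g"
    using f by (simp add: Lp_norm_1)
  show "norm (LINT x|\<mu>. f x * g x) \<le> Lp_norm \<mu> 1 f * Lp_norm \<mu> \<infinity> g"
    by (rule order_trans[OF integral_norm_bound norm_le])
qed

lemma L1_Linfinity_imp_L2:
  assumes f: "f \<in> Lp \<mu> 1" "f \<in> Lp \<mu> \<infinity>" shows "f \<in> Lp \<mu> 2"
proof -
  note [measurable] = Lp_measurable[OF f(1)]
  have "integrable \<mu> (\<lambda>x. (norm (f x))\<^sup>2)"
  proof (rule Bochner_Integration.integrable_bound)
    show "integrable \<mu> (\<lambda>x. norm (f x) * Lp_norm \<mu> \<infinity> f)" using f(1) by (simp add: Lp_1_iff)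
    show "AE x in \<mu>. norm ((norm (f x))\<^sup>2) \<le> norm (norm (f x) * Lp_norm \<mu> \<infinity> f)"
      using AE_norm_le_Lp_norm_infinity[OF f(2)]
      by eventually_elim (simp add: power2_eq_square abs_mult abs_of_nonneg Lp_norm_nonneg
          mult_left_mono)
  qed measurable
  then show ?thesis by (simp add: Lp_2_iff)
qed

lemma norm_add_power2_le:
  fixes a b :: "'b::real_normed_vector"
  shows "(norm (a + b))\<^sup>2 \<le> 2 * (norm a)\<^sup>2 + 2 * (norm b)\<^sup>2"
proof -
  have "(norm (a + b))\<^sup>2 \<le> (norm a + norm b)\<^sup>2" by (intro power_mono norm_triangle_ineq) auto
  also have "\<dots> \<le> 2 * (norm a)\<^sup>2 + 2 * (norm b)\<^sup>2"
    using sum_squares_bound[of "norm a" "norm b"] by (simp add: power2_sum)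
  finally show ?thesis .
qed

lemma L2_add:
  assumes "f \<in> Lp \<mu> 2" "g \<in> Lp \<mu> 2" shows "(\<lambda>x. f x + g x) \<in> Lp \<mu> 2"
proof -
  note [measurable] = assms[THEN Lp_measurable]
  have "integrable \<mu> (\<lambda>x. (norm (f x + g x))\<^sup>2)"
    by (rule
        Bochner_Integration.integrable_bound[where f="\<lambda>x. 2 * (norm (f x))\<^sup>2 + 2 * (norm (g x))\<^sup>2"])
      (use assms in \<open>auto simp: Lp_2_iff intro!: norm_add_power2_le\<close>)
  then show ?thesis by (simp add: Lp_2_iff)
qed

lemma L2_scale: "f \<in> Lp \<mu> 2 \<Longrightarrow> (\<lambda>x. c * f x) \<in> Lp \<mu> 2"
  by (auto simp: Lp_2_iff norm_mult power_mult_distrib)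

lemma L2_diff: "f \<in> Lp \<mu> 2 \<Longrightarrow> g \<in> Lp \<mu> 2 \<Longrightarrow> (\<lambda>x. f x - g x) \<in> Lp \<mu> 2"
  using L2_add[OF _ L2_scale[of g \<mu> "-1"], of f] by simp

lemma L2_zero: "(\<lambda>x. 0) \<in> Lp \<mu> 2"
  by (simp add: Lp_2_iff)

lemma L2_integrable_mult:
  assumes "f \<in> Lp \<mu> 2" "g \<in> Lp \<mu> 2" shows "integrable \<mu> (\<lambda>x. f x * g x)"
proof (rule Bochner_Integration.integrable_bound)
  show "integrable \<mu> (\<lambda>x. (norm (f x))\<^sup>2 + (norm (g x))\<^sup>2)" using assms by (simp add: Lp_2_iff)
  have "norm (a * b) \<le> (norm a)\<^sup>2 + (norm b)\<^sup>2" for a b :: complex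
  proof -
    have "0 \<le> norm a * norm b" by simp
    then show ?thesis using sum_squares_bound[of "norm a" "norm b"] unfolding norm_mult by linarith
  qed
  then show "AE x in \<mu>. norm (f x * g x) \<le> norm ((norm (f x))\<^sup>2 + (norm (g x))\<^sup>2)" by simp
qed (use assms in \<open>auto simp: Lp_2_iff\<close>)

lemma L2_inner_integrable:
  assumes "f \<in> Lp \<mu> 2" "g \<in> Lp \<mu> 2" shows "integrable \<mu> (\<lambda>x. f x * cnj (g x))"
  using L2_integrable_mult[OF assms(1) Lp_cnj[OF assms(2)]] .

lemma L2_inner_add_left:
  "f \<in> Lp \<mu> 2 \<Longrightarrow> g \<in> Lp \<mu> 2 \<Longrightarrow> h \<in> Lp \<mu> 2 \<Longrightarrow>
    L2_inner \<mu> (\<lambda>x. f x + g x) h = L2_inner \<mu> f h + L2_inner \<mu> g h"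
  by (simp add: L2_inner_def L2_inner_integrable distrib_right)

lemma L2_inner_diff_left:
  "f \<in> Lp \<mu> 2 \<Longrightarrow> g \<in> Lp \<mu> 2 \<Longrightarrow> h \<in> Lp \<mu> 2 \<Longrightarrow>
    L2_inner \<mu> (\<lambda>x. f x - g x) h = L2_inner \<mu> f h - L2_inner \<mu> g h"
  by (simp add: L2_inner_def L2_inner_integrable left_diff_distrib)

lemma L2_inner_scale_left: "L2_inner \<mu> (\<lambda>x. c * f x) h = c * L2_inner \<mu> f h"
  by (simp add: L2_inner_def mult.assoc)

lemma L2_inner_add_right:
  "f \<in> Lp \<mu> 2 \<Longrightarrow> g \<in> Lp \<mu> 2 \<Longrightarrow> h \<in> Lp \<mu> 2 \<Longrightarrow>
    L2_inner \<mu> h (\<lambda>x. f x + g x) = L2_inner \<mu> h f + L2_inner \<mu> h g"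
  by (simp add: L2_inner_def L2_inner_integrable distrib_left)

lemma L2_inner_diff_right:
  "f \<in> Lp \<mu> 2 \<Longrightarrow> g \<in> Lp \<mu> 2 \<Longrightarrow> h \<in> Lp \<mu> 2 \<Longrightarrow>
    L2_inner \<mu> h (\<lambda>x. f x - g x) = L2_inner \<mu> h f - L2_inner \<mu> h g"
  by (simp add: L2_inner_def L2_inner_integrable right_diff_distrib)

lemma L2_inner_scale_right: "L2_inner \<mu> h (\<lambda>x. c * f x) = cnj c * L2_inner \<mu> h f"
  by (simp add: L2_inner_def mult.left_commute)

lemma L2_inner_cnj: "cnj (L2_inner \<mu> f g) = L2_inner \<mu> g f"
proof -
  have "cnj (L2_inner \<mu> f g) = (LINT x|\<mu>. cnj (f x * cnj (g x)))"
    unfolding L2_inner_def by (rule Bochner_Integration.integral_cnj[symmetric])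
  then show ?thesis by (simp add: L2_inner_def mult.commute)
qed

lemma L2_inner_cong_left:
  assumes "AE x in \<mu>. f x = f' x" "f \<in> borel_measurable \<mu>" "f' \<in> borel_measurable \<mu>"
    "g \<in> borel_measurable \<mu>"
  shows "L2_inner \<mu> f g = L2_inner \<mu> f' g"
  unfolding L2_inner_def by (rule integral_cong_AE) (use assms in auto)

lemma L2_inner_self:
  assumes "f \<in> Lp \<mu> 2" shows "L2_inner \<mu> f f = complex_of_real ((Lp_norm \<mu> 2 f)\<^sup>2)"
proof -
  have "L2_inner \<mu> f f = (LINT x|\<mu>. complex_of_real ((norm (f x))\<^sup>2))"
    unfolding L2_inner_def complex_norm_square ..
  then show ?thesis using assms by (simp only: integral_complex_of_real Lp_norm_2_power2)
qed

lemma L2_norm_eq_0_imp_AE: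
  assumes "f \<in> Lp \<mu> 2" "Lp_norm \<mu> 2 f = 0" shows "AE x in \<mu>. f x = 0"
proof -
  have "(LINT x|\<mu>. (norm (f x))\<^sup>2) = 0" using Lp_norm_2_power2[OF assms(1)] assms(2) by simp
  then have "AE x in \<mu>. (norm (f x))\<^sup>2 = 0"
    using assms(1) by (subst (asm) integral_nonneg_eq_0_iff_AE) (auto simp: Lp_2_iff)
  then show ?thesis by eventually_elim simp
qed

lemma L2_AE_eqI:
  assumes "f \<in> Lp \<mu> 2" "g \<in> Lp \<mu> 2" "\<And>h. h \<in> Lp \<mu> 2 \<Longrightarrow> L2_inner \<mu> f h = L2_inner \<mu> g h"
  shows "AE x in \<mu>. f x = g x"
proof -
  have diff_L2: "(\<lambda>x. f x - g x) \<in> Lp \<mu> 2" using assms by (simp add: L2_diff)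
  then have "Lp_norm \<mu> 2 (\<lambda>x. f x - g x) = 0"
    using assms L2_inner_self[OF diff_L2] by (simp add: L2_inner_diff_left)
  from L2_norm_eq_0_imp_AE[OF diff_L2 this] show ?thesis by simp
qed

lemma AE_zero_on_if_L2_orthogonal_restriction:
  assumes h: "h \<in> Lp \<mu> 2" and A: "A \<in> sets \<mu>"
    and orthogonal: "L2_inner \<mu> h (\<lambda>x. indicator A x * h x) = 0"
  shows "AE x in \<mu>. x \<in> A \<longrightarrow> h x = 0"
proof -
  let ?r = "\<lambda>x. indicator A x * h x"
  have restriction_L2: "?r \<in> Lp \<mu> 2" using Lp_indicator[OF h A] .
  have "L2_inner \<mu> ?r ?r = L2_inner \<mu> h ?r"
    unfolding L2_inner_def by (intro Bochner_Integration.integral_cong) (auto simp: indicator_def)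
  then have "AE x in \<mu>. ?r x = 0"
    using orthogonal L2_inner_self[OF restriction_L2]
    by (intro L2_norm_eq_0_imp_AE restriction_L2) simp
  then show ?thesis by eventually_elim (auto simp: indicator_def split: if_splits)
qed

lemma L2_Cauchy_Schwarz_norm:
  assumes "f \<in> Lp \<mu> 2" "g \<in> Lp \<mu> 2"
  shows "(LINT x|\<mu>. norm (f x) * norm (g x)) \<le> Lp_norm \<mu> 2 f * Lp_norm \<mu> 2 g"
proof -
  note [measurable] = assms[THEN Lp_measurable]
  have integrable_product: "integrable \<mu> (\<lambda>x. norm (f x) * norm (g x))"
    using integrable_norm[OF L2_integrable_mult[OF assms]] by (simp add: norm_mult)
  have "(\<integral>\<^sup>+x. ennreal (norm (f x)) * ennreal (norm (g x)) \<partial>\<mu>)\<^sup>2 \<le>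
     (\<integral>\<^sup>+x. (ennreal (norm (f x)))\<^sup>2 \<partial>\<mu>) * (\<integral>\<^sup>+x. (ennreal (norm (g x)))\<^sup>2 \<partial>\<mu>)"
    by (rule Cauchy_Schwarz_nn_integral) auto
  then have "ennreal ((LINT x|\<mu>. norm (f x) * norm (g x))\<^sup>2) \<le>
     ennreal ((LINT x|\<mu>. (norm (f x))\<^sup>2) * (LINT x|\<mu>. (norm (g x))\<^sup>2))"
    using assms integrable_product
    by (simp add: Lp_2_iff ennreal_mult[symmetric] ennreal_power nn_integral_eq_integral)
  then have "(LINT x|\<mu>. norm (f x) * norm (g x))\<^sup>2 \<le> (Lp_norm \<mu> 2 f * Lp_norm \<mu> 2 g)\<^sup>2"
    using assms by (subst (asm) ennreal_le_iff) (auto simp: power_mult_distrib Lp_norm_2_power2)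
  then show ?thesis by (rule power2_le_imp_le) (simp add: Lp_norm_nonneg)
qed

lemma L2_Cauchy_Schwarz:
  assumes "f \<in> Lp \<mu> 2" "g \<in> Lp \<mu> 2"
  shows "norm (L2_inner \<mu> f g) \<le> Lp_norm \<mu> 2 f * Lp_norm \<mu> 2 g"
proof -
  have "norm (L2_inner \<mu> f g) \<le> (LINT x|\<mu>. norm (f x * cnj (g x)))"
    unfolding L2_inner_def by (rule integral_norm_bound)
  then show ?thesis using L2_Cauchy_Schwarz_norm[OF assms] by (simp add: norm_mult)
qed

lemma L2_norm_scale: "f \<in> Lp \<mu> 2 \<Longrightarrow> Lp_norm \<mu> 2 (\<lambda>x. c * f x) = norm c * Lp_norm \<mu> 2 f"
  by (simp add: Lp_norm_2 L2_scale norm_mult power_mult_distrib real_sqrt_mult)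

lemma L2_norm_add_power2:
  assumes "f \<in> Lp \<mu> 2" "g \<in> Lp \<mu> 2"
  shows "(Lp_norm \<mu> 2 (\<lambda>x. f x + g x))\<^sup>2 =
      (Lp_norm \<mu> 2 f)\<^sup>2 + 2 * Re (L2_inner \<mu> f g) + (Lp_norm \<mu> 2 g)\<^sup>2"
proof -
  have "complex_of_real ((Lp_norm \<mu> 2 (\<lambda>x. f x + g x))\<^sup>2) =
      L2_inner \<mu> (\<lambda>x. f x + g x) (\<lambda>x. f x + g x)"
    using assms by (simp only: L2_inner_self L2_add)
  also have "\<dots> = L2_inner \<mu> f f + (L2_inner \<mu> f g + cnj (L2_inner \<mu> f g)) + L2_inner \<mu> g g"
    using assms by (simp add: L2_add L2_inner_add_left L2_inner_add_right L2_inner_cnj)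
  finally show ?thesis using assms by (simp only: L2_inner_self complex_eq_iff) simp
qed

lemma L2_norm_triangle:
  assumes "f \<in> Lp \<mu> 2" "g \<in> Lp \<mu> 2"
  shows "Lp_norm \<mu> 2 (\<lambda>x. f x + g x) \<le> Lp_norm \<mu> 2 f + Lp_norm \<mu> 2 g"
proof (rule power2_le_imp_le)
  show "(Lp_norm \<mu> 2 (\<lambda>x. f x + g x))\<^sup>2 \<le> (Lp_norm \<mu> 2 f + Lp_norm \<mu> 2 g)\<^sup>2"
    using L2_Cauchy_Schwarz[OF assms] complex_Re_le_cmod[of "L2_inner \<mu> f g"]
    unfolding L2_norm_add_power2[OF assms] power2_sum by (simp add: mult.commute)
qed (simp add: Lp_norm_nonneg)

lemma L2_sum:
  assumes "finite I" "\<And>i. i \<in> I \<Longrightarrow> f i \<in> Lp \<mu> 2"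
  shows "(\<lambda>x. \<Sum>i\<in>I. f i x) \<in> Lp \<mu> 2"
  using assms by (induction I) (simp_all add: L2_zero L2_add)

lemma L2_norm_sum_le:
  assumes "finite I" "\<And>i. i \<in> I \<Longrightarrow> f i \<in> Lp \<mu> 2"
  shows "Lp_norm \<mu> 2 (\<lambda>x. \<Sum>i\<in>I. f i x) \<le> (\<Sum>i\<in>I. Lp_norm \<mu> 2 (f i))"
  using assms
proof (induction I)
  case empty
  show ?case by (simp add: Lp_norm_2 L2_zero)
next
  case (insert i I)
  then show ?case
    using L2_norm_triangle[of "f i" \<mu> "\<lambda>x. \<Sum>i\<in>I. f i x"] L2_sum[of I f \<mu>] by fastforce
qed

section \<open>Completeness of the Hilbert space and the Riesz representation\<close>

lemma L2_Fatou:
  assumes f: "\<And>n. f n \<in> Lp \<mu> 2" and norm_le: "\<And>n. Lp_norm \<mu> 2 (f n) \<le> C"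
    and g[measurable]: "g \<in> borel_measurable \<mu>" and lim: "AE x in \<mu>. (\<lambda>n. f n x) \<longlonglongrightarrow> g x"
  shows "g \<in> Lp \<mu> 2" "Lp_norm \<mu> 2 g \<le> C"
proof -
  note [measurable] = f[THEN Lp_measurable]
  have C_nonneg: "C \<ge> 0" using norm_le[of 0] Lp_norm_nonneg order_trans by blast
  have "(\<integral>\<^sup>+x. ennreal ((norm (g x))\<^sup>2) \<partial>\<mu>) = (\<integral>\<^sup>+x. liminf (\<lambda>n. ennreal ((norm (f n x))\<^sup>2)) \<partial>\<mu>)"
  proof (rule nn_integral_cong_AE, use lim in eventually_elim)
    case (elim x)
    have "(\<lambda>n. ennreal ((norm (f n x))\<^sup>2)) \<longlonglongrightarrow> ennreal ((norm (g x))\<^sup>2)"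
      by (intro tendsto_intros elim)
    from lim_imp_Liminf[OF _ this] show ?case by simp
  qed
  also have "\<dots> \<le> liminf (\<lambda>n. \<integral>\<^sup>+x. ennreal ((norm (f n x))\<^sup>2) \<partial>\<mu>)" by (rule nn_integral_liminf) auto
  also have "\<dots> \<le> liminf (\<lambda>n::nat. ennreal (C\<^sup>2))"
  proof (intro Liminf_mono always_eventually allI)
    fix n
    have "(\<integral>\<^sup>+x. ennreal ((norm (f n x))\<^sup>2) \<partial>\<mu>) = ennreal ((Lp_norm \<mu> 2 (f n))\<^sup>2)"
      using f[of n] by (simp add: Lp_norm_2_power2 Lp_2_iff nn_integral_eq_integral)
    then show "(\<integral>\<^sup>+x. ennreal ((norm (f n x))\<^sup>2) \<partial>\<mu>) \<le> ennreal (C\<^sup>2)"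
      using norm_le[of n] by (simp add: ennreal_leI power_mono Lp_norm_nonneg)
  qed
  finally have nn_integral_le: "(\<integral>\<^sup>+x. ennreal ((norm (g x))\<^sup>2) \<partial>\<mu>) \<le> ennreal (C\<^sup>2)"
    by (simp add: Liminf_const)
  then show g_L2: "g \<in> Lp \<mu> 2"
    using le_less_trans[OF nn_integral_le ennreal_less_top]
    by (auto simp: Lp_2_iff integrable_iff_bounded)
  from nn_integral_le have "(Lp_norm \<mu> 2 g)\<^sup>2 \<le> C\<^sup>2"
    using g_L2 by (subst (asm) nn_integral_eq_integral) (auto simp: Lp_2_iff Lp_norm_2_power2)
  then show "Lp_norm \<mu> 2 g \<le> C" using C_nonneg by (rule power2_le_imp_le)
qed

lemma nn_integral_sum_norm_power2_le:
  assumes I: "finite I" and d: "\<And>k. k \<in> I \<Longrightarrow> d k \<in> Lp \<mu> 2"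
  shows "(\<integral>\<^sup>+x. ennreal ((\<Sum>k\<in>I. norm (d k x))\<^sup>2) \<partial>\<mu>) \<le> ennreal ((\<Sum>k\<in>I. Lp_norm \<mu> 2 (d k))\<^sup>2)"
proof -
  let ?s = "\<lambda>x. \<Sum>k\<in>I. complex_of_real (norm (d k x))"
  have norm_d: "(\<lambda>x. complex_of_real (norm (d k x))) \<in> Lp \<mu> 2" if "k \<in> I" for k
    using d[OF that] by (auto simp: Lp_2_iff)
  have sum_L2: "?s \<in> Lp \<mu> 2" using I norm_d by (rule L2_sum)
  have "Lp_norm \<mu> 2 ?s \<le> (\<Sum>k\<in>I. Lp_norm \<mu> 2 (d k))"
    using L2_norm_sum_le[OF I norm_d] by (simp add: Lp_norm_def)
  then have "(Lp_norm \<mu> 2 ?s)\<^sup>2 \<le> (\<Sum>k\<in>I. Lp_norm \<mu> 2 (d k))\<^sup>2" by (intro power_mono Lp_norm_nonneg)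
  moreover have "norm (?s x) = (\<Sum>k\<in>I. norm (d k x))" for x
    unfolding of_real_sum[symmetric] norm_of_real by (simp add: sum_nonneg)
  ultimately show ?thesis
    using sum_L2
    by (subst nn_integral_eq_integral)
      (auto simp: Lp_2_iff Lp_norm_2_power2[OF sum_L2] intro: ennreal_leI)
qed

lemma AE_summable_if_summable_L2_norm:
  assumes d: "\<And>k. d k \<in> Lp \<mu> 2" and summable: "summable (\<lambda>k. Lp_norm \<mu> 2 (d k))"
  shows "AE x in \<mu>. summable (\<lambda>k. norm (d k x))"
proof -
  note [measurable] = d[THEN Lp_measurable]
  define s where "s n x = (\<Sum>k<n. norm (d k x))" for n x
  define B where "B = (\<Sum>k. Lp_norm \<mu> 2 (d k))"
  have [measurable]: "s n \<in> borel_measurable \<mu>" for n unfolding s_def by measurable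
  have s_nonneg: "s n x \<ge> 0" for n x by (simp add: s_def sum_nonneg)
  have bound: "(\<integral>\<^sup>+x. ennreal ((s n x)\<^sup>2) \<partial>\<mu>) \<le> ennreal (B\<^sup>2)" for n
  proof -
    have "(\<integral>\<^sup>+x. ennreal ((s n x)\<^sup>2) \<partial>\<mu>) \<le> ennreal ((\<Sum>k<n. Lp_norm \<mu> 2 (d k))\<^sup>2)"
      unfolding s_def by (rule nn_integral_sum_norm_power2_le) (auto simp: d)
    also have "\<dots> \<le> ennreal (B\<^sup>2)" unfolding B_def
      by (intro ennreal_leI power_mono sum_le_suminf summable sum_nonneg)
        (auto simp: Lp_norm_nonneg)
    finally show ?thesis .
  qed
  have "(\<integral>\<^sup>+x. (SUP n. ennreal ((s n x)\<^sup>2)) \<partial>\<mu>) = (SUP n. \<integral>\<^sup>+x. ennreal ((s n x)\<^sup>2) \<partial>\<mu>)"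
  proof (rule nn_integral_monotone_convergence_SUP)
    have "s m x \<le> s n x" if "m \<le> n" for m n x unfolding s_def using that by (intro sum_mono2) auto
    then show "incseq (\<lambda>n x. ennreal ((s n x)\<^sup>2))"
      using s_nonneg by (auto simp: incseq_def le_fun_def intro!: ennreal_leI power_mono)
  qed auto
  also have "\<dots> \<le> ennreal (B\<^sup>2)" by (intro SUP_least bound)
  finally have "(\<integral>\<^sup>+x. (SUP n. ennreal ((s n x)\<^sup>2)) \<partial>\<mu>) \<noteq> \<infinity>" by (auto simp: top_unique)
  then have "AE x in \<mu>. (SUP n. ennreal ((s n x)\<^sup>2)) \<noteq> \<infinity>" by (intro nn_integral_noteq_infinite) auto
  then show ?thesis
  proof eventually_elim
    case (elim x)
    then obtain c where "c \<ge> 0" and SUP_eq: "(SUP n. ennreal ((s n x)\<^sup>2)) = ennreal c"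
      by (cases "SUP n. ennreal ((s n x)\<^sup>2)") auto
    have "s n x \<le> sqrt c" for n
    proof -
      have "ennreal ((s n x)\<^sup>2) \<le> ennreal c" unfolding SUP_eq[symmetric] by (rule SUP_upper) simp
      then show ?thesis using \<open>c \<ge> 0\<close> by (simp add: real_le_rsqrt)
    qed
    then show ?case by (intro summableI_nonneg_bounded[where x="sqrt c"]) (auto simp: s_def)
  qed
qed

lemma L2_complete:
  assumes u: "\<And>n. u n \<in> Lp \<mu> 2" and summable: "summable (\<lambda>n. Lp_norm \<mu> 2 (\<lambda>x. u (Suc n) x - u n x))"
  shows "\<exists>h\<in>Lp \<mu> 2. (\<lambda>n. Lp_norm \<mu> 2 (\<lambda>x. u n x - h x)) \<longlonglongrightarrow> 0"
proof -
  note [measurable] = u[THEN Lp_measurable]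
  let ?d = "\<lambda>n x. u (Suc n) x - u n x"
  define h where "h x = lim (\<lambda>n. u n x)" for x
  have h[measurable]: "h \<in> borel_measurable \<mu>" unfolding h_def by measurable
  have lim: "AE x in \<mu>. (\<lambda>n. u n x) \<longlonglongrightarrow> h x"
    using AE_summable_if_summable_L2_norm[of ?d, OF L2_diff[OF u u] summable]
  proof eventually_elim
    case (elim x)
    have "(\<lambda>n. u 0 x + (\<Sum>k<n. ?d k x)) \<longlonglongrightarrow> u 0 x + (\<Sum>k. ?d k x)"
      by (intro tendsto_add tendsto_const summable_LIMSEQ summable_norm_cancel[OF elim])
    then have "(\<lambda>n. u n x) \<longlonglongrightarrow> u 0 x + (\<Sum>k. ?d k x)"
      unfolding sum_lessThan_telescope[of "\<lambda>k. u k x"] by simp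
    with limI[OF this] show ?case by (simp add: h_def)
  qed
  define t where "t n = (\<Sum>k. Lp_norm \<mu> 2 (?d (k + n)))" for n
  have dist_le: "Lp_norm \<mu> 2 (\<lambda>x. u (n + m) x - u n x) \<le> t n" for n m
  proof -
    have "(\<lambda>x. u (n + m) x - u n x) = (\<lambda>x. \<Sum>k<m. ?d (k + n) x)"
      using sum_lessThan_telescope[of "\<lambda>k. u (k + n) x" m for x] by (simp add: add.commute)
    then have "Lp_norm \<mu> 2 (\<lambda>x. u (n + m) x - u n x) \<le> (\<Sum>k<m. Lp_norm \<mu> 2 (?d (k + n)))"
      using L2_norm_sum_le[of "{..<m}" "\<lambda>k. ?d (k + n)" \<mu>] L2_diff[OF u u] by simp
    also have "\<dots> \<le> t n"
      unfolding t_def using summable_ignore_initial_segment[OF summable]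
      by (intro sum_le_suminf) (auto simp: Lp_norm_nonneg)
    finally show ?thesis .
  qed
  have lim_shift: "AE x in \<mu>. (\<lambda>m. u (n + m) x - u n x) \<longlonglongrightarrow> h x - u n x" for n
    using lim
    by eventually_elim (intro tendsto_diff tendsto_const, subst add.commute, rule
        LIMSEQ_ignore_initial_segment)
  note tail = L2_Fatou[OF L2_diff[OF u u] dist_le _ lim_shift]
  have h_L2: "h \<in> Lp \<mu> 2" using L2_add[OF tail(1)[of 0] u[of 0]] by simp
  have "(\<lambda>n. Lp_norm \<mu> 2 (\<lambda>x. u n x - h x)) \<longlonglongrightarrow> 0"
  proof (rule Lim_null_comparison)
    show "\<forall>\<^sub>F n in sequentially. norm (Lp_norm \<mu> 2 (\<lambda>x. u n x - h x)) \<le> t n"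
      using tail(2) L2_norm_scale[of "\<lambda>x. u _ x - h x" \<mu> "-1", OF L2_diff[OF u h_L2]]
      by (intro always_eventually) (simp add: Lp_norm_nonneg)
    show "t \<longlonglongrightarrow> 0" unfolding t_def by (rule suminf_exist_split2[OF summable])
  qed
  then show ?thesis using h_L2 by blast
qed

lemma tendsto_L2_inner_right:
  assumes g: "g \<in> Lp \<mu> 2" and f: "\<And>n. f n \<in> Lp \<mu> 2" and h: "h \<in> Lp \<mu> 2"
    and lim: "(\<lambda>n. Lp_norm \<mu> 2 (\<lambda>x. f n x - h x)) \<longlonglongrightarrow> 0"
  shows "(\<lambda>n. L2_inner \<mu> g (f n)) \<longlonglongrightarrow> L2_inner \<mu> g h"
proof -
  have "(\<lambda>n. L2_inner \<mu> g (\<lambda>x. f n x - h x)) \<longlonglongrightarrow> 0"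
  proof (rule Lim_null_comparison[OF always_eventually], rule allI)
    show "norm (L2_inner \<mu> g (\<lambda>x. f n x - h x)) \<le>
        Lp_norm \<mu> 2 g * Lp_norm \<mu> 2 (\<lambda>x. f n x - h x)" for n
      by (rule L2_Cauchy_Schwarz[OF g L2_diff[OF f h]])
    show "(\<lambda>n. Lp_norm \<mu> 2 g * Lp_norm \<mu> 2 (\<lambda>x. f n x - h x)) \<longlonglongrightarrow> 0"
      by (rule tendsto_mult_right_zero[OF lim])
  qed
  then show ?thesis using g f h by (simp add: L2_inner_diff_right LIM_zero_iff)
qed

lemma linear_coeff_eq_0_if_quadratic_nonneg:
  fixes c G :: real
  assumes nonneg: "\<And>t. 0 \<le> 2 * t * c + t\<^sup>2 * G" and G: "0 \<le> G"
  shows "c = 0"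
proof (rule ccontr)
  assume c: "c \<noteq> 0"
  define a where "a = G + 1"
  have a_pos: "a > 0" using G by (simp add: a_def)
  have "0 \<le> 2 * (- c / a) * c + (- c / a)\<^sup>2 * G" by (rule nonneg)
  also have "\<dots> \<le> 2 * (- c / a) * c + (- c / a)\<^sup>2 * a"
    by (intro add_left_mono mult_left_mono) (auto simp: a_def)
  also have "\<dots> = - (c\<^sup>2 / a)" using a_pos by (simp add: power2_eq_square field_simps)
  also have "\<dots> < 0" using c a_pos by simp
  finally show False by simp
qed

context
  fixes \<mu> :: "'a measure" and \<phi> :: "('a \<Rightarrow> complex) \<Rightarrow> complex" and K :: real
  assumes \<phi>_add: "\<And>f g. f \<in> Lp \<mu> 2 \<Longrightarrow> g \<in> Lp \<mu> 2 \<Longrightarrow> \<phi> (\<lambda>x. f x + g x) = \<phi> f + \<phi> g"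
    and \<phi>_scale: "\<And>f c. f \<in> Lp \<mu> 2 \<Longrightarrow> \<phi> (\<lambda>x. c * f x) = c * \<phi> f"
    and \<phi>_bound: "\<And>f. f \<in> Lp \<mu> 2 \<Longrightarrow> norm (\<phi> f) \<le> K * Lp_norm \<mu> 2 f"
begin

definition riesz_energy :: "('a \<Rightarrow> complex) \<Rightarrow> real" where
  "riesz_energy f = (Lp_norm \<mu> 2 f)\<^sup>2 - 2 * Re (\<phi> f)"

lemma riesz_energy_ge: "f \<in> Lp \<mu> 2 \<Longrightarrow> - K\<^sup>2 \<le> riesz_energy f"
proof -
  assume f: "f \<in> Lp \<mu> 2"
  have "Re (\<phi> f) \<le> K * Lp_norm \<mu> 2 f" using \<phi>_bound[OF f] complex_Re_le_cmod[of "\<phi> f"] by linarith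
  then show ?thesis using sum_squares_bound[of K "Lp_norm \<mu> 2 f"] by (simp add: riesz_energy_def)
qed

lemma riesz_energy_add_scale:
  assumes f: "f \<in> Lp \<mu> 2" and g: "g \<in> Lp \<mu> 2"
  shows "riesz_energy (\<lambda>x. f x + complex_of_real t * g x) =
    riesz_energy f + 2 * t * Re (L2_inner \<mu> g f - \<phi> g) + t\<^sup>2 * (Lp_norm \<mu> 2 g)\<^sup>2"
proof -
  have tg_L2: "(\<lambda>x. complex_of_real t * g x) \<in> Lp \<mu> 2" using g by (rule L2_scale)
  have "Re (L2_inner \<mu> f g) = Re (L2_inner \<mu> g f)"
    using L2_inner_cnj[of \<mu> f g] by (simp add: complex_eq_iff)
  then show ?thesis
    using f g tg_L2
    by (simp add: riesz_energy_def L2_norm_add_power2 \<phi>_add \<phi>_scale L2_inner_scale_right L2_norm_scale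
        power_mult_distrib algebra_simps)
qed

text \<open>The parallelogram law makes near-minimisers of the energy close to each other.\<close>
lemma riesz_energy_parallelogram:
  assumes f: "f \<in> Lp \<mu> 2" and g: "g \<in> Lp \<mu> 2" and d_le: "\<And>h. h \<in> Lp \<mu> 2 \<Longrightarrow> d \<le> riesz_energy h"
  shows "(Lp_norm \<mu> 2 (\<lambda>x. g x - f x))\<^sup>2 \<le> 2 * riesz_energy f + 2 * riesz_energy g - 4 * d"
proof -
  define h where "h x = g x - f x" for x
  have h: "h \<in> Lp \<mu> 2" unfolding h_def using f g by (intro L2_diff)
  have "d \<le> riesz_energy (\<lambda>x. f x + complex_of_real (1/2) * h x)"
    using f h by (intro d_le L2_add L2_scale)
  moreover have "g = (\<lambda>x. f x + complex_of_real 1 * h x)" by (simp add: h_def)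
  ultimately show ?thesis
    using riesz_energy_add_scale[OF f h, of "1/2"] riesz_energy_add_scale[OF f h, of 1]
    unfolding h_def[symmetric] by (simp add: power2_eq_square)
qed

lemma riesz_minimising_sequence:
  obtains u d where "\<And>n::nat. u n \<in> Lp \<mu> 2" "\<And>f. f \<in> Lp \<mu> 2 \<Longrightarrow> d \<le> riesz_energy f"
    "\<And>n. riesz_energy (u n) < d + (1/4) ^ n"
proof -
  define d where "d = (INF f\<in>Lp \<mu> 2. riesz_energy f)"
  have bounded_below: "bdd_below (riesz_energy ` Lp \<mu> 2)"
    using riesz_energy_ge by (intro bdd_belowI2)
  have "\<exists>f\<in>Lp \<mu> 2. riesz_energy f < d + (1/4) ^ n" for n :: nat
    using cINF_less_iff[OF _ bounded_below, of "d + (1/4) ^ n"] L2_zero[of \<mu>] by (auto simp: d_def)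
  then obtain u where "\<And>n. u n \<in> Lp \<mu> 2" "\<And>n::nat. riesz_energy (u n) < d + (1/4) ^ n" by metis
  moreover have "d \<le> riesz_energy f" if "f \<in> Lp \<mu> 2" for f
    unfolding d_def using bounded_below that by (rule cINF_lower)
  ultimately show ?thesis using that by blast
qed

lemma riesz_minimising_sequence_convergent:
  assumes u: "\<And>n. u n \<in> Lp \<mu> 2" and d_le: "\<And>f. f \<in> Lp \<mu> 2 \<Longrightarrow> d \<le> riesz_energy f"
    and u_less: "\<And>n. riesz_energy (u n) < d + (1/4) ^ n"
  shows "\<exists>h\<in>Lp \<mu> 2. (\<lambda>n. Lp_norm \<mu> 2 (\<lambda>x. u n x - h x)) \<longlonglongrightarrow> 0"
proof (rule L2_complete[OF u])
  have "Lp_norm \<mu> 2 (\<lambda>x. u (Suc n) x - u n x) \<le> 2 * (1/2) ^ n" for n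
  proof (rule power2_le_imp_le)
    have "(Lp_norm \<mu> 2 (\<lambda>x. u (Suc n) x - u n x))\<^sup>2 \<le>
        2 * riesz_energy (u n) + 2 * riesz_energy (u (Suc n)) - 4 * d"
      by (rule riesz_energy_parallelogram[OF u u d_le])
    also have "\<dots> \<le> 4 * (1/4) ^ n"
      using u_less[of n] u_less[of "Suc n"] zero_le_power[of "1/4::real" n] unfolding power_Suc
      by linarith
    also have "\<dots> = (2 * (1/2) ^ n)\<^sup>2"
      by (simp add: power2_eq_square) (simp flip: power_mult_distrib)
    finally show "(Lp_norm \<mu> 2 (\<lambda>x. u (Suc n) x - u n x))\<^sup>2 \<le> (2 * (1/2) ^ n)\<^sup>2" .
  qed simp
  then show "summable (\<lambda>n. Lp_norm \<mu> 2 (\<lambda>x. u (Suc n) x - u n x))"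
    by (intro summable_comparison_test'[OF summable_mult[OF summable_geometric[of "1/2::real"], of 2]])
      (auto simp: Lp_norm_nonneg)
qed

text \<open>The first variation of the energy at a minimiser \<open>h\<close> vanishes.\<close>
lemma riesz_minimiser_represents_Re:
  assumes u: "\<And>n. u n \<in> Lp \<mu> 2" and d_le: "\<And>f. f \<in> Lp \<mu> 2 \<Longrightarrow> d \<le> riesz_energy f"
    and u_less: "\<And>n. riesz_energy (u n) < d + (1/4) ^ n"
    and h: "h \<in> Lp \<mu> 2" and lim: "(\<lambda>n. Lp_norm \<mu> 2 (\<lambda>x. u n x - h x)) \<longlonglongrightarrow> 0" and g: "g \<in> Lp \<mu> 2"
  shows "Re (\<phi> g) = Re (L2_inner \<mu> g h)"
proof -
  define c where "c = Re (L2_inner \<mu> g h - \<phi> g)"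
  let ?q = "\<lambda>t n. (1/4) ^ n + 2 * t * Re (L2_inner \<mu> g (u n) - \<phi> g) + t\<^sup>2 * (Lp_norm \<mu> 2 g)\<^sup>2"
  have "0 \<le> 2 * t * c + t\<^sup>2 * (Lp_norm \<mu> 2 g)\<^sup>2" for t
  proof (rule LIMSEQ_le_const[of "?q t"])
    have "(\<lambda>n. Re (L2_inner \<mu> g (u n) - \<phi> g)) \<longlonglongrightarrow> c"
      unfolding c_def
      by (rule tendsto_Re[OF tendsto_diff[OF tendsto_L2_inner_right[OF g u h lim] tendsto_const]])
    then have "?q t \<longlonglongrightarrow> 0 + 2 * t * c + t\<^sup>2 * (Lp_norm \<mu> 2 g)\<^sup>2"
      by (intro tendsto_add[OF tendsto_add[OF LIMSEQ_power_zero tendsto_mult_left] tendsto_const]) auto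
    then show "?q t \<longlonglongrightarrow> 2 * t * c + t\<^sup>2 * (Lp_norm \<mu> 2 g)\<^sup>2" by simp
    have "0 \<le> ?q t n" for n
      using riesz_energy_add_scale[OF u g, of n t]
        d_le[OF L2_add[OF u L2_scale[OF g]], of n "complex_of_real t"] u_less[of n]
      by linarith
    then show "\<exists>N. \<forall>n\<ge>N. 0 \<le> ?q t n" by blast
  qed
  then have "c = 0" by (rule linear_coeff_eq_0_if_quadratic_nonneg) simp
  then show ?thesis by (simp add: c_def)
qed

theorem L2_Riesz_representation: "\<exists>h\<in>Lp \<mu> 2. \<forall>g\<in>Lp \<mu> 2. \<phi> g = L2_inner \<mu> g h"
proof -
  obtain u d where u: "\<And>n. u n \<in> Lp \<mu> 2" "\<And>f. f \<in> Lp \<mu> 2 \<Longrightarrow> d \<le> riesz_energy f"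
    "\<And>n. riesz_energy (u n) < d + (1/4) ^ n" by (rule riesz_minimising_sequence) blast
  obtain h where h: "h \<in> Lp \<mu> 2" "(\<lambda>n. Lp_norm \<mu> 2 (\<lambda>x. u n x - h x)) \<longlonglongrightarrow> 0"
    using riesz_minimising_sequence_convergent[OF u] by blast
  have "\<phi> g = L2_inner \<mu> g h" if g: "g \<in> Lp \<mu> 2" for g
    using riesz_minimiser_represents_Re[OF u h g]
      riesz_minimiser_represents_Re[OF u h L2_scale[OF g, of \<i>]] g
    by (simp add: \<phi>_scale L2_inner_scale_left complex_eq_iff)
  then show ?thesis using h(1) by blast
qed

end

section \<open>Functional calculus of a projection-valued measure\<close>

definition bounded_borel :: "(real \<Rightarrow> complex) \<Rightarrow> bool" where
  "bounded_borel F \<longleftrightarrow> F \<in> borel_measurable borel \<and> (\<exists>B. \<forall>u. norm (F u) \<le> B)"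

lemma bounded_borel_measurable[measurable_dest]: "bounded_borel F \<Longrightarrow> F \<in> borel_measurable borel"
  by (simp add: bounded_borel_def)

lemma bounded_borelI: "F \<in> borel_measurable borel \<Longrightarrow> (\<And>u. norm (F u) \<le> B) \<Longrightarrow> bounded_borel F"
  by (auto simp: bounded_borel_def)

lemma bounded_borelD: "bounded_borel F \<Longrightarrow> \<exists>B\<ge>0. \<forall>u. norm (F u) \<le> B"
  unfolding bounded_borel_def by (meson norm_ge_zero order_trans)

lemma bounded_borel_indicator: "A \<in> sets borel \<Longrightarrow> bounded_borel (indicator A)"
  by (rule bounded_borelI[of _ 1]) (auto simp: indicator_def)

lemma bounded_borel_add: "bounded_borel F \<Longrightarrow> bounded_borel G \<Longrightarrow> bounded_borel (\<lambda>u. F u + G u)"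
  unfolding bounded_borel_def by (auto, meson norm_triangle_mono)

lemma bounded_borel_mult:
  assumes "bounded_borel F" "bounded_borel G" shows "bounded_borel (\<lambda>u. F u * G u)"
proof -
  from assms obtain A B where "A \<ge> 0" "\<And>u. norm (F u) \<le> A" "B \<ge> 0" "\<And>u. norm (G u) \<le> B"
    by (meson bounded_borelD)
  then show ?thesis using assms
    by (intro bounded_borelI[of _ "A * B"])
      (auto simp: norm_mult bounded_borel_def intro!: mult_mono)
qed

lemma bounded_borel_const: "bounded_borel (\<lambda>u. c)" by (rule bounded_borelI[of _ "norm c"]) auto

lemma bounded_borel_scale: "bounded_borel F \<Longrightarrow> bounded_borel (\<lambda>u. c * F u)"
  by (intro bounded_borel_mult bounded_borel_const)

lemma bounded_borel_cnj: "bounded_borel F \<Longrightarrow> bounded_borel (\<lambda>u. cnj (F u))"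
  by (auto simp: bounded_borel_def)

lemma bounded_borel_simple_function: "simple_function borel F \<Longrightarrow> bounded_borel F"
proof (rule bounded_borelI)
  assume F: "simple_function borel F"
  then show "F \<in> borel_measurable borel" by (rule borel_measurable_simple_function)
  show "norm (F u) \<le> (\<Sum>y\<in>range F. norm y)" for u
    using F by (intro member_le_sum) (auto simp: simple_function_def)
qed

lemma simple_function_linear_induct [consumes 1, case_names indicator scale add]:
  fixes F :: "real \<Rightarrow> complex"
  assumes F: "simple_function borel F"
    and indicator: "\<And>A. A \<in> sets borel \<Longrightarrow> P (indicator A)"
    and scale: "\<And>c G. bounded_borel G \<Longrightarrow> P G \<Longrightarrow> P (\<lambda>u. c * G u)"
    and add: "\<And>G H. bounded_borel G \<Longrightarrow> bounded_borel H \<Longrightarrow> P G \<Longrightarrow> P H \<Longrightarrow> P (\<lambda>u. G u + H u)"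
  shows "P F"
proof -
  have finite_range: "finite (range F)" using F by (simp add: simple_function_def)
  have level: "F -` {y} \<in> sets borel" for y
    using measurable_sets[OF borel_measurable_simple_function[OF F], of "{y}"] by simp
  have partial_sums:
    "P (\<lambda>u. \<Sum>y\<in>I. y * indicator (F -` {y}) u) \<and>
        bounded_borel (\<lambda>u. \<Sum>y\<in>I. y * indicator (F -` {y}) u)"
    if "finite I" for I
    using that
  proof (induction I)
    case empty
    show ?case
      using indicator[of "{}"] bounded_borel_const[of 0] by (simp add: indicator_def[abs_def])
  next
    case (insert y I)
    have "bounded_borel (\<lambda>u. y * indicator (F -` {y}) u)" "P (\<lambda>u. y * indicator (F -` {y}) u)"
      using level indicator scale bounded_borel_indicator bounded_borel_scale by blast+
    with insert add bounded_borel_add show ?case by (simp only: sum.insert[OF insert(1,2)])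
  qed
  have "(\<lambda>u. \<Sum>y\<in>range F. y * indicator (F -` {y}) u) = F"
  proof (rule ext)
    fix u
    have "(\<Sum>y\<in>range F. y * indicator (F -` {y}) u) = (\<Sum>y\<in>range F. if y = F u then y else 0)"
      by (intro sum.cong) (auto simp: indicator_def)
    then show "(\<Sum>y\<in>range F. y * indicator (F -` {y}) u) = F u" using finite_range by simp
  qed
  then show ?thesis using partial_sums[OF finite_range] by (simp only:)
qed

lemma bounded_borel_induct [consumes 1, case_names indicator scale add lim]:
  assumes F: "bounded_borel F"
    and indicator: "\<And>A. A \<in> sets borel \<Longrightarrow> P (indicator A)"
    and scale: "\<And>c G. bounded_borel G \<Longrightarrow> P G \<Longrightarrow> P (\<lambda>u. c * G u)"
    and add: "\<And>G H. bounded_borel G \<Longrightarrow> bounded_borel H \<Longrightarrow> P G \<Longrightarrow> P H \<Longrightarrow> P (\<lambda>u. G u + H u)"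
    and lim: "\<And>(Gn :: nat \<Rightarrow> _) G B. (\<And>n. bounded_borel (Gn n)) \<Longrightarrow> (\<And>n. P (Gn n)) \<Longrightarrow>
      (\<And>n u. norm (Gn n u) \<le> B) \<Longrightarrow> (\<And>u. (\<lambda>n. Gn n u) \<longlonglongrightarrow> G u) \<Longrightarrow> bounded_borel G \<Longrightarrow> P G"
  shows "P F"
proof -
  obtain B where B: "\<And>u. norm (F u) \<le> B" using bounded_borelD[OF F] by blast
  from borel_measurable_implies_sequence_metric[OF bounded_borel_measurable[OF F], of 0]
  obtain s where s: "\<And>i. simple_function borel (s i)" "\<And>u. (\<lambda>i. s i u) \<longlonglongrightarrow> F u"
    "\<And>i u. norm (s i u) \<le> 2 * norm (F u)" by auto
  show ?thesis
  proof (rule lim[OF bounded_borel_simple_function[OF s(1)] _ _ s(2) F])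
    show "P (s i)" for i using s(1) indicator scale add by (rule simple_function_linear_induct)
    show "norm (s i u) \<le> 2 * B" for i u using s(3)[of i u] B[of u] by simp
  qed
qed

lemma linear_op_maps: "linear_op \<mu> A B T \<Longrightarrow> f \<in> A \<Longrightarrow> T f \<in> B"
  by (simp add: linear_op_def)

lemma linear_op_add:
  "linear_op \<mu> A B T \<Longrightarrow> f \<in> A \<Longrightarrow> g \<in> A \<Longrightarrow> AE x in \<mu>. T (\<lambda>y. f y + g y) x = T f x + T g x"
  by (simp add: linear_op_def)

lemma L2_inner_linear_op_add:
  assumes T: "linear_op \<mu> (Lp \<mu> 2) (Lp \<mu> 2) T" and f: "f \<in> Lp \<mu> 2" "g \<in> Lp \<mu> 2" "h \<in> Lp \<mu> 2"
  shows "L2_inner \<mu> (T (\<lambda>x. f x + g x)) h = L2_inner \<mu> (T f) h + L2_inner \<mu> (T g) h"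
proof -
  have "L2_inner \<mu> (T (\<lambda>x. f x + g x)) h = L2_inner \<mu> (\<lambda>x. T f x + T g x) h"
    using T f by (intro L2_inner_cong_left) (auto simp: linear_op_def L2_add intro!: L2_measurable)
  then show ?thesis using T f by (simp add: L2_inner_add_left linear_op_maps)
qed

lemma L2_inner_linear_op_scale:
  assumes T: "linear_op \<mu> (Lp \<mu> 2) (Lp \<mu> 2) T" and f: "f \<in> Lp \<mu> 2" "h \<in> Lp \<mu> 2"
  shows "L2_inner \<mu> (T (\<lambda>x. c * f x)) h = c * L2_inner \<mu> (T f) h"
proof -
  have "L2_inner \<mu> (T (\<lambda>x. c * f x)) h = L2_inner \<mu> (\<lambda>x. c * T f x) h"
    using T f
    by (intro L2_inner_cong_left) (auto simp: linear_op_def L2_scale intro!: L2_measurable)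
  then show ?thesis by (simp add: L2_inner_scale_left)
qed

lemma L2_polarisation:
  assumes T: "linear_op \<mu> (Lp \<mu> 2) (Lp \<mu> 2) T" and f: "f \<in> Lp \<mu> 2" "g \<in> Lp \<mu> 2"
  shows "L2_inner \<mu> (T f) g =
    (\<Sum>c\<in>{1,-1,\<i>,-\<i>}. c * L2_inner \<mu> (T (\<lambda>x. f x + c * g x)) (\<lambda>x. f x + c * g x)) / 4"
proof -
  have "L2_inner \<mu> (T (\<lambda>x. f x + c * g x)) (\<lambda>x. f x + c * g x) =
     L2_inner \<mu> (T f) f + cnj c * L2_inner \<mu> (T f) g + c * L2_inner \<mu> (T g) f
      + c * cnj c * L2_inner \<mu> (T g) g" for c
  proof -
    have cg_L2: "(\<lambda>x. c * g x) \<in> Lp \<mu> 2" using f by (simp add: L2_scale)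
    have left: "L2_inner \<mu> (T (\<lambda>x. f x + c * g x)) h = L2_inner \<mu> (T f) h + c * L2_inner \<mu> (T g) h"
      if "h \<in> Lp \<mu> 2" for h
      using L2_inner_linear_op_add[OF T f(1) cg_L2 that] L2_inner_linear_op_scale[OF T f(2) that]
      by simp
    have "L2_inner \<mu> (T (\<lambda>x. f x + c * g x)) (\<lambda>x. f x + c * g x) =
       L2_inner \<mu> (T (\<lambda>x. f x + c * g x)) f + cnj c * L2_inner \<mu> (T (\<lambda>x. f x + c * g x)) g"
      using f cg_L2 T by (simp add: L2_inner_add_right L2_add linear_op_maps L2_inner_scale_right)
    then show ?thesis using f by (simp add: left algebra_simps)
  qed
  note expand = this
  show ?thesis unfolding expand by (simp add: algebra_simps complex_eq_iff)
qed

locale spectral_family =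
  fixes \<mu> :: "'a measure" and E :: "real set \<Rightarrow> ('a \<Rightarrow> complex) \<Rightarrow> ('a \<Rightarrow> complex)"
  assumes E_linear: "A \<in> sets borel \<Longrightarrow> linear_op \<mu> (Lp \<mu> 2) (Lp \<mu> 2) (E A)"
    and E_sym:
      "A \<in> sets borel \<Longrightarrow> f \<in> Lp \<mu> 2 \<Longrightarrow> g \<in> Lp \<mu> 2 \<Longrightarrow> L2_inner \<mu> (E A f) g = L2_inner \<mu> f (E A g)"
    and E_mult:
      "A \<in> sets borel \<Longrightarrow> B \<in> sets borel \<Longrightarrow> f \<in> Lp \<mu> 2 \<Longrightarrow> AE x in \<mu>. E A (E B f) x = E (A \<inter> B) f x"
    and E_sums: "range S \<subseteq> sets borel \<Longrightarrow> disjoint_family S \<Longrightarrow> f \<in> Lp \<mu> 2 \<Longrightarrow> g \<in> Lp \<mu> 2 \<Longrightarrow>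
       (\<lambda>i::nat. L2_inner \<mu> (E (S i) f) g) sums L2_inner \<mu> (E (\<Union>i. S i) f) g"

lemma spectral_family_if_projection_valued_measure:
  "projection_valued_measure \<mu> E \<Longrightarrow> spectral_family \<mu> E"
  unfolding projection_valued_measure_def by unfold_locales (auto simp only: Ball_def)

lemma spectral_family_spectral_measure: "spectral_family \<mu> (spectral_measure \<mu> D L)"
proof (cases "\<exists>E. spectral_resolution \<mu> D L E")
  case True
  then have "spectral_resolution \<mu> D L (spectral_measure \<mu> D L)"
    unfolding spectral_measure_def if_P[OF True] by (rule someI_ex)
  then show ?thesis
    by (intro spectral_family_if_projection_valued_measure) (simp add: spectral_resolution_def)
next
  case False
  then have "spectral_measure \<mu> D L = (\<lambda>A f x. 0)" by (simp add: spectral_measure_def)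
  then show ?thesis
    by unfold_locales (auto simp: linear_op_def L2_zero L2_inner_def)
qed

context spectral_family begin

abbreviation "nu f \<equiv> scalar_measure \<mu> E f"

lemma E_L2: "A \<in> sets borel \<Longrightarrow> f \<in> Lp \<mu> 2 \<Longrightarrow> E A f \<in> Lp \<mu> 2"
  using E_linear linear_op_maps by blast

lemma E_inner_E:
  assumes "A \<in> sets borel" "B \<in> sets borel" "f \<in> Lp \<mu> 2" "g \<in> Lp \<mu> 2"
  shows "L2_inner \<mu> (E A f) (E B g) = L2_inner \<mu> (E (A \<inter> B) f) g"
proof -
  have "L2_inner \<mu> (E A f) (E B g) = L2_inner \<mu> (E B (E A f)) g"
    using assms by (simp add: E_sym E_L2)
  also have "\<dots> = L2_inner \<mu> (E (B \<inter> A) f) g"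
    using assms E_mult[of B A f] by (intro L2_inner_cong_left L2_measurable E_L2) auto
  finally show ?thesis by (simp add: Int_commute)
qed

lemma E_inner_self: "A \<in> sets borel \<Longrightarrow> f \<in> Lp \<mu> 2 \<Longrightarrow>
    L2_inner \<mu> (E A f) f = complex_of_real ((Lp_norm \<mu> 2 (E A f))\<^sup>2)"
  using E_inner_E[of A A f f] L2_inner_self[of "E A f" \<mu>] by (simp add: E_L2)

lemma E_norm_le: assumes "A \<in> sets borel" "f \<in> Lp \<mu> 2" shows "Lp_norm \<mu> 2 (E A f) \<le> Lp_norm \<mu> 2 f"
proof -
  have "(Lp_norm \<mu> 2 (E A f))\<^sup>2 = norm (L2_inner \<mu> (E A f) f)"
    using assms by (simp add: E_inner_self norm_power)
  also have "\<dots> \<le> Lp_norm \<mu> 2 (E A f) * Lp_norm \<mu> 2 f"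
    using assms by (intro L2_Cauchy_Schwarz E_L2)
  finally have "Lp_norm \<mu> 2 (E A f) * Lp_norm \<mu> 2 (E A f) \<le> Lp_norm \<mu> 2 (E A f) * Lp_norm \<mu> 2 f"
    by (simp add: power2_eq_square)
  then show ?thesis
    using Lp_norm_nonneg[of \<mu> 2 "E A f"] Lp_norm_nonneg[of \<mu> 2 f]
    by (cases "Lp_norm \<mu> 2 (E A f) = 0") auto
qed

lemma E_empty: assumes "f \<in> Lp \<mu> 2" "g \<in> Lp \<mu> 2" shows "L2_inner \<mu> (E {} f) g = 0"
proof -
  have "(\<lambda>i::nat. L2_inner \<mu> (E {} f) g) sums L2_inner \<mu> (E {} f) g"
    using E_sums[of "\<lambda>_. {}" f g] assms by (simp add: disjoint_family_on_def)
  then have "(\<lambda>i::nat. L2_inner \<mu> (E {} f) g) \<longlonglongrightarrow> 0" by (intro summable_LIMSEQ_zero sums_summable)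
  then show ?thesis by (simp add: LIMSEQ_const_iff)
qed

lemma sets_nu[simp, measurable_cong]: "sets (nu f) = sets borel"
  using sets.sigma_sets_eq[of "borel :: real measure"]
  by (simp add: scalar_measure_def sets_measure_of)

lemma space_nu[simp]: "space (nu f) = UNIV"
  by (simp add: scalar_measure_def space_measure_of_conv)

lemma emeasure_nu:
  assumes f: "f \<in> Lp \<mu> 2" and A: "A \<in> sets borel"
  shows "emeasure (nu f) A = ennreal ((Lp_norm \<mu> 2 (E A f))\<^sup>2)"
proof -
  let ?m = "\<lambda>A. ennreal (Re (L2_inner \<mu> (E A f) f))"
  have additive: "countably_additive (sets borel) ?m"
  proof (rule countably_additiveI)
    fix A :: "nat \<Rightarrow> real set" assume A: "range A \<subseteq> sets borel" "disjoint_family A"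
      "(\<Union>i. A i) \<in> sets borel"
    have "(\<lambda>i. Re (L2_inner \<mu> (E (A i) f) f)) sums Re (L2_inner \<mu> (E (\<Union>i. A i) f) f)"
      using E_sums[OF A(1,2) f f] by (rule sums_Re)
    moreover have "Re (L2_inner \<mu> (E (A i) f) f) \<ge> 0" for i
      using A(1) f by (subst E_inner_self) auto
    ultimately show "(\<Sum>i. ?m (A i)) = ?m (\<Union> (range A))"
      by (intro suminf_ennreal_eq) auto
  qed
  have "emeasure (nu f) A = ?m A"
    unfolding scalar_measure_def
  proof (rule emeasure_measure_of_sigma[OF _ _ additive A])
    show "sigma_algebra (UNIV::real set) (sets borel)"
      using sets.sigma_algebra_axioms[of borel] by simp
    show "positive (sets borel) ?m" using f by (simp add: positive_def E_empty)
  qed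
  then show ?thesis using f A by (simp add: E_inner_self)
qed

lemma finite_nu: "f \<in> Lp \<mu> 2 \<Longrightarrow> finite_measure (nu f)"
  by (rule finite_measureI) (simp add: emeasure_nu)

lemma measure_nu_le: "f \<in> Lp \<mu> 2 \<Longrightarrow> measure (nu f) UNIV \<le> (Lp_norm \<mu> 2 f)\<^sup>2"
  using E_norm_le[of UNIV f] by (simp add: measure_def emeasure_nu power_mono Lp_norm_nonneg)

lemma integrable_nu: assumes "bounded_borel F" "f \<in> Lp \<mu> 2" shows "integrable (nu f) F"
proof -
  interpret finite_measure "nu f" by (rule finite_nu) fact
  from assms(1) obtain B where "\<And>u. norm (F u) \<le> B" by (meson bounded_borelD)
  then show ?thesis using bounded_borel_measurable[OF assms(1)]
    by (intro integrable_const_bound[of _ B]) auto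
qed

definition form :: "(real \<Rightarrow> complex) \<Rightarrow> ('a \<Rightarrow> complex) \<Rightarrow> ('a \<Rightarrow> complex) \<Rightarrow> complex" where
  "form F f g = (\<Sum>c\<in>{1,-1,\<i>,-\<i>}. c * (LINT u|nu (\<lambda>x. f x + c * g x). F u)) / 4"

lemma integral_nu_indicator:
  assumes "f \<in> Lp \<mu> 2" "A \<in> sets borel"
  shows "(LINT u|nu f. indicator A u) = L2_inner \<mu> (E A f) f"
proof -
  have "(LINT u|nu f. indicator A u :: complex) = complex_of_real (measure (nu f) A)"
  proof -
    have of_real_indicator: "(\<lambda>u. indicator A u :: complex) = (\<lambda>u. complex_of_real (indicator A u))"
      by (auto simp: indicator_def)
    show ?thesis unfolding of_real_indicator integral_complex_of_real by simp
  qed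
  then show ?thesis using assms by (simp add: measure_def emeasure_nu E_inner_self)
qed

lemma form_indicator:
  assumes "f \<in> Lp \<mu> 2" "g \<in> Lp \<mu> 2" "A \<in> sets borel"
  shows "form (indicator A) f g = L2_inner \<mu> (E A f) g"
  unfolding form_def using assms
  by (subst L2_polarisation[OF E_linear]) (auto simp: integral_nu_indicator L2_add L2_scale)

lemma form_add:
  assumes "f \<in> Lp \<mu> 2" "g \<in> Lp \<mu> 2" "bounded_borel F" "bounded_borel G"
  shows "form (\<lambda>u. F u + G u) f g = form F f g + form G f g"
proof -
  have "(LINT u|nu (\<lambda>x. f x + c * g x). F u + G u) =
      (LINT u|nu (\<lambda>x. f x + c * g x). F u) + (LINT u|nu (\<lambda>x. f x + c * g x). G u)" for c
    using assms by (intro Bochner_Integration.integral_add integrable_nu L2_add L2_scale)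
  then show ?thesis by (simp only: form_def distrib_left sum.distrib add_divide_distrib)
qed

lemma form_scale: "form (\<lambda>u. c * F u) f g = c * form F f g"
proof -
  have "(\<Sum>k\<in>S. k * (c * h k)) = c * (\<Sum>k\<in>S. k * h k)" for S and h :: "complex \<Rightarrow> complex"
    by (simp add: sum_distrib_left mult.left_commute)
  then show ?thesis unfolding form_def by (simp del: sum.insert)
qed

lemma form_lim:
  assumes f: "f \<in> Lp \<mu> 2" "g \<in> Lp \<mu> 2"
    and F: "\<And>n. bounded_borel (Fn n)" "\<And>n u. norm (Fn n u) \<le> B" "\<And>u. (\<lambda>n. Fn n u) \<longlonglongrightarrow> F u"
      "bounded_borel F"
  shows "(\<lambda>n. form (Fn n) f g) \<longlonglongrightarrow> form F f g"
  unfolding form_def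
proof (intro tendsto_intros)
  fix c :: complex
  have h: "(\<lambda>x. f x + c * g x) \<in> Lp \<mu> 2" using f by (simp add: L2_add L2_scale)
  interpret finite_measure "nu (\<lambda>x. f x + c * g x)" using finite_nu[OF h] .
  show "(\<lambda>n. LINT u|nu (\<lambda>x. f x + c * g x). Fn n u) \<longlonglongrightarrow> (LINT u|nu (\<lambda>x. f x + c * g x). F u)"
    by (rule integral_dominated_convergence[where w="\<lambda>_. B"])
      (use F bounded_borel_measurable in auto)
qed auto

lemma form_diag: assumes "f \<in> Lp \<mu> 2" "bounded_borel F" shows "form F f f = (LINT u|nu f. F u)"
  using assms(2)
proof (induction rule: bounded_borel_induct)
  case (indicator A) then show ?case using assms by (simp add: form_indicator integral_nu_indicator)
next
  case (scale c G) then show ?case by (simp add: form_scale)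
next
  case (add G H) then show ?case using assms by (simp add: form_add integrable_nu)
next
  case (lim Gn G B)
  interpret finite_measure "nu f" using finite_nu[OF assms(1)] .
  have "(\<lambda>n. LINT u|nu f. Gn n u) \<longlonglongrightarrow> (LINT u|nu f. G u)"
    by (rule integral_dominated_convergence[where w="\<lambda>_. B"])
      (use lim bounded_borel_measurable in auto)
  with form_lim[OF assms(1) assms(1) lim(1-4)] lim(5) show ?case
    by (simp add: LIMSEQ_unique)
qed

lemma form_add_left:
  assumes "bounded_borel F" and f: "f \<in> Lp \<mu> 2" "f' \<in> Lp \<mu> 2" "g \<in> Lp \<mu> 2"
  shows "form F (\<lambda>x. f x + f' x) g = form F f g + form F f' g"
  using assms(1)
proof (induction rule: bounded_borel_induct)
  case (indicator A) then show ?case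
    using f by (simp add: form_indicator L2_add L2_inner_linear_op_add[OF E_linear])
next
  case (lim Gn G B)
  have "(\<lambda>n. form (Gn n) f g + form (Gn n) f' g) \<longlonglongrightarrow> form G f g + form G f' g"
    using lim f by (intro tendsto_add form_lim) auto
  with form_lim[OF L2_add[OF f(1,2)] f(3) lim(1-4)] lim(5) show ?case
    by (simp add: LIMSEQ_unique)
qed (use f in \<open>auto simp: form_scale form_add L2_add algebra_simps\<close>)

lemma form_scale_left:
  assumes "bounded_borel F" and f: "f \<in> Lp \<mu> 2" "g \<in> Lp \<mu> 2"
  shows "form F (\<lambda>x. c * f x) g = c * form F f g"
  using assms(1)
proof (induction rule: bounded_borel_induct)
  case (indicator A) then show ?case
    using f by (simp add: form_indicator L2_scale L2_inner_linear_op_scale[OF E_linear])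
next
  case (lim Gn G B)
  have "(\<lambda>n. c * form (Gn n) f g) \<longlonglongrightarrow> c * form G f g"
    using lim f by (intro tendsto_mult_left form_lim) auto
  with form_lim[OF L2_scale[OF f(1)] f(2) lim(1-4), of c] lim(5) show ?case
    by (simp add: LIMSEQ_unique)
qed (use f in \<open>auto simp: form_scale form_add L2_scale algebra_simps\<close>)

lemma form_cnj:
  assumes "bounded_borel F" and f: "f \<in> Lp \<mu> 2" "g \<in> Lp \<mu> 2"
  shows "cnj (form F f g) = form (\<lambda>u. cnj (F u)) g f"
  using assms(1)
proof (induction rule: bounded_borel_induct)
  case (indicator A)
  have "(\<lambda>u. cnj (indicator A u)) = (indicator A :: real \<Rightarrow> complex)" by (auto simp: indicator_def)
  then show ?case using f indicator by (simp add: form_indicator L2_inner_cnj E_sym)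
next
  case (lim Gn G B)
  have "(\<lambda>n. cnj (form (Gn n) f g)) \<longlonglongrightarrow> cnj (form G f g)"
    using lim f by (intro tendsto_cnj form_lim) auto
  moreover have "(\<lambda>n. form (\<lambda>u. cnj (Gn n u)) g f) \<longlonglongrightarrow> form (\<lambda>u. cnj (G u)) g f"
    using lim f by (intro form_lim[where B=B] bounded_borel_cnj tendsto_cnj) auto
  ultimately show ?case using lim(5) by (simp add: LIMSEQ_unique)
qed (use f in \<open>auto simp: form_scale form_add bounded_borel_cnj\<close>)

lemma form_E_right:
  assumes "bounded_borel G" and f: "f \<in> Lp \<mu> 2" "g \<in> Lp \<mu> 2" and A: "A \<in> sets borel"
  shows "form G g (E A f) = form (\<lambda>u. indicator A u * G u) g f"
  using assms(1)
proof (induction rule: bounded_borel_induct)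
  case (indicator B)
  have "(\<lambda>u. indicator A u * indicator B u) = (indicator (B \<inter> A) :: real \<Rightarrow> complex)"
    by (auto simp: indicator_def)
  then show ?case using f A indicator by (simp add: form_indicator E_L2 E_inner_E)
next
  case (scale c G)
  have "(\<lambda>u. indicator A u * (c * G u)) = (\<lambda>u. c * (indicator A u * G u))" by auto
  then show ?case using scale f by (simp add: form_scale)
next
  case (add G H)
  then show ?case using f A
    by (simp add: form_add E_L2 distrib_left bounded_borel_mult bounded_borel_indicator)
next
  case (lim Gn G B)
  have "(\<lambda>n. form (\<lambda>u. indicator A u * Gn n u) g f) \<longlonglongrightarrow> form (\<lambda>u. indicator A u * G u) g f"
    using lim f A
    by (intro form_lim[where B=B] bounded_borel_mult bounded_borel_indicator tendsto_mult_left)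
      (auto simp: indicator_def intro: order_trans[OF norm_ge_zero])
  with form_lim[OF f(2) E_L2[OF A f(1)] lim(1-4)] lim(5) show ?case
    by (simp add: LIMSEQ_unique)
qed

definition represents :: "(real \<Rightarrow> complex) \<Rightarrow> ('a \<Rightarrow> complex) \<Rightarrow> ('a \<Rightarrow> complex) \<Rightarrow> bool" where
  "represents F f h \<longleftrightarrow> h \<in> Lp \<mu> 2 \<and> (\<forall>g\<in>Lp \<mu> 2. L2_inner \<mu> h g = form F f g)"

lemma represents_form:
  assumes F: "bounded_borel F" and G: "bounded_borel G" and f: "f \<in> Lp \<mu> 2" "g \<in> Lp \<mu> 2"
    and k: "represents G g k"
  shows "form F f k = form (\<lambda>u. F u * cnj (G u)) f g"
  using F
proof (induction rule: bounded_borel_induct)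
  case (indicator A)
  have "form (indicator A) f k = cnj (L2_inner \<mu> k (E A f))"
    using f k indicator by (simp add: form_indicator represents_def L2_inner_cnj)
  also have "\<dots> = cnj (form (\<lambda>u. indicator A u * G u) g f)"
    using k f indicator G by (simp add: represents_def E_L2 form_E_right)
  also have "\<dots> = form (\<lambda>u. cnj (indicator A u * G u)) f g"
    using f indicator G by (intro form_cnj bounded_borel_mult bounded_borel_indicator)
  also have "(\<lambda>u. cnj (indicator A u * G u)) = (\<lambda>u. indicator A u * cnj (G u))"
    by (auto simp: indicator_def)
  finally show ?case .
next
  case (scale c H)
  then show ?case using f by (simp add: form_scale mult.assoc)
next
  case (add H K)
  have k_L2: "k \<in> Lp \<mu> 2" using k by (simp add: represents_def)
  have "(\<lambda>u. (H u + K u) * cnj (G u)) = (\<lambda>u. H u * cnj (G u) + K u * cnj (G u))"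
    by (simp add: distrib_right)
  then show ?case using add f G k_L2
    by (simp add: form_add bounded_borel_mult bounded_borel_cnj)
next
  case (lim Hn H B)
  have k_L2: "k \<in> Lp \<mu> 2" using k by (simp add: represents_def)
  from G obtain C where C: "C \<ge> 0" "\<And>u. norm (G u) \<le> C" by (meson bounded_borelD)
  have B: "B \<ge> 0" using lim(2)[of 0 0] norm_ge_zero order_trans by blast
  have "(\<lambda>n. form (\<lambda>u. Hn n u * cnj (G u)) f g) \<longlonglongrightarrow> form (\<lambda>u. H u * cnj (G u)) f g"
    using lim f G C B
    by (intro form_lim[where B="B * C"] bounded_borel_mult bounded_borel_cnj tendsto_mult_right)
      (auto simp: norm_mult intro!: mult_mono)
  with form_lim[OF f(1) k_L2 lim(1-4)] lim(5) show ?case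
    by (simp add: LIMSEQ_unique)
qed

lemma represents_norm:
  assumes F: "bounded_borel F" and f: "f \<in> Lp \<mu> 2" and h: "represents F f h"
  shows "(Lp_norm \<mu> 2 h)\<^sup>2 = (LINT u|nu f. (norm (F u))\<^sup>2)"
proof -
  have "complex_of_real ((Lp_norm \<mu> 2 h)\<^sup>2) = L2_inner \<mu> h h"
    using h by (simp add: represents_def L2_inner_self)
  also have "\<dots> = form F f h" using h by (simp add: represents_def)
  also have "\<dots> = form (\<lambda>u. F u * cnj (F u)) f f" by (rule represents_form[OF F F f f h])
  also have "\<dots> = (LINT u|nu f. F u * cnj (F u))"
    using F f by (intro form_diag bounded_borel_mult bounded_borel_cnj)
  also have "\<dots> = complex_of_real (LINT u|nu f. (norm (F u))\<^sup>2)"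
    by (simp only: complex_norm_square[symmetric] integral_complex_of_real)
  finally show ?thesis by (simp only: of_real_eq_iff)
qed

lemma represents_norm_le:
  assumes F: "bounded_borel F" and f: "f \<in> Lp \<mu> 2" and h: "represents F f h"
    and B: "\<And>u. norm (F u) \<le> B"
  shows "Lp_norm \<mu> 2 h \<le> B * Lp_norm \<mu> 2 f"
proof (rule power2_le_imp_le)
  interpret finite_measure "nu f" using finite_nu[OF f] .
  have [measurable]: "F \<in> borel_measurable borel" using F by (simp add: bounded_borel_def)
  have "(Lp_norm \<mu> 2 h)\<^sup>2 = (LINT u|nu f. (norm (F u))\<^sup>2)" by (rule represents_norm[OF F f h])
  also have "\<dots> \<le> (LINT u|nu f. B\<^sup>2)"
    by (intro integral_mono integrable_const_bound[of _ "B\<^sup>2"]) (auto intro!: power_mono B)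
  also have "\<dots> = B\<^sup>2 * measure (nu f) UNIV" by simp
  also have "\<dots> \<le> B\<^sup>2 * (Lp_norm \<mu> 2 f)\<^sup>2" using measure_nu_le[OF f] by (intro mult_left_mono) auto
  finally show "(Lp_norm \<mu> 2 h)\<^sup>2 \<le> (B * Lp_norm \<mu> 2 f)\<^sup>2" by (simp add: power_mult_distrib)
  have "B \<ge> 0" using B[of 0] norm_ge_zero order_trans by blast
  then show "0 \<le> B * Lp_norm \<mu> 2 f" by (simp add: Lp_norm_nonneg)
qed

lemma represents_if_form_bounded:
  assumes F: "bounded_borel F" and f: "f \<in> Lp \<mu> 2"
    and bound: "\<And>g. g \<in> Lp \<mu> 2 \<Longrightarrow> norm (form F f g) \<le> K * Lp_norm \<mu> 2 g"
  shows "\<exists>h. represents F f h"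
proof -
  let ?\<phi> = "\<lambda>g. form (\<lambda>u. cnj (F u)) g f"
  note F' = bounded_borel_cnj[OF F]
  have cnj_form: "cnj (?\<phi> g) = form F f g" if "g \<in> Lp \<mu> 2" for g
    using form_cnj[OF F' that f] by simp
  have "\<exists>h\<in>Lp \<mu> 2. \<forall>g\<in>Lp \<mu> 2. ?\<phi> g = L2_inner \<mu> g h"
  proof (rule L2_Riesz_representation)
    show "norm (?\<phi> g) \<le> K * Lp_norm \<mu> 2 g" if "g \<in> Lp \<mu> 2" for g
      using bound[OF that] unfolding cnj_form[OF that, symmetric] complex_mod_cnj .
  qed (use f in \<open>auto simp: form_add_left[OF F'] form_scale_left[OF F']\<close>)
  then obtain h where h: "h \<in> Lp \<mu> 2" "\<And>g. g \<in> Lp \<mu> 2 \<Longrightarrow> ?\<phi> g = L2_inner \<mu> g h" by blast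
  then show ?thesis unfolding represents_def by (metis cnj_form L2_inner_cnj)
qed

lemma represents_exists:
  assumes "bounded_borel F" and f: "f \<in> Lp \<mu> 2"
  shows "\<exists>h. represents F f h"
  using assms(1)
proof (induction rule: bounded_borel_induct)
  case (indicator A)
  then show ?case
    using f by (intro exI[of _ "E A f"]) (simp add: represents_def E_L2 form_indicator)
next
  case (scale c G)
  then obtain h where "represents G f h" by blast
  then show ?case
    by (intro exI[of _ "\<lambda>x. c * h x"])
      (simp add: represents_def L2_scale form_scale L2_inner_scale_left)
next
  case (add G H)
  then obtain h k where "represents G f h" "represents H f k" by blast
  then show ?case using add f
    by (intro exI[of _ "\<lambda>x. h x + k x"])
      (simp add: represents_def L2_add form_add L2_inner_add_left)
next
  case (lim Gn G B)
  obtain h where h: "\<And>n. represents (Gn n) f (h n)" using lim(5) by metis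
  show ?case
  proof (rule represents_if_form_bounded[OF lim(4) f])
    fix g assume g: "g \<in> Lp \<mu> 2"
    have "norm (form (Gn n) f g) \<le> B * Lp_norm \<mu> 2 f * Lp_norm \<mu> 2 g" for n
    proof -
      have "norm (form (Gn n) f g) = norm (L2_inner \<mu> (h n) g)"
        using h[of n] g by (simp add: represents_def)
      also have "\<dots> \<le> Lp_norm \<mu> 2 (h n) * Lp_norm \<mu> 2 g"
        using h[of n] g by (intro L2_Cauchy_Schwarz) (auto simp: represents_def)
      also have "\<dots> \<le> B * Lp_norm \<mu> 2 f * Lp_norm \<mu> 2 g"
        using represents_norm_le[OF lim(1) f h lim(2)] by (intro mult_right_mono Lp_norm_nonneg)
      finally show ?thesis .
    qed
    with tendsto_norm[OF form_lim[OF f g lim(1-4)]]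
      show "norm (form G f g) \<le> B * Lp_norm \<mu> 2 f * Lp_norm \<mu> 2 g"
      by (intro LIMSEQ_le_const2) auto
  qed
qed

definition op_of :: "(real \<Rightarrow> complex) \<Rightarrow> ('a \<Rightarrow> complex) \<Rightarrow> ('a \<Rightarrow> complex)" where
  "op_of F f = (SOME h. represents F f h)"

lemma op_of_represents: "bounded_borel F \<Longrightarrow> f \<in> Lp \<mu> 2 \<Longrightarrow> represents F f (op_of F f)"
  unfolding op_of_def using represents_exists by (rule someI_ex)

lemma represents_cong_AE:
  assumes "represents F f h" "represents F f k" shows "AE x in \<mu>. h x = k x"
  using assms by (intro L2_AE_eqI) (auto simp: represents_def)

lemma form_cong_AE:
  assumes F: "bounded_borel F"
    and f: "f \<in> Lp \<mu> 2" "f' \<in> Lp \<mu> 2" "g \<in> Lp \<mu> 2" "AE x in \<mu>. f x = f' x"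
  shows "form F f g = form F f' g"
proof -
  obtain k where k: "represents (\<lambda>u. cnj (F u)) g k"
    using represents_exists[OF bounded_borel_cnj[OF F] f(3)] by blast
  have "form F h g = L2_inner \<mu> h k" if h: "h \<in> Lp \<mu> 2" for h
  proof -
    have "form F h g = cnj (form (\<lambda>u. cnj (F u)) g h)"
      using form_cnj[OF bounded_borel_cnj[OF F] f(3) h] by simp
    also have "\<dots> = L2_inner \<mu> h k"
      using k h by (simp add: represents_def L2_inner_cnj flip: L2_inner_cnj[of \<mu> k h])
    finally show ?thesis .
  qed
  moreover have "L2_inner \<mu> f k = L2_inner \<mu> f' k"
    using f k by (intro L2_inner_cong_left L2_measurable) (auto simp: represents_def)
  ultimately show ?thesis using f by simp
qed

lemma linear_op_op_of: assumes F: "bounded_borel F" shows "linear_op \<mu> (Lp \<mu> 2) (Lp \<mu> 2) (op_of F)"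
proof -
  have op_of_f: "op_of F f \<in> Lp \<mu> 2" "g \<in> Lp \<mu> 2 \<Longrightarrow> L2_inner \<mu> (op_of F f) g = form F f g"
    if "f \<in> Lp \<mu> 2" for f g
    using op_of_represents[OF F that] by (auto simp: represents_def)
  show ?thesis
    unfolding linear_op_def
  proof (intro conjI ballI impI allI)
    fix f g assume f: "f \<in> Lp \<mu> 2" "g \<in> Lp \<mu> 2"
    show "AE x in \<mu>. op_of F f x = op_of F g x" if "AE x in \<mu>. f x = g x"
      using f that F by (intro L2_AE_eqI) (auto simp: op_of_f intro: form_cong_AE)
    show "AE x in \<mu>. op_of F (\<lambda>y. f y + g y) x = op_of F f x + op_of F g x"
      using f F by (intro L2_AE_eqI) (auto simp: op_of_f L2_add L2_inner_add_left form_add_left)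
  next
    fix f c assume f: "f \<in> Lp \<mu> 2"
    show "op_of F f \<in> Lp \<mu> 2" using op_of_f f by simp
    show "AE x in \<mu>. op_of F (\<lambda>y. c * f y) x = c * op_of F f x"
      using f F
      by (intro L2_AE_eqI) (auto simp: op_of_f L2_scale L2_inner_scale_left form_scale_left)
  qed
qed

lemma integral_nu_superposition:
  fixes G :: "'i \<Rightarrow> real \<Rightarrow> complex"
  assumes N: "sigma_finite_measure N"
    and G: "(\<lambda>(v, u). G v u) \<in> borel_measurable (N \<Otimes>\<^sub>M borel)"
    and w: "integrable N w" and G_le: "\<And>v u. v \<in> space N \<Longrightarrow> norm (G v u) \<le> w v"
    and F: "\<And>u. F u = (LINT v|N. G v u)" and h: "h \<in> Lp \<mu> 2"
  shows "integrable N (\<lambda>v. LINT u|nu h. G v u)"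
    "(LINT u|nu h. F u) = (LINT v|N. LINT u|nu h. G v u)"
proof -
  interpret n: finite_measure "nu h" using finite_nu[OF h] .
  interpret N: sigma_finite_measure N by fact
  interpret P: pair_sigma_finite N "nu h" ..
  have [measurable]: "(\<lambda>(v, u). G v u) \<in> borel_measurable (N \<Otimes>\<^sub>M nu h)"
    using G by (simp cong: measurable_cong_sets)
  have integrable_G: "integrable (nu h) (G v)" if v: "v \<in> space N" for v
  proof (rule n.integrable_const_bound[of _ "w v"])
    show "G v \<in> borel_measurable (nu h)"
      using measurable_compose[OF measurable_Pair1'[OF v] G] by simp
  qed (use G_le[OF v] in auto)
  have "integrable (N \<Otimes>\<^sub>M nu h) (\<lambda>(v, u). G v u)"
  proof (rule P.Fubini_integrable)
    show "integrable N (\<lambda>v. LINT u|nu h. norm (case (v, u) of (v, u) \<Rightarrow> G v u))"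
    proof (rule Bochner_Integration.integrable_bound[where f="\<lambda>v. w v * measure (nu h) UNIV"])
      show "AE v in N. norm (LINT u|nu h. norm (case (v, u) of (v, u) \<Rightarrow> G v u)) \<le>
          norm (w v * measure (nu h) UNIV)"
      proof (rule AE_I2)
        fix v assume v: "v \<in> space N"
        have "w v \<ge> 0" using G_le[OF v, of 0] norm_ge_zero order_trans by blast
        moreover have "(LINT u|nu h. norm (G v u)) \<le> (LINT u|nu h. w v)"
          using v by (intro integral_mono integrable_norm integrable_G G_le) auto
        ultimately show "norm (LINT u|nu h. norm (case (v, u) of (v, u) \<Rightarrow> G v u)) \<le>
            norm (w v * measure (nu h) UNIV)"
          by (simp add: mult.commute)
      qed
    qed (use w in \<open>auto intro!: n.borel_measurable_lebesgue_integral\<close>)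
    show "AE v in N. integrable (nu h) (\<lambda>u. case (v, u) of (v, u) \<Rightarrow> G v u)"
      using integrable_G by (auto intro!: AE_I2)
  qed measurable
  from P.integrable_fst'[OF this] P.Fubini_integral[OF this]
  show "integrable N (\<lambda>v. LINT u|nu h. G v u)" "(LINT u|nu h. F u) = (LINT v|N. LINT u|nu h. G v u)"
    by (simp_all add: F)
qed

lemma form_superposition:
  fixes G :: "'i \<Rightarrow> real \<Rightarrow> complex"
  assumes N: "sigma_finite_measure N"
    and G: "(\<lambda>(v, u). G v u) \<in> borel_measurable (N \<Otimes>\<^sub>M borel)"
    and w: "integrable N w" and G_le: "\<And>v u. v \<in> space N \<Longrightarrow> norm (G v u) \<le> w v"
    and F: "\<And>u. F u = (LINT v|N. G v u)"
    and f: "f \<in> Lp \<mu> 2" "g \<in> Lp \<mu> 2"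
  shows "integrable N (\<lambda>v. form (G v) f g)" "form F f g = (LINT v|N. form (G v) f g)"
proof -
  let ?S = "{1,-1,\<i>,-\<i>} :: complex set" and ?J = "\<lambda>c v. LINT u|nu (\<lambda>x. f x + c * g x). G v u"
  have h: "(\<lambda>x. f x + c * g x) \<in> Lp \<mu> 2" for c using f by (simp add: L2_add L2_scale)
  note J = integral_nu_superposition[OF N G w G_le F h]
  have integrable_term: "integrable N (\<lambda>v. c * ?J c v)" for c
    using J(1) by (intro integrable_mult_right)
  show "integrable N (\<lambda>v. form (G v) f g)"
    unfolding form_def
    by (intro integrable_divide Bochner_Integration.integrable_sum integrable_term)
  have "(LINT v|N. form (G v) f g) = (LINT v|N. (\<Sum>c\<in>?S. c * ?J c v)) / 4"
    by (simp only: form_def integral_divide_zero)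
  also have "(LINT v|N. (\<Sum>c\<in>?S. c * ?J c v)) = (\<Sum>c\<in>?S. LINT v|N. c * ?J c v)"
    by (rule Bochner_Integration.integral_sum) (rule integrable_term)
  also have "\<dots> = (\<Sum>c\<in>?S. c * (LINT u|nu (\<lambda>x. f x + c * g x). F u))"
    by (simp only: integral_mult_right_zero J(2))
  finally show "form F f g = (LINT v|N. form (G v) f g)" by (simp only: form_def)
qed

end

definition half_line :: "(real \<Rightarrow> complex) \<Rightarrow> real \<Rightarrow> complex" where
  "half_line F u = (if 0 \<le> u then F u else 0)"

lemma half_line_mult: "half_line (\<lambda>u. F u * G u) = (\<lambda>u. half_line F u * half_line G u)"
  by (auto simp: half_line_def)

lemma half_line_scale: "half_line (\<lambda>u. c * F u) = (\<lambda>u. c * half_line F u)"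
  by (auto simp: half_line_def)

lemma half_line_cnj: "half_line (\<lambda>u. cnj (F u)) = (\<lambda>u. cnj (half_line F u))"
  by (auto simp: half_line_def)

lemma bounded_borel_half_line:
  assumes "F \<in> borel_measurable borel" "\<And>u. u \<ge> 0 \<Longrightarrow> norm (F u) \<le> B"
  shows "bounded_borel (half_line F)"
proof -
  have "norm (half_line F u) \<le> B" for u
    using assms(2)[of u] assms(2)[of 0] norm_ge_zero[of "F 0"]
    by (auto simp: half_line_def simp del: norm_ge_zero)
  moreover have "half_line F \<in> borel_measurable borel"
    using assms(1) unfolding half_line_def by measurable
  ultimately show ?thesis by (intro bounded_borelI)
qed

locale operator_calculus =
  fixes \<mu> :: "'a measure" and D :: "('a \<Rightarrow> complex) set" and L :: "('a \<Rightarrow> complex) \<Rightarrow> ('a \<Rightarrow> complex)"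

sublocale operator_calculus \<subseteq> spectral_family \<mu> "spectral_measure \<mu> D L"
  by (rule spectral_family_spectral_measure)

context operator_calculus begin

abbreviation "fc \<equiv> func_calc \<mu> D L"

lemma
  assumes F: "bounded_borel (half_line F)"
  shows fc_linear: "linear_op \<mu> (Lp \<mu> 2) (Lp \<mu> 2) (fc F)"
    and fc_represents: "f \<in> Lp \<mu> 2 \<Longrightarrow> represents (half_line F) f (fc F f)"
proof -
  let ?P = "\<lambda>T. linear_op \<mu> (Lp \<mu> 2) (Lp \<mu> 2) T \<and>
     (\<exists>C. \<forall>f\<in>Lp \<mu> 2. Lp_norm \<mu> 2 (T f) \<le> C * Lp_norm \<mu> 2 f) \<and>
     (\<forall>f\<in>Lp \<mu> 2. L2_inner \<mu> (T f) f = (LINT u:{0..}|nu f. F u))"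
  have restricted_integral: "(LINT u:{0..}|nu f. F u) = (LINT u|nu f. half_line F u)" for f
    unfolding set_lebesgue_integral_def
    by (rule Bochner_Integration.integral_cong) (auto simp: half_line_def indicator_def)
  from bounded_borelD[OF F] obtain B where B: "\<And>u. norm (half_line F u) \<le> B" by blast
  have "?P (op_of (half_line F))"
  proof (intro conjI ballI)
    show "linear_op \<mu> (Lp \<mu> 2) (Lp \<mu> 2) (op_of (half_line F))" by (rule linear_op_op_of[OF F])
    show "\<exists>C. \<forall>f\<in>Lp \<mu> 2. Lp_norm \<mu> 2 (op_of (half_line F) f) \<le> C * Lp_norm \<mu> 2 f"
      using represents_norm_le[OF F _ op_of_represents[OF F] B] by blast
    fix f assume f: "f \<in> Lp \<mu> 2"
    show "L2_inner \<mu> (op_of (half_line F) f) f = (LINT u:{0..}|nu f. F u)"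
      using op_of_represents[OF F f] f unfolding restricted_integral
      by (simp add: represents_def form_diag F)
  qed
  from someI[of ?P, OF this] have fc_properties: "?P (fc F)" unfolding func_calc_def .
  then show fc_is_linear: "linear_op \<mu> (Lp \<mu> 2) (Lp \<mu> 2) (fc F)" by blast
  assume f: "f \<in> Lp \<mu> 2"
  have "L2_inner \<mu> (fc F f) g = form (half_line F) f g" if "g \<in> Lp \<mu> 2" for g
  proof -
    have "L2_inner \<mu> (fc F (\<lambda>x. f x + c * g x)) (\<lambda>x. f x + c * g x) =
        (LINT u|nu (\<lambda>x. f x + c * g x). half_line F u)" for c
      using fc_properties L2_add[OF f L2_scale[OF that, of c]] unfolding restricted_integral
      by blast
    then show ?thesis unfolding L2_polarisation[OF fc_is_linear f that] form_def by (simp only:)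
  qed
  then show "represents (half_line F) f (fc F f)"
    using f fc_is_linear by (simp add: represents_def linear_op_maps)
qed
lemma fc_inner:
  "bounded_borel (half_line F) \<Longrightarrow> f \<in> Lp \<mu> 2 \<Longrightarrow> g \<in> Lp \<mu> 2 \<Longrightarrow>
      L2_inner \<mu> (fc F f) g = form (half_line F) f g"
  using fc_represents by (simp add: represents_def)

lemma fc_L2: "bounded_borel (half_line F) \<Longrightarrow> f \<in> Lp \<mu> 2 \<Longrightarrow> fc F f \<in> Lp \<mu> 2"
  using fc_represents by (simp add: represents_def)

lemma fc_norm_le:
  assumes "bounded_borel (half_line F)" "f \<in> Lp \<mu> 2" "\<And>u. u \<ge> 0 \<Longrightarrow> norm (F u) \<le> B"
  shows "Lp_norm \<mu> 2 (fc F f) \<le> B * Lp_norm \<mu> 2 f"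
proof (rule represents_norm_le[OF assms(1,2) fc_represents[OF assms(1,2)]])
  show "norm (half_line F u) \<le> B" for u
    using assms(3)[of u] assms(3)[of 0] norm_ge_zero[of "F 0"]
    by (auto simp: half_line_def simp del: norm_ge_zero)
qed

lemma fc_mult_represents:
  assumes F: "bounded_borel (half_line F)" and G: "bounded_borel (half_line G)" and f: "f \<in> Lp \<mu> 2"
  shows "represents (half_line (\<lambda>u. F u * G u)) f (fc F (fc G f))"
  unfolding represents_def
proof (intro conjI ballI)
  note Gf = fc_represents[OF G f]
  have Gf_L2: "fc G f \<in> Lp \<mu> 2" using fc_L2[OF G f] .
  show "fc F (fc G f) \<in> Lp \<mu> 2" by (rule fc_L2[OF F Gf_L2])
  fix g assume g: "g \<in> Lp \<mu> 2"
  have "L2_inner \<mu> (fc F (fc G f)) g = form (half_line F) (fc G f) g"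
    by (rule fc_inner[OF F Gf_L2 g])
  also have "\<dots> = cnj (form (\<lambda>u. cnj (half_line F u)) g (fc G f))"
    using form_cnj[OF bounded_borel_cnj[OF F] g Gf_L2] by simp
  also have "\<dots> = cnj (form (\<lambda>u. cnj (half_line F u) * cnj (half_line G u)) g f)"
    by (simp add: represents_form[OF bounded_borel_cnj[OF F] G g f Gf])
  also have "\<dots> = form (half_line (\<lambda>u. F u * G u)) f g"
    using form_cnj[OF bounded_borel_cnj[OF bounded_borel_mult[OF F G]] g f]
    by (simp add: half_line_mult)
  finally show "L2_inner \<mu> (fc F (fc G f)) g = form (half_line (\<lambda>u. F u * G u)) f g" .
qed

lemma fc_adjoint:
  assumes F: "bounded_borel (half_line F)" and f: "f \<in> Lp \<mu> 2" and g: "g \<in> Lp \<mu> 2"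
  shows "L2_inner \<mu> (fc F f) g = L2_inner \<mu> f (fc (\<lambda>u. cnj (F u)) g)"
proof -
  have "L2_inner \<mu> f (fc (\<lambda>u. cnj (F u)) g) = cnj (L2_inner \<mu> (fc (\<lambda>u. cnj (F u)) g) f)"
    by (rule L2_inner_cnj[symmetric])
  also have "\<dots> = cnj (form (half_line (\<lambda>u. cnj (F u))) g f)"
    using F f g by (subst fc_inner) (auto simp: half_line_cnj bounded_borel_cnj)
  also have "\<dots> = form (half_line F) f g"
    unfolding half_line_cnj using form_cnj[OF bounded_borel_cnj[OF F] g f] by simp
  finally show ?thesis by (simp add: fc_inner F f g)
qed

lemma form_half_line_superposition:
  fixes G :: "'i \<Rightarrow> real \<Rightarrow> complex"
  assumes N: "sigma_finite_measure N"
    and G[measurable]: "(\<lambda>(v, u). G v u) \<in> borel_measurable (N \<Otimes>\<^sub>M borel)"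
    and w: "integrable N w" and G_le: "\<And>v u. v \<in> space N \<Longrightarrow> 0 \<le> u \<Longrightarrow> norm (G v u) \<le> w v"
    and F: "\<And>u. 0 \<le> u \<Longrightarrow> F u = (LINT v|N. G v u)"
    and f: "f \<in> Lp \<mu> 2" "g \<in> Lp \<mu> 2"
  shows "integrable N (\<lambda>v. form (half_line (G v)) f g)"
    and "form (half_line F) f g = (LINT v|N. form (half_line (G v)) f g)"
proof -
  have half_line_measurable: "(\<lambda>(v, u). half_line (G v) u) \<in> borel_measurable (N \<Otimes>\<^sub>M borel)"
    unfolding half_line_def by measurable
  have half_line_le: "norm (half_line (G v) u) \<le> w v" if "v \<in> space N" for v u
    using G_le[OF that, of u] G_le[OF that, of 0] norm_ge_zero[of "G v 0"]
    by (auto simp: half_line_def simp del: norm_ge_zero)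
  have half_line_eq: "half_line F u = (LINT v|N. half_line (G v) u)" for u
    using F[of u] by (simp add: half_line_def)
  show "integrable N (\<lambda>v. form (half_line (G v)) f g)"
    "form (half_line F) f g = (LINT v|N. form (half_line (G v)) f g)"
    using form_superposition[OF N half_line_measurable w _ _ f, of "half_line F"] half_line_le
      half_line_eq by blast+
qed

definition L1_Linfinity_bounded :: "(real \<Rightarrow> complex) \<Rightarrow> real \<Rightarrow> bool" where
  "L1_Linfinity_bounded F M \<longleftrightarrow> bounded_borel (half_line F) \<and>
     (\<forall>f\<in>Lp \<mu> 2 \<inter> Lp \<mu> 1. \<forall>g\<in>Lp \<mu> 2 \<inter> Lp \<mu> \<infinity>.
        norm (form (half_line F) f g) \<le> M * (Lp_norm \<mu> 1 f * Lp_norm \<mu> \<infinity> g) \<and>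
        norm (form (half_line F) g f) \<le> M * (Lp_norm \<mu> 1 f * Lp_norm \<mu> \<infinity> g))"

lemma L1_Linfinity_bounded_zero: "L1_Linfinity_bounded (\<lambda>u. 0) 0"
  using bounded_borel_const[of 0]
  by (auto simp: L1_Linfinity_bounded_def form_def half_line_def[abs_def])

lemma L1_Linfinity_bounded_scale:
  assumes "L1_Linfinity_bounded F M" shows "L1_Linfinity_bounded (\<lambda>u. c * F u) (norm c * M)"
  using assms by (auto simp: L1_Linfinity_bounded_def half_line_scale bounded_borel_scale form_scale
      norm_mult mult.assoc intro!: mult_left_mono)

lemma L1_Linfinity_bounded_mono:
  assumes F: "L1_Linfinity_bounded F M" and M_le: "M \<le> M'" shows "L1_Linfinity_bounded F M'"
proof -
  have "M * (Lp_norm \<mu> 1 f * Lp_norm \<mu> \<infinity> g) \<le> M' * (Lp_norm \<mu> 1 f * Lp_norm \<mu> \<infinity> g)" for f g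
    using M_le by (intro mult_right_mono mult_nonneg_nonneg Lp_norm_nonneg)
  then show ?thesis using F unfolding L1_Linfinity_bounded_def by (blast intro: order_trans)
qed

lemma L1_Linfinity_bounded_superposition:
  fixes G :: "'i \<Rightarrow> real \<Rightarrow> complex"
  assumes N: "sigma_finite_measure N"
    and G: "(\<lambda>(v, u). G v u) \<in> borel_measurable (N \<Otimes>\<^sub>M borel)"
    and w: "integrable N w" and G_le: "\<And>v u. v \<in> space N \<Longrightarrow> 0 \<le> u \<Longrightarrow> norm (G v u) \<le> w v"
    and F: "bounded_borel (half_line F)" "\<And>u. 0 \<le> u \<Longrightarrow> F u = (LINT v|N. G v u)"
    and m: "integrable N m" and G_bounded: "\<And>v. v \<in> space N \<Longrightarrow> L1_Linfinity_bounded (G v) (m v)"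
  shows "L1_Linfinity_bounded F (LINT v|N. m v)"
proof -
  have superposition: "integrable N (\<lambda>v. form (half_line (G v)) f g)"
    "form (half_line F) f g = (LINT v|N. form (half_line (G v)) f g)"
      if "f \<in> Lp \<mu> 2" "g \<in> Lp \<mu> 2" for f g
    using form_half_line_superposition[OF N G w _ _ that, of F] G_le F(2) by blast+
  have form_le: "norm (form (half_line F) f g) \<le> (LINT v|N. m v) * c"
    if f: "f \<in> Lp \<mu> 2" "g \<in> Lp \<mu> 2"
      and c: "\<And>v. v \<in> space N \<Longrightarrow> norm (form (half_line (G v)) f g) \<le> m v * c"
    for f g c
  proof -
    have "norm (form (half_line F) f g) \<le> (LINT v|N. norm (form (half_line (G v)) f g))"
      unfolding superposition(2)[OF f] by (rule integral_norm_bound)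
    also have "\<dots> \<le> (LINT v|N. m v * c)"
      using m c by (intro integral_mono integrable_norm superposition(1)[OF f]) auto
    finally show ?thesis by simp
  qed
  show ?thesis
    using F(1) G_bounded unfolding L1_Linfinity_bounded_def by (auto intro!: form_le)
qed

end

section \<open>Termwise integration of series\<close>

lemma AE_summable_if_summable_integral_norm:
  fixes f :: "nat \<Rightarrow> 'a \<Rightarrow> 'b::{banach, second_countable_topology}"
  assumes f: "\<And>n. integrable M (f n)" and summable: "summable (\<lambda>n. LINT x|M. norm (f n x))"
  shows "AE x in M. summable (\<lambda>n. norm (f n x))"
proof -
  note [measurable] = borel_measurable_integrable[OF f]
  have "(\<integral>\<^sup>+x. (\<Sum>n. ennreal (norm (f n x))) \<partial>M) = (\<Sum>n. \<integral>\<^sup>+x. ennreal (norm (f n x)) \<partial>M)"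
    by (rule nn_integral_suminf) measurable
  also have "\<dots> = ennreal (\<Sum>n. LINT x|M. norm (f n x))"
    using f summable by (simp add: nn_integral_eq_integral suminf_ennreal2)
  finally have "AE x in M. (\<Sum>n. ennreal (norm (f n x))) \<noteq> \<infinity>"
    by (intro nn_integral_noteq_infinite) auto
  then show ?thesis by eventually_elim (rule summable_suminf_not_top, auto)
qed

lemma sums_integral_if_summable_norm:
  fixes f :: "nat \<Rightarrow> 'a \<Rightarrow> 'b::{banach, second_countable_topology}"
  assumes f: "\<And>n. integrable M (f n)" and summable: "summable (\<lambda>n. LINT x|M. norm (f n x))"
    and g[measurable]: "g \<in> borel_measurable M" and sums: "AE x in M. (\<lambda>n. f n x) sums g x"
  shows "integrable M g" "(\<lambda>n. LINT x|M. f n x) sums (LINT x|M. g x)"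
    and "(LINT x|M. norm (g x)) \<le> (\<Sum>n. LINT x|M. norm (f n x))"
proof -
  note [measurable] = borel_measurable_integrable[OF f]
  note norm_summable = AE_summable_if_summable_integral_norm[OF f summable]
  have suminf_eq: "AE x in M. (\<Sum>n. f n x) = g x" using sums by eventually_elim (simp add: sums_iff)
  show g_int: "integrable M g"
    by (rule integrable_cong_AE_imp[OF integrable_suminf[OF f norm_summable summable]])
      (use suminf_eq in auto)
  have "(LINT x|M. (\<Sum>n. f n x)) = (LINT x|M. g x)"
    by (rule integral_cong_AE) (use suminf_eq in auto)
  with sums_integral[OF f norm_summable summable] show "(\<lambda>n. LINT x|M. f n x) sums (LINT x|M. g x)"
    by simp
  have "(LINT x|M. norm (g x)) \<le> (LINT x|M. (\<Sum>n. norm (f n x)))"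
  proof (rule integral_mono_AE[OF integrable_norm[OF g_int]])
    show "integrable M (\<lambda>x. \<Sum>n. norm (f n x))"
      using f summable norm_summable by (intro integrable_suminf) auto
    show "AE x in M. norm (g x) \<le> (\<Sum>n. norm (f n x))"
      using suminf_eq norm_summable by eventually_elim (metis summable_norm)
  qed
  also have "\<dots> = (\<Sum>n. LINT x|M. norm (f n x))"
    using f summable norm_summable by (intro integral_suminf) auto
  finally show "(LINT x|M. norm (g x)) \<le> (\<Sum>n. LINT x|M. norm (f n x))" .
qed

section \<open>Duality between the exponents 1 and infinity\<close>

lemma mult_cnj_sgn: "z * cnj (sgn z) = complex_of_real (norm z)"
proof (cases "z = 0")
  case False
  have "z * cnj (sgn z) = (z * cnj z) / complex_of_real (norm z)"
    by (simp add: sgn_div_norm scaleR_conv_of_real divide_inverse mult_ac)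
  also have "\<dots> = complex_of_real ((norm z)\<^sup>2) / complex_of_real (norm z)"
    by (simp only: complex_norm_square)
  finally show ?thesis using False by (simp add: power2_eq_square)
qed simp

definition finite_exhaustion :: "'a measure \<Rightarrow> (nat \<Rightarrow> 'a set) \<Rightarrow> bool" where
  "finite_exhaustion M A \<longleftrightarrow>
     (\<forall>n. A n \<in> sets M \<and> emeasure M (A n) < \<infinity>) \<and> (\<Union>n. A n) = space M \<and> incseq A"

lemma (in sigma_finite_measure) finite_exhaustion_exists: obtains A where "finite_exhaustion M A"
proof -
  obtain A :: "nat \<Rightarrow> 'a set" where "range A \<subseteq> sets M" "(\<Union>i. A i) = space M"
    "\<And>i. emeasure M (A i) \<noteq> \<infinity>" "incseq A"
    using sigma_finite_incseq by metis
  then show ?thesis by (intro that[of A]) (auto simp: finite_exhaustion_def less_top)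
qed

lemma finite_exhaustion_subset_finite:
  "finite_exhaustion M A \<Longrightarrow> S \<subseteq> A n \<Longrightarrow> emeasure M S < \<infinity>"
  using emeasure_mono[of S "A n" M] by (auto simp: finite_exhaustion_def intro: le_less_trans)

definition phase_on :: "'a set \<Rightarrow> ('a \<Rightarrow> complex) \<Rightarrow> 'a \<Rightarrow> complex" where
  "phase_on A h x = indicator A x * sgn (h x)"

lemma mult_cnj_phase_on: "h x * cnj (phase_on A h x) = complex_of_real (indicator A x * norm (h x))"
  using mult_cnj_sgn[of "h x"] by (simp add: phase_on_def indicator_def)

lemma norm_phase_on_le: "norm (phase_on A h x) \<le> indicator A x"
  by (simp add: phase_on_def indicator_def norm_sgn)

lemma
  assumes h[measurable]: "h \<in> borel_measurable \<mu>" and A[measurable]: "A \<in> sets \<mu>"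
    and finite_A: "emeasure \<mu> A < \<infinity>"
  shows phase_on_L1: "phase_on A h \<in> Lp \<mu> 1"
    and phase_on_Linfinity: "phase_on A h \<in> Lp \<mu> \<infinity>"
    and L1_norm_phase_on_le: "Lp_norm \<mu> 1 (phase_on A h) \<le> measure \<mu> A"
    and Linfinity_norm_phase_on_le: "Lp_norm \<mu> \<infinity> (phase_on A h) \<le> 1"
proof -
  have phase_measurable[measurable]: "phase_on A h \<in> borel_measurable \<mu>"
    unfolding phase_on_def[abs_def] by measurable
  have integrable_indicator: "integrable \<mu> (indicator A :: _ \<Rightarrow> real)" using finite_A by simp
  show phase_L1: "phase_on A h \<in> Lp \<mu> 1" unfolding Lp_1_iff
    by (rule Bochner_Integration.integrable_bound[OF integrable_indicator])
      (auto intro: norm_phase_on_le)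
  have "(LINT x|\<mu>. norm (phase_on A h x)) \<le> (LINT x|\<mu>. indicator A x)"
    using phase_L1 integrable_indicator
    by (intro integral_mono norm_phase_on_le) (auto simp: Lp_1_iff)
  also have "\<dots> = measure \<mu> A" using A by (simp add: Int_absorb2 sets.sets_into_space)
  finally show "Lp_norm \<mu> 1 (phase_on A h) \<le> measure \<mu> A" using phase_L1 by (simp add: Lp_norm_1)
  have phase_le_1: "AE x in \<mu>. norm (phase_on A h x) \<le> 1"
    by (intro AE_I2 order_trans[OF norm_phase_on_le]) (simp add: indicator_def)
  show "phase_on A h \<in> Lp \<mu> \<infinity>" using phase_measurable phase_le_1 by (rule Lp_infinityI)
  show "Lp_norm \<mu> \<infinity> (phase_on A h) \<le> 1"
    using phase_measurable phase_le_1 by (intro Lp_norm_infinity_le) auto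
qed

lemma AE_norm_le_if_phase_integrals:
  assumes h[measurable]: "h \<in> borel_measurable \<mu>"
    and A: "finite_exhaustion \<mu> A"
    and integrable_phase:
      "\<And>n S. S \<in> sets \<mu> \<Longrightarrow> S \<subseteq> A n \<Longrightarrow> integrable \<mu> (\<lambda>x. h x * cnj (phase_on S h x))"
    and bound:
      "\<And>n S. S \<in> sets \<mu> \<Longrightarrow> S \<subseteq> A n \<Longrightarrow> norm (LINT x|\<mu>. h x * cnj (phase_on S h x)) \<le> K * measure \<mu> S"
  shows "AE x in \<mu>. norm (h x) \<le> K"
proof -
  have "AE x in \<mu>. x \<in> A n \<longrightarrow> norm (h x) \<le> K" for n
  proof -
    have [measurable]: "A n \<in> sets \<mu>" using A by (simp add: finite_exhaustion_def)
    let ?S = "A n \<inter> {x\<in>space \<mu>. norm (h x) > K}"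
    have S_sets[measurable]: "?S \<in> sets \<mu>" by measurable
    have finite_S: "emeasure \<mu> ?S < \<infinity>" using finite_exhaustion_subset_finite[OF A, of ?S n] by simp
    have h_int: "integrable \<mu> (\<lambda>x. indicator ?S x * norm (h x))"
      using integrable_phase[OF S_sets, of n]
      unfolding mult_cnj_phase_on complex_of_real_integrable_eq by blast
    have K_int: "integrable \<mu> (\<lambda>x. indicator ?S x * K)"
      using S_sets finite_S by (intro integrable_mult_left) simp
    have "(LINT x|\<mu>. indicator ?S x * norm (h x)) \<le> K * measure \<mu> ?S"
      using bound[OF S_sets, of n] unfolding mult_cnj_phase_on integral_complex_of_real norm_of_real
      by simp
    then have "(LINT x|\<mu>. indicator ?S x * norm (h x) - indicator ?S x * K) \<le> 0"
      using h_int K_int S_sets by (simp add: Int_absorb2 sets.sets_into_space mult.commute)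
    moreover have nonneg: "AE x in \<mu>. 0 \<le> indicator ?S x * norm (h x) - indicator ?S x * K"
      by (auto simp: indicator_def)
    ultimately have "(LINT x|\<mu>. indicator ?S x * norm (h x) - indicator ?S x * K) = 0"
      using integral_nonneg_AE[OF nonneg] by simp
    then have "AE x in \<mu>. indicator ?S x * norm (h x) - indicator ?S x * K = 0"
      using h_int K_int nonneg by (subst (asm) integral_nonneg_eq_0_iff_AE) auto
    then show ?thesis using AE_space by eventually_elim (auto simp: indicator_def split: if_splits)
  qed
  then have "AE x in \<mu>. \<forall>n. x \<in> A n \<longrightarrow> norm (h x) \<le> K" by (subst AE_all_countable) simp
  then show ?thesis using AE_space by eventually_elim (use A in \<open>auto simp: finite_exhaustion_def\<close>)
qed

lemma L1_norm_tail_tendsto_0: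
  assumes f: "f \<in> Lp M 1" and A: "finite_exhaustion M A"
  shows "(\<lambda>n. Lp_norm M 1 (\<lambda>x. (1 - indicator (A n) x) * f x)) \<longlonglongrightarrow> 0"
proof -
  note [measurable] = Lp_measurable[OF f]
  have [measurable]: "A n \<in> sets M" for n using A by (simp add: finite_exhaustion_def)
  have tail_le: "norm ((1 - indicator (A n) x) * f x) \<le> norm (f x)" for n x
    by (simp add: indicator_def)
  have tail_L1: "(\<lambda>x. (1 - indicator (A n) x) * f x) \<in> Lp M 1" for n
    unfolding Lp_1_iff
    by (rule Bochner_Integration.integrable_bound[of M f]) (use f tail_le in \<open>auto simp: Lp_1_iff\<close>)
  have "(\<lambda>n. LINT x|M. norm ((1 - indicator (A n) x) * f x)) \<longlonglongrightarrow> (LINT x|M. 0)"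
  proof (rule integral_dominated_convergence[where w="\<lambda>x. norm (f x)"])
    show "AE x in M. (\<lambda>n. norm ((1 - indicator (A n) x) * f x)) \<longlonglongrightarrow> 0"
    proof (rule AE_I2, rule tendsto_eventually)
      fix x assume "x \<in> space M"
      then obtain N where "x \<in> A N" using A by (auto simp: finite_exhaustion_def)
      then have "x \<in> A n" if "n \<ge> N" for n
        using A that unfolding finite_exhaustion_def incseq_def by blast
      then show "\<forall>\<^sub>F n in sequentially. norm ((1 - indicator (A n) x) * f x) = 0"
        unfolding eventually_sequentially by (intro exI[of _ N]) (auto simp: indicator_def)
    qed
  qed (use f tail_le in \<open>auto simp: Lp_1_iff\<close>)
  then show ?thesis by (simp add: Lp_norm_1[OF tail_L1])
qed

lemma finite_exhaustion_superlevel: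
  fixes v :: "'a \<Rightarrow> real"
  assumes v[measurable]: "v \<in> borel_measurable M" and pos: "\<And>x. 0 < v x"
    and integrable_v2: "integrable M (\<lambda>x. (v x)\<^sup>2)"
  shows "finite_exhaustion M (\<lambda>n. {x\<in>space M. 1 < real (Suc n) * v x})"
proof -
  let ?A = "\<lambda>n. {x\<in>space M. 1 < real (Suc n) * v x}"
  have "emeasure M (?A n) < \<infinity>" for n
  proof -
    have "integrable M (indicator (?A n) :: _ \<Rightarrow> real)"
    proof (rule Bochner_Integration.integrable_bound)
      show "integrable M (\<lambda>x. (real (Suc n) * v x)\<^sup>2)"
        using integrable_v2 by (simp add: power_mult_distrib)
      have "1 \<le> (real (Suc n) * v x)\<^sup>2" if "x \<in> ?A n" for x using that by (intro one_le_power) simp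
      then show "AE x in M. norm (indicator (?A n) x :: real) \<le> norm ((real (Suc n) * v x)\<^sup>2)"
        by (auto simp: indicator_def simp del: of_nat_Suc)
    qed simp
    then show ?thesis by (simp add: integrable_indicator_iff)
  qed
  moreover have "\<exists>n. 1 < real (Suc n) * v x" for x
    using reals_Archimedean[OF pos[of x]] by (auto simp: inverse_eq_divide field_simps)
  moreover have "real (Suc m) * v x \<le> real (Suc n) * v x" if "m \<le> n" for m n x
    using that pos[of x] by (intro mult_right_mono) auto
  then have "incseq ?A" unfolding incseq_def by (blast intro: less_le_trans)
  ultimately show ?thesis unfolding finite_exhaustion_def by (auto simp del: of_nat_Suc)
qed

context sigma_finite_measure begin

lemma AE_norm_le_if_pairings:
  assumes h: "h \<in> borel_measurable M"
    and integrable_pairing: "\<And>g. g \<in> Lp M 1 \<inter> Lp M \<infinity> \<Longrightarrow> integrable M (\<lambda>x. h x * cnj (g x))"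
    and bound: "\<And>g. g \<in> Lp M 1 \<inter> Lp M \<infinity> \<Longrightarrow> norm (L2_inner M h g) \<le> K * Lp_norm M 1 g"
    and K: "K \<ge> 0"
  shows "AE x in M. norm (h x) \<le> K"
proof -
  obtain A where A: "finite_exhaustion M A" by (rule finite_exhaustion_exists)
  note finite_subset = finite_exhaustion_subset_finite[OF A]
  show ?thesis
  proof (rule AE_norm_le_if_phase_integrals[OF h A])
    fix n S assume S: "S \<in> sets M" "S \<subseteq> A n"
    have g: "phase_on S h \<in> Lp M 1 \<inter> Lp M \<infinity>"
      using phase_on_L1 phase_on_Linfinity h S finite_subset by blast
    show "integrable M (\<lambda>x. h x * cnj (phase_on S h x))" by (rule integrable_pairing[OF g])
    have "norm (LINT x|M. h x * cnj (phase_on S h x)) \<le> K * Lp_norm M 1 (phase_on S h)"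
      using bound[OF g] by (simp add: L2_inner_def)
    also have "\<dots> \<le> K * measure M S"
      using L1_norm_phase_on_le[OF h S(1) finite_subset[OF S(2)]] K by (rule mult_left_mono)
    finally show "norm (LINT x|M. h x * cnj (phase_on S h x)) \<le> K * measure M S" .
  qed
qed

lemma L1_if_pairings:
  assumes h[measurable]: "h \<in> borel_measurable M"
    and integrable_pairing: "\<And>g. g \<in> Lp M 1 \<inter> Lp M \<infinity> \<Longrightarrow> integrable M (\<lambda>x. h x * cnj (g x))"
    and bound: "\<And>g. g \<in> Lp M 1 \<inter> Lp M \<infinity> \<Longrightarrow> norm (L2_inner M h g) \<le> K * Lp_norm M \<infinity> g"
    and K: "K \<ge> 0"
  shows "h \<in> Lp M 1" "Lp_norm M 1 h \<le> K"
proof -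
  obtain A where A: "finite_exhaustion M A" by (rule finite_exhaustion_exists)
  have A_sets[measurable]: "A n \<in> sets M" for n using A by (simp add: finite_exhaustion_def)
  have integral_A_le: "(\<integral>\<^sup>+x. ennreal (indicator (A n) x * norm (h x)) \<partial>M) \<le> ennreal K" for n
  proof -
    have finite_A: "emeasure M (A n) < \<infinity>" using A by (simp add: finite_exhaustion_def)
    have g: "phase_on (A n) h \<in> Lp M 1 \<inter> Lp M \<infinity>"
      using phase_on_L1 phase_on_Linfinity h A_sets finite_A by blast
    have "integrable M (\<lambda>x. indicator (A n) x * norm (h x))"
      using integrable_pairing[OF g] unfolding mult_cnj_phase_on complex_of_real_integrable_eq .
    moreover have "(LINT x|M. indicator (A n) x * norm (h x)) \<le> K * Lp_norm M \<infinity> (phase_on (A n) h)"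
      using bound[OF g]
      unfolding L2_inner_def mult_cnj_phase_on integral_complex_of_real norm_of_real by simp
    moreover have "K * Lp_norm M \<infinity> (phase_on (A n) h) \<le> K * 1"
      using Linfinity_norm_phase_on_le[OF h A_sets finite_A] K by (rule mult_left_mono)
    ultimately show ?thesis by (subst nn_integral_eq_integral) (auto intro: ennreal_leI)
  qed
  have "(\<integral>\<^sup>+x. ennreal (norm (h x)) \<partial>M) =
      (\<integral>\<^sup>+x. (SUP n. ennreal (indicator (A n) x * norm (h x))) \<partial>M)"
  proof (rule nn_integral_cong, rule antisym)
    fix x assume "x \<in> space M"
    then obtain n where "x \<in> A n" using A by (auto simp: finite_exhaustion_def)
    then show "ennreal (norm (h x)) \<le> (SUP n. ennreal (indicator (A n) x * norm (h x)))"
      by (intro SUP_upper2[of n]) auto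
    show "(SUP n. ennreal (indicator (A n) x * norm (h x))) \<le> ennreal (norm (h x))"
      by (intro SUP_least ennreal_leI) (auto simp: indicator_def)
  qed
  also have "\<dots> = (SUP n. \<integral>\<^sup>+x. ennreal (indicator (A n) x * norm (h x)) \<partial>M)"
  proof (rule nn_integral_monotone_convergence_SUP)
    have "A m \<subseteq> A n" if "m \<le> n" for m n using A that by (simp add: finite_exhaustion_def incseq_def)
    then show "incseq (\<lambda>n x. ennreal (indicator (A n) x * norm (h x)))"
      by (fastforce simp: incseq_def le_fun_def indicator_def intro: ennreal_leI)
  qed auto
  also have "\<dots> \<le> ennreal K" by (intro SUP_least integral_A_le)
  finally have nn_integral_le: "(\<integral>\<^sup>+x. ennreal (norm (h x)) \<partial>M) \<le> ennreal K" .
  then show h_L1: "h \<in> Lp M 1"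
    using le_less_trans[OF nn_integral_le ennreal_less_top]
    by (auto simp: Lp_1_iff integrable_iff_bounded)
  from nn_integral_le show "Lp_norm M 1 h \<le> K"
    using h_L1 K by (subst (asm) nn_integral_eq_integral) (auto simp: Lp_1_iff Lp_norm_1[OF h_L1])
qed

lemma positive_L2_weight:
  obtains v :: "'a \<Rightarrow> real" where "v \<in> borel_measurable M" "\<And>x. 0 < v x" "\<And>x. v x \<le> 1"
    "integrable M (\<lambda>x. (v x)\<^sup>2)"
proof -
  obtain w :: "'a \<Rightarrow> ennreal" where w[measurable]: "w \<in> borel_measurable M"
    and w_fin: "(\<integral>\<^sup>+x. w x \<partial>M) \<noteq> \<infinity>"
    and w_pos: "\<And>x. x \<in> space M \<Longrightarrow> 0 < w x" "\<And>x. x \<in> space M \<Longrightarrow> w x < \<infinity>"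
    using Ex_finite_integrable_function by metis
  define v where "v x = (if x \<in> space M then min 1 (sqrt (enn2real (w x))) else 1)" for x
  have v[measurable]: "v \<in> borel_measurable M"
    by (rule measurable_cong[THEN iffD2, of _ _ "\<lambda>x. min 1 (sqrt (enn2real (w x)))"])
      (auto simp: v_def)
  have v_pos: "0 < v x" for x using w_pos[of x] by (auto simp: v_def enn2real_positive_iff)
  have "(\<integral>\<^sup>+x. ennreal ((v x)\<^sup>2) \<partial>M) \<le> (\<integral>\<^sup>+x. w x \<partial>M)"
  proof (rule nn_integral_mono)
    fix x assume x: "x \<in> space M"
    have "(v x)\<^sup>2 \<le> (sqrt (enn2real (w x)))\<^sup>2"
      using x v_pos[of x] by (intro power_mono) (auto simp: v_def)
    then have "ennreal ((v x)\<^sup>2) \<le> ennreal (enn2real (w x))" by (intro ennreal_leI) simp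
    also have "ennreal (enn2real (w x)) = w x" using w_pos(2)[OF x] by simp
    finally show "ennreal ((v x)\<^sup>2) \<le> w x" .
  qed
  then have "(\<integral>\<^sup>+x. ennreal ((v x)\<^sup>2) \<partial>M) < \<infinity>" using w_fin by (simp add: le_less_trans less_top)
  then have "integrable M (\<lambda>x. (v x)\<^sup>2)" by (auto simp: integrable_iff_bounded)
  moreover have "v x \<le> 1" for x by (simp add: v_def)
  ultimately show ?thesis using that v v_pos by blast
qed

end

locale L1_functional = sigma_finite_measure \<mu> for \<mu> :: "'a measure" +
  fixes l :: "('a \<Rightarrow> complex) \<Rightarrow> complex" and K :: real
  assumes l_add: "\<And>f g. f \<in> Lp \<mu> 1 \<inter> Lp \<mu> 2 \<Longrightarrow> g \<in> Lp \<mu> 1 \<inter> Lp \<mu> 2 \<Longrightarrow> l (\<lambda>x. f x + g x) = l f + l g"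
    and l_scale: "\<And>f c. f \<in> Lp \<mu> 1 \<inter> Lp \<mu> 2 \<Longrightarrow> l (\<lambda>x. c * f x) = c * l f"
    and l_bound: "\<And>f. f \<in> Lp \<mu> 1 \<inter> Lp \<mu> 2 \<Longrightarrow> norm (l f) \<le> K * Lp_norm \<mu> 1 f"
    and K: "K \<ge> 0"
begin

text \<open>On \<open>L\<^sup>2\<close> the functional \<open>\<phi> \<mapsto> l (v \<phi>)\<close> is bounded; dividing its Riesz representative by
  \<open>v\<close> gives the density of \<open>l\<close>.\<close>
lemma weighted_representative:
  assumes v[measurable]: "v \<in> borel_measurable \<mu>" and v_bounds: "\<And>x. 0 < v x" "\<And>x. v x \<le> 1"
    and v_int: "integrable \<mu> (\<lambda>x. (v x)\<^sup>2)"
  shows "\<exists>k\<in>Lp \<mu> 2. \<forall>\<phi>\<in>Lp \<mu> 2. l (\<lambda>x. complex_of_real (v x) * \<phi> x) = L2_inner \<mu> \<phi> k"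
proof -
  let ?v = "\<lambda>x. complex_of_real (v x)"
  have v_L2: "?v \<in> Lp \<mu> 2" using v_int by (simp add: Lp_2_iff)
  have v\<phi>: "(\<lambda>x. ?v x * \<phi> x) \<in> Lp \<mu> 1 \<inter> Lp \<mu> 2" if \<phi>: "\<phi> \<in> Lp \<mu> 2" for \<phi>
  proof
    note [measurable] = L2_measurable[OF \<phi>]
    show "(\<lambda>x. ?v x * \<phi> x) \<in> Lp \<mu> 1" using L2_integrable_mult[OF v_L2 \<phi>] by (simp add: Lp_1_iff)
    show "(\<lambda>x. ?v x * \<phi> x) \<in> Lp \<mu> 2"
      using v_bounds
      by (intro Lp_dominated[OF \<phi>] AE_I2) (auto simp: norm_mult mult_left_le_one_le less_imp_le)
  qed
  show ?thesis
  proof (rule L2_Riesz_representation)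
    fix f g assume "f \<in> Lp \<mu> 2" "g \<in> Lp \<mu> 2"
    then show "l (\<lambda>x. ?v x * (f x + g x)) = l (\<lambda>x. ?v x * f x) + l (\<lambda>x. ?v x * g x)"
      unfolding distrib_left by (intro l_add v\<phi>)
  next
    fix f c assume "f \<in> Lp \<mu> 2"
    then show "l (\<lambda>x. ?v x * (c * f x)) = c * l (\<lambda>x. ?v x * f x)"
      using l_scale[OF v\<phi>, of f c] by (simp add: mult.left_commute)
  next
    fix f assume f: "f \<in> Lp \<mu> 2"
    have "norm (l (\<lambda>x. ?v x * f x)) \<le> K * Lp_norm \<mu> 1 (\<lambda>x. ?v x * f x)"
      by (rule l_bound[OF v\<phi>[OF f]])
    also have "Lp_norm \<mu> 1 (\<lambda>x. ?v x * f x) \<le> Lp_norm \<mu> 2 ?v * Lp_norm \<mu> 2 f"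
      using L2_Cauchy_Schwarz_norm[OF v_L2 f] v\<phi>[OF f] by (simp add: Lp_norm_1 norm_mult)
    finally show "norm (l (\<lambda>x. ?v x * f x)) \<le> K * Lp_norm \<mu> 2 ?v * Lp_norm \<mu> 2 f"
      using K by (simp add: mult_left_mono mult.assoc)
  qed
qed

definition locally_represented :: "(nat \<Rightarrow> 'a set) \<Rightarrow> ('a \<Rightarrow> complex) \<Rightarrow> bool" where
  "locally_represented A h \<longleftrightarrow> h \<in> borel_measurable \<mu> \<and>
     (\<forall>n. \<forall>g\<in>Lp \<mu> 1 \<inter> Lp \<mu> 2. (\<forall>x\<in>space \<mu> - A n. g x = 0) \<longrightarrow>
        integrable \<mu> (\<lambda>x. g x * cnj (h x)) \<and> l g = L2_inner \<mu> g h)"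

lemma locally_represented_divide_weight:
  assumes v[measurable]: "v \<in> borel_measurable \<mu>" and v_pos: "\<And>x. 0 < v x"
    and k: "k \<in> Lp \<mu> 2"
    and represents: "\<And>\<phi>. \<phi> \<in> Lp \<mu> 2 \<Longrightarrow> l (\<lambda>x. complex_of_real (v x) * \<phi> x) = L2_inner \<mu> \<phi> k"
  shows "locally_represented (\<lambda>n. {x\<in>space \<mu>. 1 <
      real (Suc n) * v x}) (\<lambda>x. k x / complex_of_real (v x))"
  unfolding locally_represented_def
proof (intro conjI allI ballI impI)
  note [measurable] = L2_measurable[OF k]
  show "(\<lambda>x. k x / complex_of_real (v x)) \<in> borel_measurable \<mu>" by measurable
  fix n g
  assume g: "g \<in> Lp \<mu> 1 \<inter> Lp \<mu> 2"
    and support: "\<forall>x\<in>space \<mu> - {x\<in>space \<mu>. 1 < real (Suc n) * v x}. g x = 0"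
  define \<phi> where "\<phi> x = g x / complex_of_real (v x)" for x
  have "\<phi> \<in> Lp \<mu> 2"
  proof (rule Lp_dominated)
    show "(\<lambda>x. complex_of_real (real (Suc n)) * g x) \<in> Lp \<mu> 2" using g by (simp add: L2_scale)
    show "\<phi> \<in> borel_measurable \<mu>" unfolding \<phi>_def using g by (auto dest: L2_measurable)
    have "norm (\<phi> x) \<le> norm (complex_of_real (real (Suc n)) * g x)" if x: "x \<in> space \<mu>" for x
    proof (cases "1 < real (Suc n) * v x")
      case True
      then have "inverse (v x) \<le> real (Suc n)" using v_pos[of x] by (simp add: field_simps)
      from mult_right_mono[OF this norm_ge_zero[of "g x"]] show ?thesis using v_pos[of x]
        by (simp add: \<phi>_def norm_divide norm_mult norm_inverse divide_inverse mult.commute del: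
            of_nat_Suc)
    qed (use x support in \<open>simp add: \<phi>_def\<close>)
    then show "AE x in \<mu>. norm (\<phi> x) \<le> norm (complex_of_real (real (Suc n)) * g x)" by (rule AE_I2)
  qed
  moreover have "g x * cnj (k x / complex_of_real (v x)) = \<phi> x * cnj (k x)" for x
    by (simp add: \<phi>_def)
  moreover have "(\<lambda>x. complex_of_real (v x) * \<phi> x) = g"
    using v_pos by (auto simp: \<phi>_def less_imp_neq[symmetric])
  ultimately show "integrable \<mu> (\<lambda>x. g x * cnj (k x / complex_of_real (v x)))"
    "l g = L2_inner \<mu> g (\<lambda>x. k x / complex_of_real (v x))"
    using represents[of \<phi>] L2_inner_integrable[OF _ k, of \<phi>] by (simp_all add: L2_inner_def)
qed

lemma locally_represented_exists:
  obtains A h where "finite_exhaustion \<mu> A" "locally_represented A h"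
proof -
  obtain v :: "'a \<Rightarrow> real" where v: "v \<in> borel_measurable \<mu>" "\<And>x. 0 < v x" "\<And>x. v x \<le> 1"
    "integrable \<mu> (\<lambda>x. (v x)\<^sup>2)"
    by (rule positive_L2_weight) blast
  obtain k where "k \<in> Lp \<mu> 2"
    "\<And>\<phi>. \<phi> \<in> Lp \<mu> 2 \<Longrightarrow> l (\<lambda>x. complex_of_real (v x) * \<phi> x) = L2_inner \<mu> \<phi> k"
    using weighted_representative[OF v] by blast
  from that[OF finite_exhaustion_superlevel[OF v(1,2,4)]
      locally_represented_divide_weight[OF v(1,2) this]]
  show ?thesis .
qed

lemma locally_represented_AE_norm_le:
  assumes A: "finite_exhaustion \<mu> A" and represents: "locally_represented A h"
  shows "AE x in \<mu>. norm (h x) \<le> K"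
proof -
  have h: "h \<in> borel_measurable \<mu>" using represents by (simp add: locally_represented_def)
  show ?thesis
  proof (rule AE_norm_le_if_phase_integrals[OF h A])
    fix n S assume S: "S \<in> sets \<mu>" "S \<subseteq> A n"
    note fin = finite_exhaustion_subset_finite[OF A S(2)]
    note phase = phase_on_L1[OF h S(1) fin] phase_on_Linfinity[OF h S(1) fin]
    have g: "phase_on S h \<in> Lp \<mu> 1 \<inter> Lp \<mu> 2" using phase L1_Linfinity_imp_L2[OF phase] by blast
    have "\<forall>x\<in>space \<mu> - A n. phase_on S h x = 0"
      using S(2) by (auto simp: phase_on_def indicator_def)
    then have integrable_phase: "integrable \<mu> (\<lambda>x. phase_on S h x * cnj (h x))"
      and l_phase: "l (phase_on S h) = L2_inner \<mu> (phase_on S h) h"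
      using represents g unfolding locally_represented_def by blast+
    show "integrable \<mu> (\<lambda>x. h x * cnj (phase_on S h x))"
      using integrable_cnj[OF integrable_phase] by (simp add: mult.commute)
    have "(LINT x|\<mu>. h x * cnj (phase_on S h x)) = cnj (l (phase_on S h))"
      unfolding l_phase L2_inner_cnj by (simp add: L2_inner_def)
    then have "norm (LINT x|\<mu>. h x * cnj (phase_on S h x)) \<le> K * Lp_norm \<mu> 1 (phase_on S h)"
      using l_bound[OF g] by simp
    also have "\<dots> \<le> K * measure \<mu> S"
      using L1_norm_phase_on_le[OF h S(1) fin] K by (rule mult_left_mono)
    finally show "norm (LINT x|\<mu>. h x * cnj (phase_on S h x)) \<le> K * measure \<mu> S" .
  qed
qed

lemma locally_represented_imp_represented:
  assumes A: "finite_exhaustion \<mu> A" and represents: "locally_represented A h"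
    and g: "g \<in> Lp \<mu> 1 \<inter> Lp \<mu> 2"
  shows "l g = L2_inner \<mu> g h"
proof -
  have [measurable]: "h \<in> borel_measurable \<mu>" "A n \<in> sets \<mu>" for n
    using A represents by (auto simp: locally_represented_def finite_exhaustion_def)
  note h_le = locally_represented_AE_norm_le[OF A represents]
  have h_Linf: "(\<lambda>x. cnj (h x)) \<in> Lp \<mu> \<infinity>" using h_le by (intro Lp_cnj Lp_infinityI) auto
  have h_norm: "Lp_norm \<mu> \<infinity> (\<lambda>x. cnj (h x)) \<le> K"
    using h_le K unfolding Lp_norm_cnj by (intro Lp_norm_infinity_le) auto
  note integrable_mult_h = L1_Linfinity_integrable_mult[OF _ h_Linf]
    and Holder = L1_Linfinity_Holder[OF _ h_Linf]
  define b where "b n x = indicator (A n) x * g x" for n x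
  define d where "d n x = (1 - indicator (A n) x) * g x" for n x
  have b: "b n \<in> Lp \<mu> 1 \<inter> Lp \<mu> 2" for n unfolding b_def using g by (auto intro: Lp_indicator)
  have "d n = (\<lambda>x. g x - b n x)" for n by (auto simp: b_def d_def algebra_simps)
  then have d: "d n \<in> Lp \<mu> 1 \<inter> Lp \<mu> 2" for n using g b[of n] by (auto simp: Lp_1_iff L2_diff)
  have g_eq: "g = (\<lambda>x. b n x + d n x)" for n by (simp add: b_def d_def algebra_simps)
  have "norm (l g - L2_inner \<mu> g h) \<le> 2 * K * Lp_norm \<mu> 1 (d n)" for n
  proof -
    have "l g = l (b n) + l (d n)" using l_add[OF b d, of n n] unfolding g_eq[of n, symmetric] .
    moreover have "L2_inner \<mu> g h = L2_inner \<mu> (b n) h + L2_inner \<mu> (d n) h"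
      using integrable_mult_h b d by (subst g_eq[of n]) (simp add: L2_inner_def distrib_right)
    moreover have "l (b n) = L2_inner \<mu> (b n) h"
    proof -
      have "\<forall>x\<in>space \<mu> - A n. b n x = 0" by (simp add: b_def)
      then show ?thesis using represents b unfolding locally_represented_def by blast
    qed
    ultimately have "norm (l g - L2_inner \<mu> g h) \<le> norm (l (d n)) + norm (L2_inner \<mu> (d n) h)"
      using norm_triangle_ineq4[of "l (d n)" "L2_inner \<mu> (d n) h"] by simp
    also have "norm (l (d n)) \<le> K * Lp_norm \<mu> 1 (d n)" by (rule l_bound[OF d])
    also have "norm (L2_inner \<mu> (d n) h) \<le> K * Lp_norm \<mu> 1 (d n)"
      using Holder[of "d n"] d mult_left_mono[OF h_norm Lp_norm_nonneg, of \<mu> 1 "d n"]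
      by (auto simp: L2_inner_def mult.commute)
    finally show ?thesis by simp
  qed
  moreover have "(\<lambda>n. 2 * K * Lp_norm \<mu> 1 (d n)) \<longlonglongrightarrow> 0"
    unfolding d_def using g A by (intro tendsto_mult_right_zero L1_norm_tail_tendsto_0) auto
  ultimately have "(\<lambda>n::nat. l g - L2_inner \<mu> g h) \<longlonglongrightarrow> 0"
    by (rule Lim_null_comparison[OF always_eventually, OF allI])
  then show ?thesis by (simp add: LIMSEQ_const_iff)
qed

theorem L1_dual:
  "\<exists>h\<in>borel_measurable \<mu>. (AE x in \<mu>. norm (h x) \<le> K) \<and> (\<forall>g\<in>Lp \<mu> 1 \<inter> Lp \<mu> 2. l g = L2_inner \<mu> g h)"
proof -
  obtain A h where "finite_exhaustion \<mu> A" "locally_represented A h"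
    by (rule locally_represented_exists)
  then show ?thesis
    using locally_represented_AE_norm_le locally_represented_imp_represented
    unfolding locally_represented_def by blast
qed

end

section \<open>Extension of bounded operators to Lebesgue spaces\<close>

definition weak_image ::
  "'a measure \<Rightarrow> (('a \<Rightarrow> complex) \<Rightarrow> ('a \<Rightarrow> complex)) \<Rightarrow> ('a \<Rightarrow> complex) \<Rightarrow> ('a \<Rightarrow> complex) \<Rightarrow> bool" where
  "weak_image \<mu> T' f h \<longleftrightarrow> h \<in> borel_measurable \<mu> \<and>
     (\<forall>g\<in>Lp \<mu> 1 \<inter> Lp \<mu> \<infinity>. integrable \<mu> (\<lambda>x. h x * cnj (g x)) \<and> integrable \<mu> (\<lambda>x. f x * cnj (T' g x)) \<and>
        L2_inner \<mu> h g = L2_inner \<mu> f (T' g))"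

lemma weak_image_add:
  "weak_image \<mu> T' f h \<Longrightarrow> weak_image \<mu> T' g k \<Longrightarrow> weak_image \<mu> T' (\<lambda>x. f x + g x) (\<lambda>x. h x + k x)"
  by (auto simp: weak_image_def L2_inner_def distrib_right)

lemma weak_image_scale: "weak_image \<mu> T' f h \<Longrightarrow> weak_image \<mu> T' (\<lambda>x. c * f x) (\<lambda>x. c * h x)"
  by (auto simp: weak_image_def L2_inner_scale_left mult.assoc)

lemma weak_image_cong:
  assumes w: "weak_image \<mu> T' f h" and f_eq: "AE x in \<mu>. f x = f' x"
    and f: "f \<in> borel_measurable \<mu>" "f' \<in> borel_measurable \<mu>"
    and T': "\<And>g. g \<in> Lp \<mu> 1 \<inter> Lp \<mu> \<infinity> \<Longrightarrow> T' g \<in> borel_measurable \<mu>"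
  shows "weak_image \<mu> T' f' h"
proof -
  have "integrable \<mu> (\<lambda>x. f' x * cnj (T' g x))" if g: "g \<in> Lp \<mu> 1 \<inter> Lp \<mu> \<infinity>" for g
  proof (rule integrable_cong_AE_imp)
    show "integrable \<mu> (\<lambda>x. f x * cnj (T' g x))" using w g by (simp add: weak_image_def)
    show "AE x in \<mu>. f x * cnj (T' g x) = f' x * cnj (T' g x)" using f_eq by eventually_elim simp
    show "(\<lambda>x. f' x * cnj (T' g x)) \<in> borel_measurable \<mu>" using f T'[OF g] by measurable
  qed
  then show ?thesis using w L2_inner_cong_left[OF f_eq f T'] by (simp add: weak_image_def)
qed

lemma
  fixes v :: "nat \<Rightarrow> 'a \<Rightarrow> complex"
  assumes v: "\<And>n. v n \<in> Lp \<mu> 1" and summable: "summable (\<lambda>n. Lp_norm \<mu> 1 (v n))"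
    and u: "u \<in> borel_measurable \<mu>" and sums: "AE x in \<mu>. (\<lambda>n. v n x) sums u x"
  shows L1_suminf: "u \<in> Lp \<mu> 1"
    and L1_norm_suminf_le: "Lp_norm \<mu> 1 u \<le> (\<Sum>n. Lp_norm \<mu> 1 (v n))"
    and L1_suminf_inner_sums: "g \<in> Lp \<mu> \<infinity> \<Longrightarrow> (\<lambda>n. L2_inner \<mu> (v n) g) sums L2_inner \<mu> u g"
proof -
  have v_int: "integrable \<mu> (v n)" for n using v by (simp add: Lp_1_iff)
  have summable_integral: "summable (\<lambda>n. LINT x|\<mu>. norm (v n x))"
    using summable v by (simp add: Lp_norm_1)
  note series = sums_integral_if_summable_norm[OF v_int summable_integral u sums]
  show u_L1: "u \<in> Lp \<mu> 1" using series(1) by (simp add: Lp_1_iff)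
  show "Lp_norm \<mu> 1 u \<le> (\<Sum>n. Lp_norm \<mu> 1 (v n))" using series(3) v u_L1 by (simp add: Lp_norm_1)
  show "(\<lambda>n. L2_inner \<mu> (v n) g) sums L2_inner \<mu> u g" if g: "g \<in> Lp \<mu> \<infinity>"
    unfolding L2_inner_def
  proof (rule sums_integral_if_summable_norm(2))
    note g' = Lp_cnj[OF g]
    note [measurable] = u Lp_measurable[OF g]
    show integrable_term: "integrable \<mu> (\<lambda>x. v n x * cnj (g x))" for n
      by (rule L1_Linfinity_integrable_mult[OF v g'])
    show "(\<lambda>x. u x * cnj (g x)) \<in> borel_measurable \<mu>" by measurable
    show "AE x in \<mu>. (\<lambda>n. v n x * cnj (g x)) sums (u x * cnj (g x))"
      using sums by eventually_elim (rule sums_mult2)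
    show "summable (\<lambda>n. LINT x|\<mu>. norm (v n x * cnj (g x)))"
      by (rule summable_comparison_test'[OF summable_mult2[OF summable, of "Lp_norm \<mu> \<infinity> g"]])
        (use L1_Linfinity_Holder_norm[OF v g'] in simp)
  qed
qed

lemma L1_level_decomposition:
  assumes f: "f \<in> Lp \<mu> 1"
  obtains v :: "nat \<Rightarrow> 'a \<Rightarrow> complex" where "\<And>n. v n \<in> Lp \<mu> 1 \<inter> Lp \<mu> \<infinity>" "\<And>x. (\<lambda>n. v n x) sums f x"
    "summable (\<lambda>n. Lp_norm \<mu> 1 (v n))" "(\<Sum>n. Lp_norm \<mu> 1 (v n)) \<le> Lp_norm \<mu> 1 f"
proof -
  note [measurable] = Lp_measurable[OF f]
  define v where "v n x = (if nat \<lfloor>norm (f x)\<rfloor> = n then f x else 0)" for n x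
  have [measurable]: "v n \<in> borel_measurable \<mu>" for n unfolding v_def by measurable
  have v_L1: "v n \<in> Lp \<mu> 1" for n by (rule Lp_dominated[OF f]) (auto simp: v_def)
  have "norm (v n x) \<le> real n + 1" for n x
    using real_of_int_floor_add_one_gt[of "norm (f x)"] by (auto simp: v_def)
  then have v_Linf: "v n \<in> Lp \<mu> \<infinity>" for n by (intro Lp_infinityI[where B="real n + 1"]) auto
  have sums: "(\<lambda>n. v n x) sums f x" for x
    unfolding v_def using sums_single[of "nat \<lfloor>norm (f x)\<rfloor>" "\<lambda>_. f x"] by (simp add: eq_commute)
  have partial: "(\<Sum>n<N. Lp_norm \<mu> 1 (v n)) \<le> Lp_norm \<mu> 1 f" for N
  proof -
    have "(\<Sum>n<N. norm (v n x)) \<le> norm (f x)" for x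
    proof -
      have "(\<Sum>n<N. norm (v n x)) = (\<Sum>n<N. if nat \<lfloor>norm (f x)\<rfloor> = n then norm (f x) else 0)"
        by (intro sum.cong) (auto simp: v_def)
      then show ?thesis by simp
    qed
    then have "(LINT x|\<mu>. (\<Sum>n<N. norm (v n x))) \<le> (LINT x|\<mu>. norm (f x))"
      using v_L1 f by (intro integral_mono) (auto simp: Lp_1_iff)
    then show ?thesis using v_L1 f by (simp add: Lp_norm_1 Lp_1_iff)
  qed
  have "summable (\<lambda>n. Lp_norm \<mu> 1 (v n))"
    by (intro summableI_nonneg_bounded[OF _ partial] Lp_norm_nonneg)
  moreover from this have "(\<Sum>n. Lp_norm \<mu> 1 (v n)) \<le> Lp_norm \<mu> 1 f"
    using partial by (rule suminf_le_const)
  ultimately show ?thesis using that v_L1 v_Linf sums by blast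
qed

locale bounded_adjoint_pair = sigma_finite_measure \<mu> for \<mu> :: "'a measure" +
  fixes T T' :: "('a \<Rightarrow> complex) \<Rightarrow> ('a \<Rightarrow> complex)" and M :: real
  assumes M: "M \<ge> 0"
    and T: "linear_op \<mu> (Lp \<mu> 2) (Lp \<mu> 2) T" and T': "linear_op \<mu> (Lp \<mu> 2) (Lp \<mu> 2) T'"
    and adjoint: "f \<in> Lp \<mu> 2 \<Longrightarrow> g \<in> Lp \<mu> 2 \<Longrightarrow> L2_inner \<mu> (T f) g = L2_inner \<mu> f (T' g)"
    and bound_left: "f \<in> Lp \<mu> 2 \<inter> Lp \<mu> 1 \<Longrightarrow> g \<in> Lp \<mu> 2 \<inter> Lp \<mu> \<infinity> \<Longrightarrow>
      norm (L2_inner \<mu> (T f) g) \<le> M * (Lp_norm \<mu> 1 f * Lp_norm \<mu> \<infinity> g)"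
    and bound_right: "f \<in> Lp \<mu> 2 \<inter> Lp \<mu> 1 \<Longrightarrow> g \<in> Lp \<mu> 2 \<inter> Lp \<mu> \<infinity> \<Longrightarrow>
      norm (L2_inner \<mu> (T g) f) \<le> M * (Lp_norm \<mu> 1 f * Lp_norm \<mu> \<infinity> g)"
begin

lemma T_L2: "f \<in> Lp \<mu> 2 \<Longrightarrow> T f \<in> Lp \<mu> 2" and T'_L2: "f \<in> Lp \<mu> 2 \<Longrightarrow> T' f \<in> Lp \<mu> 2"
  using T T' by (auto simp: linear_op_def)

lemma swapped: "bounded_adjoint_pair \<mu> T' T M"
proof unfold_locales
  show adjoint': "L2_inner \<mu> (T' f) g = L2_inner \<mu> f (T g)" if "f \<in> Lp \<mu> 2" "g \<in> Lp \<mu> 2" for f g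
    using adjoint[OF that(2,1)] L2_inner_cnj by metis
  have norm_swap: "norm (L2_inner \<mu> (T' f) g) = norm (L2_inner \<mu> (T g) f)"
    if "f \<in> Lp \<mu> 2" "g \<in> Lp \<mu> 2" for f g
    using adjoint'[OF that] L2_inner_cnj complex_mod_cnj by metis
  fix f g assume fg: "f \<in> Lp \<mu> 2 \<inter> Lp \<mu> 1" "g \<in> Lp \<mu> 2 \<inter> Lp \<mu> \<infinity>"
  show "norm (L2_inner \<mu> (T' f) g) \<le> M * (Lp_norm \<mu> 1 f * Lp_norm \<mu> \<infinity> g)"
    "norm (L2_inner \<mu> (T' g) f) \<le> M * (Lp_norm \<mu> 1 f * Lp_norm \<mu> \<infinity> g)"
    using bound_left[OF fg] bound_right[OF fg] fg by (auto simp: norm_swap)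
qed (rule M T T')+

lemma
  assumes f: "f \<in> Lp \<mu> 2 \<inter> Lp \<mu> 1"
  shows T_L1: "T f \<in> Lp \<mu> 1" and T_L1_norm_le: "Lp_norm \<mu> 1 (T f) \<le> M * Lp_norm \<mu> 1 f"
proof -
  have Tf: "T f \<in> Lp \<mu> 2" using f by (simp add: T_L2)
  have "integrable \<mu> (\<lambda>x. T f x * cnj (g x))"
    "norm (L2_inner \<mu> (T f) g) \<le> (M * Lp_norm \<mu> 1 f) * Lp_norm \<mu> \<infinity> g"
    if "g \<in> Lp \<mu> 1 \<inter> Lp \<mu> \<infinity>" for g
    using that L2_inner_integrable[OF Tf] bound_left[OF f, of g]
    by (auto simp: L1_Linfinity_imp_L2 mult.assoc)
  from L1_if_pairings[OF L2_measurable[OF Tf] this] M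
  show "T f \<in> Lp \<mu> 1" "Lp_norm \<mu> 1 (T f) \<le> M * Lp_norm \<mu> 1 f" by (simp_all add: Lp_norm_nonneg)
qed

lemma T_Linfinity:
  assumes f: "f \<in> Lp \<mu> 2 \<inter> Lp \<mu> \<infinity>" shows "AE x in \<mu>. norm (T f x) \<le> M * Lp_norm \<mu> \<infinity> f"
proof (rule AE_norm_le_if_pairings)
  have Tf: "T f \<in> Lp \<mu> 2" using f by (simp add: T_L2)
  then show "T f \<in> borel_measurable \<mu>" by (rule L2_measurable)
  fix g assume "g \<in> Lp \<mu> 1 \<inter> Lp \<mu> \<infinity>"
  then have g: "g \<in> Lp \<mu> 2 \<inter> Lp \<mu> 1" by (simp add: L1_Linfinity_imp_L2)
  then show "integrable \<mu> (\<lambda>x. T f x * cnj (g x))" using L2_inner_integrable[OF Tf] by simp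
  show "norm (L2_inner \<mu> (T f) g) \<le> M * Lp_norm \<mu> \<infinity> f * Lp_norm \<mu> 1 g"
    using bound_right[OF g f] by (simp add: mult_ac)
qed (use M in \<open>simp add: Lp_norm_nonneg\<close>)

lemma T'_Linfinity: "g \<in> Lp \<mu> 2 \<inter> Lp \<mu> \<infinity> \<Longrightarrow> T' g \<in> Lp \<mu> \<infinity>"
  using bounded_adjoint_pair.T_Linfinity[OF swapped]
  by (intro Lp_infinityI[OF L2_measurable[OF T'_L2]]) auto

lemma weak_image_L2: assumes f: "f \<in> Lp \<mu> 2" shows "weak_image \<mu> T' f (T f)"
  using f adjoint L2_measurable[OF T_L2] L2_inner_integrable[OF T_L2]
    L2_inner_integrable[OF _ T'_L2]
  by (simp add: weak_image_def L1_Linfinity_imp_L2)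

lemma weak_image_unique:
  assumes "weak_image \<mu> T' f h" "weak_image \<mu> T' f k" shows "AE x in \<mu>. h x = k x"
proof -
  have "AE x in \<mu>. norm (h x - k x) \<le> 0"
  proof (rule AE_norm_le_if_pairings)
    show "(\<lambda>x. h x - k x) \<in> borel_measurable \<mu>" using assms by (auto simp: weak_image_def)
    fix g assume "g \<in> Lp \<mu> 1 \<inter> Lp \<mu> \<infinity>"
    then show "integrable \<mu> (\<lambda>x. (h x - k x) * cnj (g x))"
      "norm (L2_inner \<mu> (\<lambda>x. h x - k x) g) \<le> 0 * Lp_norm \<mu> 1 g"
      using assms by (auto simp: weak_image_def L2_inner_def left_diff_distrib)
  qed simp
  then show ?thesis by eventually_elim simp
qed

lemma
  assumes v: "\<And>n::nat. v n \<in> Lp \<mu> 2 \<inter> Lp \<mu> 1" and summable: "summable (\<lambda>n. Lp_norm \<mu> 1 (v n))"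
  shows summable_L1_norm_T: "summable (\<lambda>n. Lp_norm \<mu> 1 (T (v n)))"
    and suminf_L1_norm_T_le: "(\<Sum>n. Lp_norm \<mu> 1 (T (v n))) \<le> M * (\<Sum>n. Lp_norm \<mu> 1 (v n))"
proof -
  have summable_M: "summable (\<lambda>n. M * Lp_norm \<mu> 1 (v n))" using summable by (rule summable_mult)
  show summable_T: "summable (\<lambda>n. Lp_norm \<mu> 1 (T (v n)))"
    by (rule summable_comparison_test'[OF summable_M]) (simp add: T_L1_norm_le[OF v] Lp_norm_nonneg)
  have "(\<Sum>n. Lp_norm \<mu> 1 (T (v n))) \<le> (\<Sum>n. M * Lp_norm \<mu> 1 (v n))"
    by (intro suminf_le T_L1_norm_le v summable_T summable_M)
  then show "(\<Sum>n. Lp_norm \<mu> 1 (T (v n))) \<le> M * (\<Sum>n. Lp_norm \<mu> 1 (v n))"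
    by (simp add: suminf_mult summable)
qed

lemma weak_image_L1:
  assumes f: "f \<in> Lp \<mu> 1"
  obtains h where "weak_image \<mu> T' f h" "h \<in> Lp \<mu> 1" "Lp_norm \<mu> 1 h \<le> M * Lp_norm \<mu> 1 f"
proof -
  obtain v :: "nat \<Rightarrow> 'a \<Rightarrow> complex" where v: "\<And>n. v n \<in> Lp \<mu> 1 \<inter> Lp \<mu> \<infinity>"
    and v_sums: "\<And>x. (\<lambda>n. v n x) sums f x"
    and v_summable: "summable (\<lambda>n. Lp_norm \<mu> 1 (v n))"
    and v_le: "(\<Sum>n. Lp_norm \<mu> 1 (v n)) \<le> Lp_norm \<mu> 1 f"
    by (rule L1_level_decomposition[OF f]) blast
  have v_L2_L1: "v n \<in> Lp \<mu> 2 \<inter> Lp \<mu> 1" for n using v[of n] by (simp add: L1_Linfinity_imp_L2)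
  note Tv = T_L1[OF v_L2_L1] and Tv_summable = summable_L1_norm_T[OF v_L2_L1 v_summable]
  define h where "h x = (\<Sum>n. T (v n) x)" for x
  have h: "h \<in> borel_measurable \<mu>" unfolding h_def using Lp_measurable[OF Tv] by measurable
  have h_sums: "AE x in \<mu>. (\<lambda>n. T (v n) x) sums h x"
    using AE_summable_if_summable_integral_norm[of \<mu> "\<lambda>n. T (v n)"] Tv Tv_summable
    by (auto simp: h_def Lp_1_iff Lp_norm_1[OF Tv] elim!: eventually_mono intro: summable_sums
        summable_norm_cancel)
  note series_h = Tv Tv_summable h h_sums
  have "weak_image \<mu> T' f h"
    unfolding weak_image_def
  proof (intro conjI ballI h)
    fix g assume g: "g \<in> Lp \<mu> 1 \<inter> Lp \<mu> \<infinity>"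
    then have g_L2: "g \<in> Lp \<mu> 2" by (simp add: L1_Linfinity_imp_L2)
    have T'g: "T' g \<in> Lp \<mu> \<infinity>" using g g_L2 by (intro T'_Linfinity) simp
    show "integrable \<mu> (\<lambda>x. h x * cnj (g x))"
      using L1_suminf[OF series_h] g by (intro L1_Linfinity_integrable_mult Lp_cnj) auto
    show "integrable \<mu> (\<lambda>x. f x * cnj (T' g x))"
      using f T'g by (intro L1_Linfinity_integrable_mult Lp_cnj)
    have "(\<lambda>n. L2_inner \<mu> (T (v n)) g) sums L2_inner \<mu> h g"
      using g by (intro L1_suminf_inner_sums[OF series_h]) simp
    moreover have "(\<lambda>n. L2_inner \<mu> (v n) (T' g)) sums L2_inner \<mu> f (T' g)"
      using v v_summable v_sums f T'g by (intro L1_suminf_inner_sums) (auto simp: Lp_measurable)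
    moreover have "L2_inner \<mu> (T (v n)) g = L2_inner \<mu> (v n) (T' g)" for n
      using v_L2_L1 g_L2 by (simp add: adjoint)
    ultimately show "L2_inner \<mu> h g = L2_inner \<mu> f (T' g)" by (simp add: sums_unique2)
  qed
  moreover have "Lp_norm \<mu> 1 h \<le> M * Lp_norm \<mu> 1 f"
  proof -
    have "Lp_norm \<mu> 1 h \<le> (\<Sum>n. Lp_norm \<mu> 1 (T (v n)))" by (rule L1_norm_suminf_le[OF series_h])
    also have "\<dots> \<le> M * (\<Sum>n. Lp_norm \<mu> 1 (v n))" by (rule suminf_L1_norm_T_le[OF v_L2_L1 v_summable])
    also have "\<dots> \<le> M * Lp_norm \<mu> 1 f" using v_le M by (rule mult_left_mono)
    finally show ?thesis .
  qed
  ultimately show ?thesis using that L1_suminf[OF series_h] by blast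
qed

lemma T'_L1: "g \<in> Lp \<mu> 1 \<inter> Lp \<mu> 2 \<Longrightarrow> T' g \<in> Lp \<mu> 1"
  by (rule bounded_adjoint_pair.T_L1[OF swapped]) simp

lemma T'_L1_norm_le: "g \<in> Lp \<mu> 1 \<inter> Lp \<mu> 2 \<Longrightarrow> Lp_norm \<mu> 1 (T' g) \<le> M * Lp_norm \<mu> 1 g"
  by (rule bounded_adjoint_pair.T_L1_norm_le[OF swapped]) simp

lemma L1_functional_inner_T':
  assumes f: "f \<in> Lp \<mu> \<infinity>"
  shows "L1_functional \<mu> (\<lambda>g. L2_inner \<mu> (T' g) f) (M * Lp_norm \<mu> \<infinity> f)"
proof -
  have cnj_f: "(\<lambda>x. cnj (f x)) \<in> Lp \<mu> \<infinity>" using f by (rule Lp_cnj)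
  note [measurable] = Lp_measurable[OF f]
  note integrable_pairing = L1_Linfinity_integrable_mult[OF T'_L1 cnj_f]
  show ?thesis
  proof
    fix g k assume gk: "g \<in> Lp \<mu> 1 \<inter> Lp \<mu> 2" "k \<in> Lp \<mu> 1 \<inter> Lp \<mu> 2"
    then have "L2_inner \<mu> (T' (\<lambda>x. g x + k x)) f = L2_inner \<mu> (\<lambda>x. T' g x + T' k x) f"
      by (intro L2_inner_cong_left linear_op_add[OF T']) (auto intro!: L2_measurable T'_L2 L2_add)
    then show "L2_inner \<mu> (T' (\<lambda>x. g x + k x)) f = L2_inner \<mu> (T' g) f + L2_inner \<mu> (T' k) f"
      using integrable_pairing[OF gk(1)] integrable_pairing[OF gk(2)]
      by (simp add: L2_inner_def distrib_right)
  next
    fix g c assume g: "g \<in> Lp \<mu> 1 \<inter> Lp \<mu> 2"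
    then have "L2_inner \<mu> (T' (\<lambda>x. c * g x)) f = L2_inner \<mu> (\<lambda>x. c * T' g x) f"
      using T'
      by (intro L2_inner_cong_left) (auto simp: linear_op_def intro!: L2_measurable T'_L2 L2_scale)
    then show "L2_inner \<mu> (T' (\<lambda>x. c * g x)) f = c * L2_inner \<mu> (T' g) f"
      by (simp add: L2_inner_scale_left)
  next
    fix g assume g: "g \<in> Lp \<mu> 1 \<inter> Lp \<mu> 2"
    have "norm (L2_inner \<mu> (T' g) f) \<le> Lp_norm \<mu> 1 (T' g) * Lp_norm \<mu> \<infinity> f"
      using L1_Linfinity_Holder[OF T'_L1[OF g] cnj_f] by (simp add: L2_inner_def)
    also have "\<dots> \<le> (M * Lp_norm \<mu> 1 g) * Lp_norm \<mu> \<infinity> f"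
      using g by (intro mult_right_mono T'_L1_norm_le Lp_norm_nonneg)
    finally show "norm (L2_inner \<mu> (T' g) f) \<le> M * Lp_norm \<mu> \<infinity> f * Lp_norm \<mu> 1 g"
      by (simp add: mult_ac)
  qed (use M in \<open>simp add: Lp_norm_nonneg\<close>)
qed

lemma weak_image_Linfinity:
  assumes f: "f \<in> Lp \<mu> \<infinity>"
  obtains h where "weak_image \<mu> T' f h" "AE x in \<mu>. norm (h x) \<le> M * Lp_norm \<mu> \<infinity> f"
proof -
  obtain h where h[measurable]: "h \<in> borel_measurable \<mu>"
    and h_le: "AE x in \<mu>. norm (h x) \<le> M * Lp_norm \<mu> \<infinity> f"
    and represents_h: "\<And>g. g \<in> Lp \<mu> 1 \<inter> Lp \<mu> 2 \<Longrightarrow> L2_inner \<mu> (T' g) f = L2_inner \<mu> g h"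
    using L1_functional.L1_dual[OF L1_functional_inner_T'[OF f]] by blast
  have "weak_image \<mu> T' f h"
    unfolding weak_image_def
  proof (intro conjI ballI h)
    fix g assume "g \<in> Lp \<mu> 1 \<inter> Lp \<mu> \<infinity>"
    then have g: "g \<in> Lp \<mu> 1 \<inter> Lp \<mu> 2" by (simp add: L1_Linfinity_imp_L2)
    have "integrable \<mu> (\<lambda>x. cnj (g x) * h x)"
      using g h_le by (intro L1_Linfinity_integrable_mult Lp_cnj Lp_infinityI) auto
    then show "integrable \<mu> (\<lambda>x. h x * cnj (g x))" by (simp add: mult.commute)
    show "integrable \<mu> (\<lambda>x. f x * cnj (T' g x))"
      using integrable_cnj[OF L1_Linfinity_integrable_mult[OF T'_L1[OF g] Lp_cnj[OF f]]]
      by (simp add: mult.commute)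
    show "L2_inner \<mu> h g = L2_inner \<mu> f (T' g)" using represents_h[OF g] L2_inner_cnj by metis
  qed
  with h_le that show ?thesis by blast
qed

end

section \<open>Interpolation by truncation\<close>

definition soft_threshold :: "real \<Rightarrow> complex \<Rightarrow> complex" where
  "soft_threshold s z = complex_of_real (max 0 (norm z - s)) * sgn z"

lemma norm_soft_threshold: "0 \<le> s \<Longrightarrow> norm (soft_threshold s z) = max 0 (norm z - s)"
  by (auto simp: soft_threshold_def norm_mult norm_sgn)

lemma norm_diff_soft_threshold_le: "0 \<le> s \<Longrightarrow> norm (z - soft_threshold s z) \<le> s"
proof (cases "z = 0")
  case False
  assume s: "0 \<le> s"
  have "z = complex_of_real (norm z) * sgn z"
    using False by (simp add: sgn_div_norm scaleR_conv_of_real)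
  then have "z - soft_threshold s z = complex_of_real (norm z - max 0 (norm z - s)) * sgn z"
    unfolding soft_threshold_def by (metis left_diff_distrib of_real_diff)
  then have "norm (z - soft_threshold s z) = \<bar>norm z - max 0 (norm z - s)\<bar>"
    using False by (simp only: norm_mult norm_of_real) (simp add: norm_sgn)
  then show ?thesis using s by simp
qed (simp add: soft_threshold_def)

lemma soft_threshold_measurable [measurable]: "soft_threshold s \<in> borel_measurable borel"
  unfolding soft_threshold_def[abs_def] by measurable

lemma enn2real_ge_1: "1 \<le> p \<Longrightarrow> p \<noteq> \<infinity> \<Longrightarrow> 1 \<le> enn2real p"
  using enn2real_mono[of 1 p] by (simp add: less_top)

lemma Lp_soft_threshold_L1:
  assumes p: "1 \<le> p" "p \<noteq> \<infinity>" and f: "f \<in> Lp \<mu> p" and s: "0 < s"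
  shows "(\<lambda>x. soft_threshold s (f x)) \<in> Lp \<mu> 1"
proof -
  note [measurable] = Lp_measurable[OF f]
  let ?q = "enn2real p"
  have q: "?q \<ge> 1" using p by (rule enn2real_ge_1)
  have "norm (soft_threshold s z) \<le> s powr (1 - ?q) * norm z powr ?q" for z
  proof (cases "norm z > s")
    case True
    have "norm (soft_threshold s z) \<le> norm z powr (1 - ?q) * norm z powr ?q"
      using True s by (simp add: norm_soft_threshold flip: powr_add)
    also have "\<dots> \<le> s powr (1 - ?q) * norm z powr ?q"
      using True s q by (intro mult_right_mono powr_mono2') auto
    finally show ?thesis .
  qed (use s in \<open>simp add: norm_soft_threshold\<close>)
  then have "(\<integral>\<^sup>+x. ennreal (norm (soft_threshold s (f x))) \<partial>\<mu>) \<le>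
      (\<integral>\<^sup>+x. ennreal (s powr (1 - ?q)) * ennreal (norm (f x) powr ?q) \<partial>\<mu>)"
    by (intro nn_integral_mono) (simp add: ennreal_mult[symmetric] ennreal_leI)
  also have "\<dots> < \<infinity>" using f p(2) by (simp add: Lp_def nn_integral_cmult ennreal_mult_less_top)
  finally show ?thesis by (simp add: Lp_1_iff integrable_iff_bounded)
qed

lemma
  assumes f: "f \<in> borel_measurable \<mu>" and s: "0 \<le> s"
  shows Linfinity_diff_soft_threshold: "(\<lambda>x. f x - soft_threshold s (f x)) \<in> Lp \<mu> \<infinity>"
    and Linfinity_norm_diff_soft_threshold_le: "Lp_norm \<mu> \<infinity> (\<lambda>x. f x - soft_threshold s (f x)) \<le> s"
proof -
  have measurable_diff: "(\<lambda>x. f x - soft_threshold s (f x)) \<in> borel_measurable \<mu>"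
    using f by measurable
  have norm_le: "AE x in \<mu>. norm (f x - soft_threshold s (f x)) \<le> s"
    by (intro AE_I2 norm_diff_soft_threshold_le s)
  show "(\<lambda>x. f x - soft_threshold s (f x)) \<in> Lp \<mu> \<infinity>"
    using measurable_diff norm_le by (rule Lp_infinityI)
  show "Lp_norm \<mu> \<infinity> (\<lambda>x. f x - soft_threshold s (f x)) \<le> s"
    using measurable_diff s norm_le by (rule Lp_norm_infinity_le)
qed

lemma nn_integral_truncation_weight:
  fixes q y :: real
  assumes q: "q > 1" and y: "y \<ge> 0"
  shows "(\<integral>\<^sup>+s. ennreal (indicator {0<..} s * s powr (q - 2)) * ennreal (max 0 (y - s)) \<partial>lborel) =
    ennreal (1 / (q * (q - 1))) * ennreal (y powr q)"
proof -
  have integrand: "ennreal (indicator {0<..} s * s powr (q - 2)) * ennreal (max 0 (y - s)) =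
      ennreal (y * s powr (q - 2) - s powr (q - 1)) * indicator {0..y} s" for s
  proof (cases "0 < s")
    case True
    then have "s powr (q - 1) = s * s powr (q - 2)" by (simp add: powr_mult_base)
    then show ?thesis using True
      by (auto simp: indicator_def max_def ennreal_mult[symmetric] left_diff_distrib mult.commute)
  qed (auto simp: indicator_def)
  have antiderivative: "((\<lambda>s. y * s powr (q - 2) - s powr (q - 1)) has_integral
      (y * (y powr (q - 2 + 1) / (q - 2 + 1)) - y powr (q - 1 + 1) / (q - 1 + 1))) {0..y}"
    using q y by (intro has_integral_diff has_integral_mult_right has_integral_powr_from_0) auto
  have integral_eq:
    "y * (y powr (q - 2 + 1) / (q - 2 + 1)) - y powr (q - 1 + 1) / (q - 1 + 1) =
        1 / (q * (q - 1)) * y powr q"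
  proof -
    have "y * y powr (q - 1) = y powr q" using y by (simp add: powr_mult_base)
    then show ?thesis using q by (simp add: field_simps)
  qed
  have nonneg: "0 \<le> y * s powr (q - 2) - s powr (q - 1)" if "s \<in> {0..y}" for s
  proof -
    have "s powr (q - 1) = s * s powr (q - 2)" using that by (simp add: powr_mult_base)
    then show ?thesis using that by (simp add: mult_right_mono)
  qed
  show ?thesis
    unfolding integrand
    using nn_integral_has_integral_lebesgue'[OF nonneg antiderivative[unfolded integral_eq]] q
    by (simp only: ennreal_mult powr_ge_zero zero_le_divide_1_iff mult_nonneg_nonneg)
qed

context sigma_finite_measure begin

lemma nn_integral_powr_layer_cake:
  assumes k[measurable]: "k \<in> borel_measurable M" and k_nonneg: "\<And>x. k x \<ge> (0::real)" and q: "q > 1"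
  shows "(\<integral>\<^sup>+s. ennreal (indicator {0<..} s * s powr (q - 2)) *
      (\<integral>\<^sup>+x. ennreal (max 0 (k x - s)) \<partial>M) \<partial>lborel) =
    ennreal (1 / (q * (q - 1))) * (\<integral>\<^sup>+x. ennreal (k x powr q) \<partial>M)"
proof -
  interpret P: pair_sigma_finite M lborel ..
  have "(\<integral>\<^sup>+s. ennreal (indicator {0<..} s * s powr (q - 2)) *
      (\<integral>\<^sup>+x. ennreal (max 0 (k x - s)) \<partial>M) \<partial>lborel) =
      (\<integral>\<^sup>+s. \<integral>\<^sup>+x. ennreal (indicator {0<..} s * s powr (q - 2)) * ennreal (max 0 (k x - s)) \<partial>M \<partial>lborel)"
    by (intro nn_integral_cong nn_integral_cmult[symmetric]) measurable
  also have "\<dots> =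
      (\<integral>\<^sup>+x. \<integral>\<^sup>+s. ennreal (indicator {0<..} s * s powr (q - 2)) *
          ennreal (max 0 (k x - s)) \<partial>lborel \<partial>M)"
    by (rule P.Fubini') measurable
  also have "\<dots> = (\<integral>\<^sup>+x. ennreal (1 / (q * (q - 1))) * ennreal (k x powr q) \<partial>M)"
    by (intro nn_integral_cong nn_integral_truncation_weight q k_nonneg)
  also have "\<dots> = ennreal (1 / (q * (q - 1))) * (\<integral>\<^sup>+x. ennreal (k x powr q) \<partial>M)"
    by (rule nn_integral_cmult) measurable
  finally show ?thesis .
qed

lemma nn_integral_powr_le_if_truncations_le:
  assumes k: "k \<in> borel_measurable M" "\<And>x. k x \<ge> (0::real)"
    and j: "j \<in> borel_measurable M" "\<And>x. j x \<ge> (0::real)"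
    and q: "q > 1"
    and truncations_le:
      "\<And>s. s > 0 \<Longrightarrow> (\<integral>\<^sup>+x. ennreal (max 0 (k x - s)) \<partial>M) \<le> (\<integral>\<^sup>+x. ennreal (max 0 (j x - s)) \<partial>M)"
  shows "(\<integral>\<^sup>+x. ennreal (k x powr q) \<partial>M) \<le> (\<integral>\<^sup>+x. ennreal (j x powr q) \<partial>M)"
proof (rule ennreal_mult_le_mult_iff[THEN iffD1])
  show "ennreal (1 / (q * (q - 1))) * (\<integral>\<^sup>+x. ennreal (k x powr q) \<partial>M) \<le>
      ennreal (1 / (q * (q - 1))) * (\<integral>\<^sup>+x. ennreal (j x powr q) \<partial>M)"
    unfolding nn_integral_powr_layer_cake[OF k q, symmetric]
      nn_integral_powr_layer_cake[OF j q, symmetric]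
  proof (rule nn_integral_mono)
    fix s :: real
    show "ennreal (indicator {0<..} s * s powr (q - 2)) * (\<integral>\<^sup>+x. ennreal (max 0 (k x - s)) \<partial>M)
      \<le> ennreal (indicator {0<..} s * s powr (q - 2)) * (\<integral>\<^sup>+x. ennreal (max 0 (j x - s)) \<partial>M)"
      using truncations_le[of s] by (cases "s > 0") (auto intro: mult_left_mono)
  qed
qed (use q in auto)

end

context bounded_adjoint_pair begin

lemma weak_image_exists:
  assumes p: "1 \<le> p" and f: "f \<in> Lp \<mu> p" shows "\<exists>h. weak_image \<mu> T' f h"
proof (cases "p = \<infinity>")
  case True
  then show ?thesis using f weak_image_Linfinity by blast
next
  case False
  obtain h where h: "weak_image \<mu> T' (\<lambda>x. soft_threshold 1 (f x)) h"
    by (rule weak_image_L1[OF Lp_soft_threshold_L1[OF p False f zero_less_one]])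
  obtain k where k: "weak_image \<mu> T' (\<lambda>x. f x - soft_threshold 1 (f x)) k"
    by (rule weak_image_Linfinity[OF Linfinity_diff_soft_threshold[OF Lp_measurable[OF f] zero_le_one]])
  from weak_image_add[OF h k] show ?thesis by auto
qed

lemma weak_image_truncation_le:
  assumes p: "1 \<le> p" "p \<noteq> \<infinity>" and f: "f \<in> Lp \<mu> p" and g: "weak_image \<mu> T' f g" and s: "s > 0"
  shows "(\<integral>\<^sup>+x. ennreal (max 0 (norm (g x) - M * s)) \<partial>\<mu>) \<le>
      ennreal M * (\<integral>\<^sup>+x. ennreal (max 0 (norm (f x) - s)) \<partial>\<mu>)"
proof -
  let ?t = "\<lambda>x. soft_threshold s (f x)" and ?r = "\<lambda>x. f x - soft_threshold s (f x)"
  have t_L1: "?t \<in> Lp \<mu> 1" by (rule Lp_soft_threshold_L1[OF p f s])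
  have r_Linf: "?r \<in> Lp \<mu> \<infinity>"
    using s by (intro Linfinity_diff_soft_threshold Lp_measurable[OF f]) simp
  obtain h where h: "weak_image \<mu> T' ?t h" "h \<in> Lp \<mu> 1" "Lp_norm \<mu> 1 h \<le> M * Lp_norm \<mu> 1 ?t"
    by (rule weak_image_L1[OF t_L1])
  obtain k where k: "weak_image \<mu> T' ?r k" and k_le: "AE x in \<mu>. norm (k x) \<le> M * Lp_norm \<mu> \<infinity> ?r"
    by (rule weak_image_Linfinity[OF r_Linf])
  have r_le: "M * Lp_norm \<mu> \<infinity> ?r \<le> M * s"
    using s M Linfinity_norm_diff_soft_threshold_le[OF Lp_measurable[OF f], of s]
    by (simp add: mult_left_mono)
  have "weak_image \<mu> T' f (\<lambda>x. h x + k x)" using weak_image_add[OF h(1) k] by simp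
  then have g_eq: "AE x in \<mu>. g x = h x + k x" by (rule weak_image_unique[OF g])
  have "(\<integral>\<^sup>+x. ennreal (max 0 (norm (g x) - M * s)) \<partial>\<mu>) \<le> (\<integral>\<^sup>+x. ennreal (norm (h x)) \<partial>\<mu>)"
  proof (rule nn_integral_mono_AE, use g_eq k_le in eventually_elim)
    case (elim x)
    then show ?case using norm_triangle_ineq[of "h x" "k x"] r_le by (intro ennreal_leI) auto
  qed
  also have "\<dots> = ennreal (Lp_norm \<mu> 1 h)"
    using h(2) by (simp add: Lp_norm_1 Lp_1_iff nn_integral_eq_integral)
  also have "\<dots> \<le> ennreal (M * Lp_norm \<mu> 1 ?t)" using h(3) by (rule ennreal_leI)
  also have "\<dots> = ennreal M * (\<integral>\<^sup>+x. ennreal (norm (?t x)) \<partial>\<mu>)"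
    using t_L1 M by (simp add: Lp_norm_1 Lp_1_iff nn_integral_eq_integral ennreal_mult)
  finally show ?thesis using s by (simp add: norm_soft_threshold)
qed

lemma weak_image_nn_integral_powr_le:
  assumes p: "1 < p" "p \<noteq> \<infinity>" and f: "f \<in> Lp \<mu> p" and g: "weak_image \<mu> T' f g" and M_pos: "M > 0"
  shows "(\<integral>\<^sup>+x. ennreal (norm (g x) powr enn2real p) \<partial>\<mu>) \<le>
    ennreal (M powr enn2real p) * (\<integral>\<^sup>+x. ennreal (norm (f x) powr enn2real p) \<partial>\<mu>)"
proof -
  let ?q = "enn2real p"
  have p_ge_1: "1 \<le> p" using p by simp
  have q: "?q > 1" using p by (cases p) auto
  note [measurable] = Lp_measurable[OF f]
  have [measurable]: "g \<in> borel_measurable \<mu>" using g by (simp add: weak_image_def)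
  have "(\<integral>\<^sup>+x. ennreal ((norm (g x) / M) powr ?q) \<partial>\<mu>) \<le> (\<integral>\<^sup>+x. ennreal (norm (f x) powr ?q) \<partial>\<mu>)"
  proof (rule nn_integral_powr_le_if_truncations_le[OF _ _ _ _ q])
    fix s :: real assume s: "s > 0"
    have scaled: "max 0 (norm (g x) / M - s) = (1 / M) * max 0 (norm (g x) - M * s)" for x
      using M_pos by (simp add: max_def field_simps)
    have "(\<integral>\<^sup>+x. ennreal (max 0 (norm (g x) / M - s)) \<partial>\<mu>) =
        (\<integral>\<^sup>+x. ennreal (1 / M) * ennreal (max 0 (norm (g x) - M * s)) \<partial>\<mu>)"
      unfolding scaled using M_pos by (intro nn_integral_cong ennreal_mult) auto
    also have "\<dots> = ennreal (1 / M) * (\<integral>\<^sup>+x. ennreal (max 0 (norm (g x) - M * s)) \<partial>\<mu>)"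
      by (rule nn_integral_cmult) measurable
    also have "\<dots> \<le> ennreal (1 / M) * (ennreal M * (\<integral>\<^sup>+x. ennreal (max 0 (norm (f x) - s)) \<partial>\<mu>))"
      by (intro mult_left_mono weak_image_truncation_le[OF p_ge_1 p(2) f g s]) simp
    also have "\<dots> = (\<integral>\<^sup>+x. ennreal (max 0 (norm (f x) - s)) \<partial>\<mu>)"
      using M_pos by (simp add: mult.assoc[symmetric] ennreal_mult[symmetric])
    finally show "(\<integral>\<^sup>+x. ennreal (max 0 (norm (g x) / M - s)) \<partial>\<mu>) \<le>
        (\<integral>\<^sup>+x. ennreal (max 0 (norm (f x) - s)) \<partial>\<mu>)" .
  qed (use M in auto)
  then have "ennreal (M powr ?q) * (\<integral>\<^sup>+x. ennreal ((norm (g x) / M) powr ?q) \<partial>\<mu>) \<le>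
      ennreal (M powr ?q) * (\<integral>\<^sup>+x. ennreal (norm (f x) powr ?q) \<partial>\<mu>)" by (rule mult_left_mono) simp
  also have "ennreal (M powr ?q) * (\<integral>\<^sup>+x. ennreal ((norm (g x) / M) powr ?q) \<partial>\<mu>) =
      (\<integral>\<^sup>+x. ennreal (norm (g x) powr ?q) \<partial>\<mu>)"
    using M_pos by (simp add: ennreal_mult[symmetric] powr_divide flip: nn_integral_cmult)
  finally show ?thesis .
qed

lemma weak_image_Lp_bound:
  assumes p: "1 \<le> p" and f: "f \<in> Lp \<mu> p" and g: "weak_image \<mu> T' f g" and M_pos: "M > 0"
  shows "g \<in> Lp \<mu> p \<and> Lp_norm \<mu> p g \<le> M * Lp_norm \<mu> p f"
proof -
  have g_measurable[measurable]: "g \<in> borel_measurable \<mu>" using g by (simp add: weak_image_def)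
  consider (infinite) "p = \<infinity>" | (one) "p = 1" | (between) "1 < p" "p \<noteq> \<infinity>" using p by fastforce
  then show ?thesis
  proof cases
    case infinite
    obtain h where h: "weak_image \<mu> T' f h" "AE x in \<mu>. norm (h x) \<le> M * Lp_norm \<mu> \<infinity> f"
      using f unfolding infinite by (rule weak_image_Linfinity)
    have g_le: "AE x in \<mu>. norm (g x) \<le> M * Lp_norm \<mu> \<infinity> f"
      using weak_image_unique[OF g h(1)] h(2) by eventually_elim simp
    show ?thesis unfolding infinite
      using Lp_infinityI[OF g_measurable g_le]
        Lp_norm_infinity_le[OF g_measurable mult_nonneg_nonneg[OF M Lp_norm_nonneg] g_le] by simp
  next
    case one
    obtain h where h: "weak_image \<mu> T' f h" "h \<in> Lp \<mu> 1" "Lp_norm \<mu> 1 h \<le> M * Lp_norm \<mu> 1 f"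
      using f unfolding one by (rule weak_image_L1)
    then show ?thesis
      unfolding one
      using weak_image_unique[OF h(1) g] Lp_cong_AE[of h \<mu> 1 g] Lp_norm_cong_AE[of h \<mu> g 1]
        Lp_measurable[of h] by auto
  next
    case between
    let ?q = "enn2real p"
    let ?F = "\<integral>\<^sup>+x. ennreal (norm (f x) powr ?q) \<partial>\<mu>" and ?G = "\<integral>\<^sup>+x. ennreal (norm (g x) powr ?q) \<partial>\<mu>"
    have q: "?q > 0" using between by (cases p) auto
    have F: "?F < \<infinity>" using f between by (simp add: Lp_def)
    have nn_integral_le: "?G \<le> ennreal (M powr ?q) * ?F"
      by (rule weak_image_nn_integral_powr_le[OF between f g M_pos])
    have finite_rhs: "ennreal (M powr ?q) * ?F < \<infinity>" using F by (simp add: ennreal_mult_less_top)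
    have G: "?G < \<infinity>" using nn_integral_le finite_rhs by (rule le_less_trans)
    have "enn2real ?G \<le> M powr ?q * enn2real ?F"
      using enn2real_mono[OF nn_integral_le] finite_rhs by (simp add: enn2real_mult)
    then have "enn2real ?G powr (1 / ?q) \<le> (M powr ?q * enn2real ?F) powr (1 / ?q)"
      using q by (intro powr_mono2) auto
    also have "\<dots> = M * enn2real ?F powr (1 / ?q)" using q M_pos by (simp add: powr_mult powr_powr)
    finally show ?thesis using G between by (simp add: Lp_def Lp_norm_def)
  qed
qed

lemma op_norm_le_if_pos:
  assumes p: "1 \<le> p" and M_pos: "M > 0" and U: "\<And>f. f \<in> Lp \<mu> 2 \<Longrightarrow> AE x in \<mu>. U f x = T f x"
  shows "op_norm \<mu> p p U \<le> ennreal M"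
proof -
  define S where "S f = (SOME h. weak_image \<mu> T' f h)" for f
  have S_weak_image: "weak_image \<mu> T' f (S f)" if "f \<in> Lp \<mu> p" for f
    unfolding S_def using weak_image_exists[OF p that] by (rule someI_ex)
  have S_eq: "AE x in \<mu>. S f x = h x" if h: "weak_image \<mu> T' f h" for f h
    using weak_image_unique[OF someI[of "weak_image \<mu> T' f", OF h] h] by (simp add: S_def)
  have "linear_op \<mu> (Lp \<mu> p) (Lp \<mu> p) S"
    unfolding linear_op_def
  proof (intro conjI ballI impI allI)
    fix f g assume fg: "f \<in> Lp \<mu> p" "g \<in> Lp \<mu> p"
    have T'_meas: "T' h \<in> borel_measurable \<mu>" if "h \<in> Lp \<mu> 1 \<inter> Lp \<mu> \<infinity>" for h
      using that by (intro L2_measurable T'_L2) (simp add: L1_Linfinity_imp_L2)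
    show "AE x in \<mu>. S f x = S g x" if f_eq_g: "AE x in \<mu>. f x = g x"
    proof (rule S_eq[OF weak_image_cong[OF S_weak_image[OF fg(2)]]])
      show "AE x in \<mu>. g x = f x" using f_eq_g by eventually_elim simp
    qed (use fg T'_meas in \<open>auto intro: Lp_measurable\<close>)
    show "AE x in \<mu>. S (\<lambda>y. f y + g y) x = S f x + S g x"
      by (rule S_eq[OF weak_image_add[OF S_weak_image[OF fg(1)] S_weak_image[OF fg(2)]]])
  next
    fix f c assume f: "f \<in> Lp \<mu> p"
    show "S f \<in> Lp \<mu> p" using weak_image_Lp_bound[OF p f S_weak_image[OF f] M_pos] by simp
    show "AE x in \<mu>. S (\<lambda>y. c * f y) x = c * S f x"
      by (rule S_eq[OF weak_image_scale[OF S_weak_image[OF f]]])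
  qed
  moreover have "AE x in \<mu>. S f x = U f x" if "f \<in> Lp \<mu> 2 \<inter> Lp \<mu> p" for f
    using S_eq[OF weak_image_L2, of f] U[of f] that by (auto elim: eventually_elim2)
  moreover have "Lp_norm \<mu> p (S f) \<le> M * Lp_norm \<mu> p f" if "f \<in> Lp \<mu> p" for f
    using weak_image_Lp_bound[OF p that S_weak_image[OF that] M_pos] by simp
  ultimately show ?thesis unfolding op_norm_def using M by (intro Inf_lower) blast
qed

lemma bounded_adjoint_pair_mono: "M \<le> M' \<Longrightarrow> bounded_adjoint_pair \<mu> T T' M'"
proof unfold_locales
  assume M_le: "M \<le> M'"
  have bound_mono:
    "M * (Lp_norm \<mu> 1 f * Lp_norm \<mu> \<infinity> g) \<le> M' * (Lp_norm \<mu> 1 f * Lp_norm \<mu> \<infinity> g)" for f g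
    using M_le by (intro mult_right_mono mult_nonneg_nonneg Lp_norm_nonneg)
  fix f g assume fg: "f \<in> Lp \<mu> 2 \<inter> Lp \<mu> 1" "g \<in> Lp \<mu> 2 \<inter> Lp \<mu> \<infinity>"
  show "norm (L2_inner \<mu> (T f) g) \<le> M' * (Lp_norm \<mu> 1 f * Lp_norm \<mu> \<infinity> g)"
    using bound_left[OF fg] bound_mono by (rule order_trans)
  show "norm (L2_inner \<mu> (T g) f) \<le> M' * (Lp_norm \<mu> 1 f * Lp_norm \<mu> \<infinity> g)"
    using bound_right[OF fg] bound_mono by (rule order_trans)
qed (use M in \<open>auto intro: T T' adjoint\<close>)

theorem op_norm_le:
  assumes p: "1 \<le> p" and U: "\<And>f. f \<in> Lp \<mu> 2 \<Longrightarrow> AE x in \<mu>. U f x = T f x"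
  shows "op_norm \<mu> p p U \<le> ennreal M"
proof (rule ennreal_le_epsilon)
  fix e :: real assume e: "e > 0"
  interpret perturbed: bounded_adjoint_pair \<mu> T T' "M + e"
    using e by (intro bounded_adjoint_pair_mono) simp
  have "op_norm \<mu> p p U \<le> ennreal (M + e)" using M e by (intro perturbed.op_norm_le_if_pos p U) auto
  then show "op_norm \<mu> p p U \<le> ennreal M + ennreal e" using M e by (simp add: ennreal_plus)
qed

end

lemma (in operator_calculus) op_norm_le_if_L1_Linfinity_bounded:
  assumes \<mu>: "sigma_finite_measure \<mu>" and F: "L1_Linfinity_bounded F M" and M: "M \<ge> 0"
    and p: "1 \<le> p"
    and U: "\<And>f. f \<in> Lp \<mu> 2 \<Longrightarrow> represents (half_line F) f (U f)"
  shows "op_norm \<mu> p p U \<le> ennreal M"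
proof -
  have F_bounded: "bounded_borel (half_line F)" using F by (simp add: L1_Linfinity_bounded_def)
  have cnj_F_bounded: "bounded_borel (half_line (\<lambda>u. cnj (F u)))"
    unfolding half_line_cnj by (rule bounded_borel_cnj[OF F_bounded])
  interpret sigma_finite_measure \<mu> by fact
  interpret bounded_adjoint_pair \<mu> "fc F" "fc (\<lambda>u. cnj (F u))" M
  proof
    fix f g assume fg: "f \<in> Lp \<mu> 2 \<inter> Lp \<mu> 1" "g \<in> Lp \<mu> 2 \<inter> Lp \<mu> \<infinity>"
    show "norm (L2_inner \<mu> (fc F f) g) \<le> M * (Lp_norm \<mu> 1 f * Lp_norm \<mu> \<infinity> g)"
      "norm (L2_inner \<mu> (fc F g) f) \<le> M * (Lp_norm \<mu> 1 f * Lp_norm \<mu> \<infinity> g)"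
      using F fg by (auto simp: L1_Linfinity_bounded_def fc_inner[OF F_bounded])
  qed (rule M fc_linear[OF F_bounded] fc_linear[OF cnj_F_bounded] fc_adjoint[OF F_bounded] |
      assumption)+
  show ?thesis by (rule op_norm_le[OF p represents_cong_AE[OF U fc_represents[OF F_bounded]]])
qed

section \<open>The complex Gamma integral\<close>

definition gamma_kernel :: "real \<Rightarrow> complex \<Rightarrow> real \<Rightarrow> complex" where
  "gamma_kernel b p v =
      indicator {0<..} v *\<^sub>R (complex_of_real (v powr (b - 1)) * exp (- (p * complex_of_real v)))"

lemma gamma_kernel_measurable[measurable]: "gamma_kernel b p \<in> borel_measurable borel"
proof -
  have "(\<lambda>v. exp (- (p * complex_of_real v))) \<in> borel_measurable borel"
    by (intro borel_measurable_continuous_onI continuous_intros)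
  then show ?thesis unfolding gamma_kernel_def by measurable
qed

lemma norm_gamma_kernel:
  "norm (gamma_kernel b p v) = indicator {0<..} v * (v powr (b - 1) * exp (- Re p * v))"
  by (auto simp: gamma_kernel_def norm_mult indicator_def)

lemma gamma_kernel_of_real:
  "gamma_kernel b (complex_of_real r) v =
      complex_of_real (norm (gamma_kernel b (complex_of_real r) v))"
  unfolding norm_gamma_kernel by (simp add: gamma_kernel_def indicator_def exp_of_real[symmetric])

lemma gamma_kernel_power:
  "gamma_kernel b p v * complex_of_real v ^ n = gamma_kernel (b + real n) p v"
proof (cases "v > 0")
  case True
  have "v powr (b + real n - 1) = v powr (b - 1) * v ^ n"
    using powr_add[of v "b - 1" "real n"] True by (simp add: powr_realpow algebra_simps)
  then show ?thesis using True by (simp add: gamma_kernel_def mult_ac)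
qed (simp add: gamma_kernel_def)

lemma gamma_kernel_mult_exp:
  "gamma_kernel b p v * exp (h * complex_of_real v) = gamma_kernel b (p - h) v"
  by (simp add: gamma_kernel_def mult.assoc exp_add[symmetric] left_diff_distrib)

lemma gamma_kernel_sums:
  "(\<lambda>n. (h ^ n / fact n) * gamma_kernel (b + real n) p v) sums gamma_kernel b (p - h) v"
proof -
  have "(\<lambda>n. gamma_kernel b p v * ((h * complex_of_real v) ^ n /\<^sub>R fact n)) sums
      (gamma_kernel b p v * exp (h * complex_of_real v))"
    by (intro sums_mult exp_converges)
  moreover have "gamma_kernel b p v * ((h * complex_of_real v) ^ n /\<^sub>R fact n)
      = (h ^ n / fact n) * gamma_kernel (b + real n) p v" for n
    unfolding gamma_kernel_power[symmetric]
    by (simp add: scaleR_conv_of_real power_mult_distrib divide_inverse mult_ac)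
  ultimately show ?thesis by (simp add: gamma_kernel_mult_exp)
qed

lemma nn_integral_Gamma_scaled:
  assumes b: "b > 0" and r: "r > 0"
  shows "(\<integral>\<^sup>+v. ennreal (indicator {0<..} v * (v powr (b - 1) * exp (- r * v))) \<partial>lborel) =
      ennreal (Gamma b * r powr (- b))"
    (is "?I = _")
proof -
  have integrand:
    "ennreal (indicator {0..} (0 + r * v) * (0 + r * v) powr (b - 1) / exp (0 + r * v)) =
      ennreal (r powr (b - 1)) * ennreal (indicator {0<..} v * (v powr (b - 1) * exp (- r * v)))" for v
  proof (cases "v > 0")
    case True
    then show ?thesis using r
      by (simp add: ennreal_mult[symmetric] powr_mult exp_minus divide_inverse mult_ac)
  next
    case False
    then show ?thesis using r by (cases "v = 0") (auto simp: indicator_def zero_le_mult_iff)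
  qed
  have "ennreal (Gamma b) = (\<integral>\<^sup>+t. ennreal (indicator {0..} t * t powr (b - 1) / exp t) \<partial>lborel)"
    using b by (rule Gamma_conv_nn_integral_real)
  also have "\<dots> =
      ennreal r * (\<integral>\<^sup>+v.
          ennreal (indicator {0..} (0 + r * v) * (0 + r * v) powr (b - 1) / exp (0 + r * v)) \<partial>lborel)"
    using r by (subst nn_integral_real_affine[of _ r 0]) auto
  also have "\<dots> = ennreal r * (ennreal (r powr (b - 1)) * ?I)"
    unfolding integrand by (subst nn_integral_cmult) auto
  also have "\<dots> = ennreal (r powr b) * ?I"
    using r by (simp add: mult.assoc[symmetric] ennreal_mult[symmetric] powr_mult_base)
  finally have "ennreal (r powr (- b)) * ennreal (Gamma b) =
      ennreal (r powr (- b)) * ennreal (r powr b) * ?I"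
    by (simp add: mult.assoc)
  moreover have "ennreal (r powr (- b)) * ennreal (r powr b) = 1"
    using r by (simp add: ennreal_mult[symmetric] powr_add[symmetric])
  ultimately show ?thesis
    using b by (simp add: ennreal_mult[symmetric] mult.commute Gamma_real_nonneg)
qed

lemma
  assumes b: "b > 0" and p: "Re p > 0"
  shows integrable_gamma_kernel: "integrable lborel (gamma_kernel b p)"
    and integral_norm_gamma_kernel:
      "(LINT v|lborel. norm (gamma_kernel b p v)) = Gamma b * Re p powr (- b)"
proof -
  have nn_integral_norm:
    "(\<integral>\<^sup>+v. ennreal (norm (gamma_kernel b p v)) \<partial>lborel) = ennreal (Gamma b * Re p powr (- b))"
    unfolding norm_gamma_kernel by (rule nn_integral_Gamma_scaled[OF b p])
  then show "integrable lborel (gamma_kernel b p)" by (simp add: integrable_iff_bounded)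
  show "(LINT v|lborel. norm (gamma_kernel b p v)) = Gamma b * Re p powr (- b)"
    using nn_integral_norm b by (subst integral_eq_nn_integral) (auto simp: Gamma_real_nonneg)
qed

lemma integral_gamma_kernel_of_real:
  assumes "b > 0" and "r > 0"
  shows "(LINT v|lborel. gamma_kernel b (complex_of_real r) v) =
      complex_of_real (Gamma b * r powr (- b))"
  using integral_norm_gamma_kernel[of b "complex_of_real r"] assms
  by (subst gamma_kernel_of_real) (simp only: integral_complex_of_real Re_complex_of_real)

lemma Gamma_add_nat:
  assumes b: "b > (0::real)" shows "Gamma (b + real n) = Gamma b * pochhammer b n"
proof -
  have "b \<notin> \<int>\<^sub>\<le>\<^sub>0" using b by (auto elim!: nonpos_Ints_cases)
  then show ?thesis using pochhammer_Gamma[of b n] Gamma_real_pos[OF b] by simp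
qed

lemma minus_gbinomial_mult_power:
  "(- b gchoose n) * (- x) ^ n = pochhammer b n * x ^ n / fact n" for b x :: "'a::field_char_0"
  unfolding gbinomial_pochhammer power_minus[of x n] by simp

lemma Gamma_add_nat_powr:
  assumes "b > 0" "r > 0"
  shows "Gamma (b + real n) * r powr (- (b + real n)) =
      Gamma b * r powr (- b) * (pochhammer b n / r ^ n)"
  using assms by (simp add: Gamma_add_nat powr_diff powr_realpow)

lemma integral_gamma_kernel_near_real:
  assumes b: "b > 0" and r: "r > 0" and h: "norm h < r"
  shows "(LINT v|lborel. gamma_kernel b (complex_of_real r - h) v) =
    complex_of_real (Gamma b) * (complex_of_real r - h) powr (- complex_of_real b)"
proof -
  define f where
    "f n v = (h ^ n / fact n) * gamma_kernel (b + real n) (complex_of_real r) v" for n v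
  have integrable_f: "integrable lborel (f n)" for n
    unfolding f_def using b r by (intro integrable_mult_right integrable_gamma_kernel) auto
  have integral_f: "(LINT v|lborel. f n v) =
      complex_of_real (Gamma b * r powr (- b)) *
        ((- complex_of_real b gchoose n) * (- (h / complex_of_real r)) ^ n)" for n
    unfolding f_def minus_gbinomial_mult_power using b r
    by (simp add: integral_gamma_kernel_of_real Gamma_add_nat_powr del: minus_add_distrib)
       (simp add: power_divide pochhammer_of_real)
  have integral_norm_f: "(LINT v|lborel. norm (f n v)) =
      Gamma b * r powr (- b) * ((- b gchoose n) * (- (norm h / r)) ^ n)" for n
    unfolding f_def minus_gbinomial_mult_power using b r
    by (simp add: norm_mult norm_divide norm_power integral_norm_gamma_kernel Gamma_add_nat_powr
        del: minus_add_distrib)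
       (simp add: power_divide)
  have summable_norm: "summable (\<lambda>n. LINT v|lborel. norm (f n v))"
    unfolding integral_norm_f using h r
    by (intro summable_mult sums_summable[OF gen_binomial_real]) auto
  have "norm (- (h / complex_of_real r)) < 1" using h r by (simp add: norm_divide)
  from gen_binomial_complex[OF this, of "- complex_of_real b"]
  have "(\<lambda>n. LINT v|lborel. f n v) sums
      (complex_of_real (Gamma b * r powr (- b)) * (1 + - (h / complex_of_real r)) powr (- complex_of_real b))"
    unfolding integral_f by (rule sums_mult)
  moreover have "(\<lambda>n. LINT v|lborel. f n v) sums
      (LINT v|lborel. gamma_kernel b (complex_of_real r - h) v)"
    by (rule sums_integral_if_summable_norm(2)[OF integrable_f summable_norm])
       (simp_all add: f_def gamma_kernel_sums del: times_divide_eq_left)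
  ultimately have "(LINT v|lborel. gamma_kernel b (complex_of_real r - h) v) =
      complex_of_real (Gamma b * r powr (- b)) * (1 + - (h / complex_of_real r)) powr (- complex_of_real b)"
    by (rule sums_unique2[rotated])
  moreover have "complex_of_real r powr (- complex_of_real b) *
      (1 + - (h / complex_of_real r)) powr (- complex_of_real b) =
      (complex_of_real r - h) powr (- complex_of_real b)"
    using r by (subst powr_times_real_left[symmetric]) (simp_all add: right_diff_distrib)
  ultimately show ?thesis using r by (simp add: powr_of_real[symmetric] mult.assoc)
qed

text \<open>The right half plane is the union of the discs \<open>|p - r| < r\<close>, and in each of them the
  expansion of the exponential about \<open>r\<close> turns the integral into a binomial series.\<close>
theorem integral_gamma_kernel:
  assumes b: "b > 0" and p: "Re p > 0"
  shows "(LINT v|lborel. gamma_kernel b p v) =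
      complex_of_real (Gamma b) * p powr (- complex_of_real b)"
proof -
  define r where "r = (norm p)\<^sup>2 / (2 * Re p) + 1"
  have r: "r > 0" using p by (simp add: r_def add_nonneg_pos)
  have "(norm (complex_of_real r - p))\<^sup>2 = r\<^sup>2 - 2 * r * Re p + (norm p)\<^sup>2"
    unfolding cmod_power2 by (simp add: power2_eq_square algebra_simps)
  also have "2 * r * Re p = (norm p)\<^sup>2 + 2 * Re p" using p by (simp add: r_def field_simps)
  finally have "(norm (complex_of_real r - p))\<^sup>2 < r\<^sup>2" using p by simp
  then have "norm (complex_of_real r - p) < r" using r by (simp add: power2_less_imp_less)
  from integral_gamma_kernel_near_real[OF b r this] show ?thesis by simp
qed

section \<open>Bessel functions\<close>

text \<open>The classical \<open>J\<^sub>\<nu>(x)\<close> is \<open>(x / 2) powr \<nu> * bessel (\<nu> + 1) (x\<^sup>2)\<close>.\<close>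
definition bessel_coeff :: "real \<Rightarrow> nat \<Rightarrow> real" where
  "bessel_coeff b k = (- 1 / 4) ^ k / (fact k * Gamma (b + real k))"

definition bessel :: "real \<Rightarrow> real \<Rightarrow> real" where
  "bessel b y = (\<Sum>k. bessel_coeff b k * y ^ k)"

lemma bessel_coeff_mult_Gamma:
  assumes "b > 0" shows "bessel_coeff b k * Gamma (b + real k) = (- 1 / 4) ^ k / fact k"
proof -
  have "Gamma (b + real k) > 0" using assms by (intro Gamma_real_pos) auto
  then show ?thesis by (simp add: bessel_coeff_def)
qed

lemma Suc_mult_bessel_coeff_Suc:
  "real (Suc k) * bessel_coeff b (Suc k) = - bessel_coeff (b + 1) k / 4"
proof -
  have "b + real (Suc k) = b + 1 + real k" by simp
  moreover have "x * ((- 1 / 4) * e / (x * F * g)) = - (e / (F * g)) / 4"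
    if "x \<noteq> 0" for x e F g :: real
    using that by simp
  ultimately show ?thesis unfolding bessel_coeff_def by (simp only: power_Suc fact_Suc)
qed

lemma bessel_coeff_plus1:
  assumes b: "b > 0" shows "(b + real k) * bessel_coeff (b + 1) k = bessel_coeff b k"
proof -
  have "b + real k \<notin> \<int>\<^sub>\<le>\<^sub>0" using b by (auto elim!: nonpos_Ints_cases)
  then have "Gamma (b + 1 + real k) = (b + real k) * Gamma (b + real k)"
    using Gamma_plus1[of "b + real k"] by (simp add: add_ac)
  moreover have "b + real k \<noteq> 0" using b by simp
  ultimately show ?thesis by (simp add: bessel_coeff_def)
qed

lemma abs_bessel_coeff_le:
  assumes b: "b > 0" shows "\<bar>bessel_coeff b k\<bar> \<le> (1 / (4 * b)) ^ k / (fact k * Gamma b)"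
proof -
  have Gamma_pos: "Gamma b > 0" "Gamma (b + real k) > 0" using b by (auto intro!: Gamma_real_pos)
  have "b ^ k \<le> pochhammer b k"
    unfolding pochhammer_prod using b prod_mono[of "{0..<k}" "\<lambda>_. b" "\<lambda>i. b + real i"] by simp
  then have "b ^ k * Gamma b \<le> Gamma (b + real k)"
    using b Gamma_pos by (simp add: Gamma_add_nat mult.commute)
  then have "\<bar>bessel_coeff b k\<bar> \<le> (1/4) ^ k / (fact k * (b ^ k * Gamma b))"
    using b Gamma_pos unfolding bessel_coeff_def
    by (simp add: abs_mult power_abs) (intro divide_left_mono mult_left_mono mult_pos_pos; simp)
  also have "\<dots> = (1 / (4 * b)) ^ k / (fact k * Gamma b)"
    by (simp add: power_divide power_mult_distrib)
  finally show ?thesis .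
qed

lemma summable_abs_bessel:
  assumes b: "b > 0" shows "summable (\<lambda>k. \<bar>bessel_coeff b k * y ^ k\<bar>)"
proof (rule summable_comparison_test')
  show "summable (\<lambda>k. (\<bar>y\<bar> / (4 * b)) ^ k /\<^sub>R fact k * (1 / Gamma b))"
    by (intro summable_mult2 sums_summable[OF exp_converges])
  fix k
  have "\<bar>bessel_coeff b k\<bar> * \<bar>y\<bar> ^ k \<le> (1 / (4 * b)) ^ k / (fact k * Gamma b) * \<bar>y\<bar> ^ k"
    using abs_bessel_coeff_le[OF b] by (intro mult_right_mono) auto
  also have "\<dots> = (\<bar>y\<bar> / (4 * b)) ^ k /\<^sub>R fact k * (1 / Gamma b)"
    by (simp add: power_divide field_simps)
  finally show "norm \<bar>bessel_coeff b k * y ^ k\<bar> \<le> (\<bar>y\<bar> / (4 * b)) ^ k /\<^sub>R fact k * (1 / Gamma b)"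
    by (simp add: abs_mult power_abs)
qed

lemma bessel_sums: "b > 0 \<Longrightarrow> (\<lambda>k. bessel_coeff b k * y ^ k) sums bessel b y"
  unfolding bessel_def by (rule summable_sums[OF summable_rabs_cancel[OF summable_abs_bessel]])

lemma diffs_bessel_coeff: "diffs (bessel_coeff b) k = - bessel_coeff (b + 1) k / 4"
  unfolding diffs_def by (rule Suc_mult_bessel_coeff_Suc)

lemma bessel_has_real_derivative:
  assumes b: "b > 0" shows "(bessel b has_real_derivative - bessel (b + 1) y / 4) (at y)"
proof -
  have "(\<lambda>k. diffs (bessel_coeff b) k * y ^ k) sums (- bessel (b + 1) y / 4)"
    using sums_divide[OF sums_minus[OF bessel_sums[of "b + 1" y]], of 4] b
    by (simp add: diffs_bessel_coeff)
  moreover have "(bessel b has_real_derivative (\<Sum>k. diffs (bessel_coeff b) k * y ^ k)) (at y)"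
    unfolding bessel_def[abs_def]
    by (rule termdiffs_strong_converges_everywhere[OF sums_summable[OF bessel_sums[OF b]]])
  ultimately show ?thesis by (simp add: sums_iff)
qed

lemma bessel_measurable:
  assumes "b > 0" shows "bessel b \<in> borel_measurable borel"
  using bessel_has_real_derivative[OF assms]
  by (intro borel_measurable_continuous_onI continuous_at_imp_continuous_on ballI DERIV_isCont)

lemma bessel_contiguous:
  assumes b: "b > 0"
  shows "bessel b y = b * bessel (b + 1) y - y / 4 * bessel (b + 2) y"
proof -
  let ?c = "bessel_coeff (b + 1)"
  have "(\<lambda>k. y * (diffs ?c k * y ^ k)) sums (y * (- bessel (b + 2) y / 4))"
    unfolding diffs_bessel_coeff
    using b sums_divide[OF sums_minus[OF bessel_sums[of "b + 2" y]], of 4]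
    by (intro sums_mult) (simp add: add_ac)
  then have "(\<lambda>k. real (Suc k) * ?c (Suc k) * y ^ Suc k) sums (y * (- bessel (b + 2) y / 4))"
    by (simp add: diffs_def mult_ac)
  then have "(\<lambda>k. real k * ?c k * y ^ k) sums (y * (- bessel (b + 2) y / 4))"
    by (subst (asm) sums_Suc_iff) simp
  then have "(\<lambda>k. b * (?c k * y ^ k) + real k * ?c k * y ^ k) sums
      (b * bessel (b + 1) y + y * (- bessel (b + 2) y / 4))"
    using b by (intro sums_add sums_mult bessel_sums) auto
  moreover have "b * (?c k * y ^ k) + real k * ?c k * y ^ k = bessel_coeff b k * y ^ k" for k
    unfolding bessel_coeff_plus1[OF b, of k, symmetric] by (simp add: algebra_simps)
  ultimately show ?thesis using sums_unique2[OF bessel_sums[OF b]] by simp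
qed

text \<open>The energy \<open>w\<^sup>2 + w'\<^sup>2\<close> grows at most by the factor \<open>exp (\<integral> |c| / x\<^sup>2)\<close>.\<close>
lemma perturbed_oscillator_bounded:
  assumes w: "\<And>x. x \<ge> 1 \<Longrightarrow> (w has_real_derivative v x) (at x)"
    and v: "\<And>x. x \<ge> 1 \<Longrightarrow> (v has_real_derivative - w x + c * w x / x\<^sup>2) (at x)"
  shows "\<exists>K. \<forall>x\<ge>1. \<bar>w x\<bar> \<le> K"
proof -
  define E where "E x = ((w x)\<^sup>2 + (v x)\<^sup>2) * exp (\<bar>c\<bar> / x)" for x
  have E_decreasing: "\<exists>y. (E has_real_derivative y) (at x) \<and> y \<le> 0" if x: "x \<ge> 1" for x
  proof (intro exI conjI)
    have "((\<lambda>x. exp (\<bar>c\<bar> / x)) has_real_derivative exp (\<bar>c\<bar> / x) * (- \<bar>c\<bar> / x\<^sup>2)) (at x)"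
      using x by (auto intro!: derivative_eq_intros simp: power2_eq_square)
    then show "(E has_real_derivative exp (\<bar>c\<bar> / x) / x\<^sup>2 *
        (2 * c * (w x * v x) - \<bar>c\<bar> * ((w x)\<^sup>2 + (v x)\<^sup>2))) (at x)"
      unfolding E_def using w[OF x] v[OF x] x
      by (auto intro!: derivative_eq_intros simp: field_simps power2_eq_square)
    have "2 * c * (w x * v x) \<le> \<bar>c\<bar> * (2 * \<bar>w x\<bar> * \<bar>v x\<bar>)"
      using abs_ge_self[of "c * (w x * v x)"] by (simp add: abs_mult)
    also have "\<dots> \<le> \<bar>c\<bar> * ((w x)\<^sup>2 + (v x)\<^sup>2)"
      using sum_squares_bound[of "\<bar>w x\<bar>" "\<bar>v x\<bar>"] by (intro mult_left_mono) auto
    finally show "exp (\<bar>c\<bar> / x) / x\<^sup>2 * (2 * c * (w x * v x) - \<bar>c\<bar> * ((w x)\<^sup>2 + (v x)\<^sup>2)) \<le> 0"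
      by (intro mult_nonneg_nonpos) auto
  qed
  have "\<bar>w x\<bar> \<le> sqrt (E 1)" if x: "x \<ge> 1" for x
  proof -
    have "(w x)\<^sup>2 * 1 \<le> ((w x)\<^sup>2 + (v x)\<^sup>2) * exp (\<bar>c\<bar> / x)" using x by (intro mult_mono) auto
    also have "\<dots> \<le> E 1"
      unfolding E_def[symmetric] using x E_decreasing
      by (intro DERIV_nonpos_imp_nonincreasing[of 1 x E]) auto
    finally show ?thesis by (intro real_le_rsqrt) simp
  qed
  then show ?thesis by blast
qed

lemma powr_mult_bessel_bounded:
  assumes a: "a > 0"
  shows "\<exists>K. \<forall>x\<ge>1. \<bar>x powr a * bessel (a + 1/2) (x\<^sup>2)\<bar> \<le> K"
proof (rule perturbed_oscillator_bounded[where c = "a * (a - 1)"])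
  let ?B = "\<lambda>i x. bessel (a + 1/2 + i) (x\<^sup>2)"
  let ?v = "\<lambda>x. x powr a * (a / x * bessel (a + 1/2) (x\<^sup>2) - x / 2 * ?B 1 x)"
  have deriv: "((\<lambda>x. bessel b (x\<^sup>2)) has_real_derivative - x / 2 * bessel (b + 1) (x\<^sup>2)) (at x)"
    if "b > 0" for b x
    by (rule DERIV_chain2[OF bessel_has_real_derivative[OF that], THEN DERIV_cong])
       (auto intro!: derivative_eq_intros)
  have deriv_powr: "((\<lambda>x. x powr a) has_real_derivative x powr a * (a / x)) (at x)" if "x \<ge> 1" for x
    using that by (auto intro!: derivative_eq_intros simp: powr_diff)
  fix x :: real assume x: "x \<ge> 1"
  show "((\<lambda>x. x powr a * bessel (a + 1/2) (x\<^sup>2)) has_real_derivative ?v x) (at x)"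
    using DERIV_mult[OF deriv_powr[OF x] deriv[of "a + 1/2" x]] a
    by (rule_tac DERIV_cong) (auto simp: algebra_simps)
  have equation: "P * (a / x) * (a / x * B - x / 2 * B') +
      (- a / x\<^sup>2 * B + - x / 2 * B' * (a / x) - (1 / 2 * B' + - x / 2 * B'' * (x / 2))) * P =
      - (P * B) + a * (a - 1) * (P * B) / x\<^sup>2"
    if "B = (a + 1/2) * B' - x\<^sup>2 / 4 * B''" for P B B' B'' :: real
    using x by (simp add: that field_simps power2_eq_square)
  have contiguous:
    "bessel (a + 1/2) (x\<^sup>2) = (a + 1/2) * ?B 1 x - x\<^sup>2 / 4 * bessel (a + 1/2 + 1 + 1) (x\<^sup>2)"
    using bessel_contiguous[of "a + 1/2" "x\<^sup>2"] a by (simp add: add_ac)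
  have "((\<lambda>x. a / x) has_real_derivative - a / x\<^sup>2) (at x)"
    "((\<lambda>x. x / 2) has_real_derivative 1 / 2) (at x)"
    using x by (auto intro!: derivative_eq_intros simp: power2_eq_square)
  then have "((\<lambda>x. a / x * bessel (a + 1/2) (x\<^sup>2) - x / 2 * ?B 1 x) has_real_derivative
      (- a / x\<^sup>2 * bessel (a + 1/2) (x\<^sup>2) + - x / 2 * ?B 1 x * (a / x)) -
      (1 / 2 * ?B 1 x + - x / 2 * bessel (a + 1/2 + 1 + 1) (x\<^sup>2) * (x / 2))) (at x)"
    using a by (intro DERIV_diff DERIV_mult deriv) auto
  from DERIV_mult[OF deriv_powr[OF x] this]
  show "(?v has_real_derivative - (x powr a * bessel (a + 1/2) (x\<^sup>2)) +
      a * (a - 1) * (x powr a * bessel (a + 1/2) (x\<^sup>2)) / x\<^sup>2) (at x)"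
    by (rule DERIV_cong) (rule equation[OF contiguous])
qed

lemma bessel_decay:
  assumes s: "s > 0"
  shows "\<exists>K\<ge>0. \<forall>y\<ge>0. (1 + 4 * y) powr s * \<bar>bessel (2 * s + 1/2) y\<bar> \<le> K"
proof -
  let ?b = "2 * s + 1/2"
  obtain K where K: "\<bar>x powr (2 * s) * bessel ?b (x\<^sup>2)\<bar> \<le> K" if "x \<ge> 1" for x
    using powr_mult_bessel_bounded[of "2 * s"] s by auto
  have "continuous_on {0..1} (bessel ?b)"
    using bessel_has_real_derivative[of ?b] s
    by (intro continuous_at_imp_continuous_on ballI DERIV_isCont) auto
  then have "compact (bessel ?b ` {0..1})" by (intro compact_continuous_image) auto
  then obtain K' where K': "\<bar>bessel ?b y\<bar> \<le> K'" if "y \<in> {0..1}" for y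
    using compact_imp_bounded bounded_iff by (metis imageI real_norm_def)
  have nonneg: "K \<ge> 0" "K' \<ge> 0" using K[of 1] K'[of 0] by auto
  have "(1 + 4 * y) powr s * \<bar>bessel ?b y\<bar> \<le> 5 powr s * max K K'" if y: "y \<ge> 0" for y
  proof (cases "y \<le> 1")
    case True
    with y s K'[of y] show ?thesis by (intro mult_mono powr_mono2) auto
  next
    case False
    have "sqrt y powr (2 * s) = y powr s"
      using False by (simp add: powr_half_sqrt[symmetric] powr_powr)
    with K[of "sqrt y"] False have at_top: "y powr s * \<bar>bessel ?b y\<bar> \<le> K" by (simp add: abs_mult)
    have "(1 + 4 * y) powr s * \<bar>bessel ?b y\<bar> \<le> (5 * y) powr s * \<bar>bessel ?b y\<bar>"
      using False s by (intro mult_right_mono powr_mono2) auto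
    also have "\<dots> = 5 powr s * (y powr s * \<bar>bessel ?b y\<bar>)" using False by (simp add: powr_mult)
    also have "\<dots> \<le> 5 powr s * max K K'" using at_top by (intro mult_left_mono) auto
    finally show ?thesis .
  qed
  then show ?thesis using nonneg by (intro exI[of _ "5 powr s * max K K'"]) auto
qed

lemma
  assumes b: "b > 0" and p: "Re p > 0"
  shows integral_gamma_kernel_bessel_term:
      "(LINT v|lborel. complex_of_real (bessel_coeff b k * u ^ k) * gamma_kernel (b + real k) p v) =
        p powr (- complex_of_real b) * ((- complex_of_real u / (4 * p)) ^ k /\<^sub>R fact k)"
    and integral_norm_gamma_kernel_bessel_term:
      "(LINT v|lborel. norm (complex_of_real (bessel_coeff b k * u ^ k) * gamma_kernel (b + real k) p v)) =
        Re p powr (- b) * ((\<bar>u\<bar> / (4 * Re p)) ^ k /\<^sub>R fact k)"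
proof -
  have "p \<noteq> 0" using p by auto
  then have "p powr (- complex_of_real (b + real k)) = p powr (- complex_of_real b) / p ^ k"
    by (simp add: powr_diff powr_nat')
  then have "(LINT v|lborel. complex_of_real (bessel_coeff b k * u ^ k) *
      gamma_kernel (b + real k) p v) =
      complex_of_real (bessel_coeff b k * Gamma (b + real k)) *
        (complex_of_real u ^ k * (p powr (- complex_of_real b) / p ^ k))"
    using b p by (simp add: integral_gamma_kernel)
  also have "\<dots> = p powr (- complex_of_real b) *
      ((complex_of_real (- 1 / 4) ^ k * complex_of_real u ^ k / p ^ k) /\<^sub>R fact k)"
    unfolding bessel_coeff_mult_Gamma[OF b] of_real_divide[of "_ ^ k"] of_real_power
    by (simp only: scaleR_conv_of_real divide_inverse of_real_inverse mult_ac)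
  also have "complex_of_real (- 1 / 4) ^ k * complex_of_real u ^ k / p ^ k =
      (- complex_of_real u / (4 * p)) ^ k"
    by (simp only: power_divide[symmetric] power_mult_distrib[symmetric]) simp
  finally show "(LINT v|lborel. complex_of_real (bessel_coeff b k * u ^ k) *
      gamma_kernel (b + real k) p v) =
        p powr (- complex_of_real b) * ((- complex_of_real u / (4 * p)) ^ k /\<^sub>R fact k)" .
  have "(LINT v|lborel. norm (complex_of_real (bessel_coeff b k * u ^ k) * gamma_kernel (b + real k) p v)) =
      \<bar>bessel_coeff b k * Gamma (b + real k)\<bar> * (\<bar>u\<bar> ^ k * (Re p powr (- b) / Re p ^ k))"
    unfolding norm_mult norm_of_real using b p
    by (simp add: integral_norm_gamma_kernel abs_mult power_abs Gamma_real_nonneg powr_diff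
        powr_realpow)
  also have "\<bar>bessel_coeff b k * Gamma (b + real k)\<bar> = (1 / 4) ^ k / fact k"
    using b by (simp add: bessel_coeff_mult_Gamma abs_mult power_abs)
  also have "(1 / 4) ^ k / fact k * (\<bar>u\<bar> ^ k * (Re p powr (- b) / Re p ^ k)) =
      Re p powr (- b) * (((1 / 4) ^ k * \<bar>u\<bar> ^ k / Re p ^ k) /\<^sub>R fact k)"
    by (simp only: real_scaleR_def divide_inverse mult_ac)
  also have "(1 / 4) ^ k * \<bar>u\<bar> ^ k / Re p ^ k = (\<bar>u\<bar> / (4 * Re p)) ^ k"
    by (simp only: power_divide[symmetric] power_mult_distrib[symmetric]) simp
  finally show "(LINT v|lborel. norm (complex_of_real (bessel_coeff b k * u ^ k) * gamma_kernel (b + real k) p v)) =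
        Re p powr (- b) * ((\<bar>u\<bar> / (4 * Re p)) ^ k /\<^sub>R fact k)" .
qed

theorem integral_gamma_kernel_bessel:
  assumes b: "b > 0" and p: "Re p > 0"
  shows "(LINT v|lborel. gamma_kernel b p v * complex_of_real (bessel b (v * u))) =
    p powr (- complex_of_real b) * exp (- complex_of_real u / (4 * p))"
proof -
  define f where
    "f k v = complex_of_real (bessel_coeff b k * u ^ k) * gamma_kernel (b + real k) p v" for k v
  note [measurable] = bessel_measurable[OF b]
  have "f k v = gamma_kernel b p v * complex_of_real (bessel_coeff b k * (v * u) ^ k)" for k v
    unfolding f_def gamma_kernel_power[symmetric] by (simp add: power_mult_distrib mult_ac)
  then have sums: "(\<lambda>k. f k v) sums (gamma_kernel b p v * complex_of_real (bessel b (v * u)))" for v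
    using b by (simp only:) (intro sums_mult sums_of_real bessel_sums)
  have integrable_f: "integrable lborel (f k)" for k
    unfolding f_def using b p by (intro integrable_mult_right integrable_gamma_kernel) auto
  have summable: "summable (\<lambda>k. LINT v|lborel. norm (f k v))"
    unfolding f_def integral_norm_gamma_kernel_bessel_term[OF b p]
    by (intro summable_mult sums_summable[OF exp_converges])
  have "(\<lambda>k. LINT v|lborel. f k v) sums
      (LINT v|lborel. gamma_kernel b p v * complex_of_real (bessel b (v * u)))"
    by (rule sums_integral_if_summable_norm(2)[OF integrable_f summable _ AE_I2[OF sums]]) measurable
  moreover have "(\<lambda>k. LINT v|lborel. f k v) sums
      (p powr (- complex_of_real b) * exp (- complex_of_real u / (4 * p)))"
    unfolding f_def integral_gamma_kernel_bessel_term[OF b p] by (intro sums_mult exp_converges)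
  ultimately show ?thesis by (rule sums_unique2)
qed

definition beta_weight :: "real \<Rightarrow> real \<Rightarrow> real" where
  "beta_weight a t = indicator {0<..<1} t * (t powr (- (1/2)) * (1 - t) powr (a - 1))"

lemma beta_weight_measurable[measurable]: "beta_weight a \<in> borel_measurable borel"
  unfolding beta_weight_def by measurable

lemma beta_weight_mult_power_nonneg: "0 \<le> beta_weight a t * t ^ k"
  by (auto simp: beta_weight_def indicator_def)

lemma
  assumes a: "a > 0"
  shows integrable_beta_weight_mult_power: "integrable lborel (\<lambda>t. beta_weight a t * t ^ k)"
    and integral_beta_weight_mult_power:
      "(LINT t|lborel. beta_weight a t * t ^ k) = Beta (real k + 1/2) a"
proof -
  have integrand: "ennreal (beta_weight a t * t ^ k) =
      ennreal (t powr (real k + 1/2 - 1) * (1 - t) powr (a - 1)) * indicator {0..1} t" for t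
  proof (cases "0 < t \<and> t < 1")
    case True
    have "t powr (real k + 1/2 - 1) = t powr (- (1/2)) * t ^ k"
      using powr_add[of t "- (1/2)" "real k"] True by (simp add: powr_realpow algebra_simps)
    then show ?thesis using True by (simp add: beta_weight_def mult_ac)
  next
    case False
    then show ?thesis by (cases "t = 0"; cases "t = 1") (auto simp: beta_weight_def indicator_def)
  qed
  have has_integral:
    "((\<lambda>t. t powr (real k + 1/2 - 1) * (1 - t) powr (a - 1)) has_integral Beta (real k + 1/2) a) {0..1}"
    using a by (intro has_integral_Beta_real) auto
  have nn_integral:
    "(\<integral>\<^sup>+t. ennreal (beta_weight a t * t ^ k) \<partial>lborel) = ennreal (Beta (real k + 1/2) a)"
    unfolding integrand by (rule nn_integral_has_integral_lebesgue'[OF _ has_integral]) auto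
  then show "integrable lborel (\<lambda>t. beta_weight a t * t ^ k)"
    using beta_weight_mult_power_nonneg by (intro integrableI_nonneg) auto
  have "Beta (real k + 1/2) a \<ge> 0" by (rule has_integral_nonneg[OF has_integral]) auto
  then show "(LINT t|lborel. beta_weight a t * t ^ k) = Beta (real k + 1/2) a"
    using nn_integral beta_weight_mult_power_nonneg by (subst integral_eq_nn_integral) auto
qed

lemma Beta_half_eq_bessel_coeff:
  assumes a: "a > 0"
  shows "(- 1) ^ k / fact (2 * k) * Beta (real k + 1/2) a =
      sqrt pi * Gamma a * bessel_coeff (a + 1/2) k"
proof -
  have "Gamma (real k + 1/2) = sqrt pi * pochhammer (1/2) k"
    using Gamma_add_nat[of "1/2" k] by (simp add: Gamma_one_half_real add.commute)
  moreover have "(fact (2 * k) :: real) = 4 ^ k * pochhammer (1/2) k * fact k"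
    using fact_double[of k, where 'a = real] by (simp add: power_mult)
  moreover have "pochhammer (1/2 :: real) k > 0" by (simp add: pochhammer_pos)
  moreover have "(- 1 / 4) ^ k = (- 1) ^ k / (4::real) ^ k" by (rule power_divide)
  ultimately show ?thesis by (simp add: Beta_def bessel_coeff_def add_ac mult_ac)
qed

theorem bessel_eq_cosine_integral:
  assumes a: "a > 0"
  shows "(LINT t|lborel. beta_weight a t * cos (x * sqrt t)) =
      sqrt pi * Gamma a * bessel (a + 1/2) (x\<^sup>2)"
proof -
  define f where
    "f k t = ((- 1) ^ k / fact (2 * k) * x ^ (2 * k)) * (beta_weight a t * t ^ k)" for k t
  have "f k t = beta_weight a t * ((- 1) ^ k / fact (2 * k) * (x * sqrt t) ^ (2 * k))" for k t
  proof (cases "t > 0")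
    case True
    then have "sqrt t ^ (2 * k) = t ^ k" by (simp add: power_mult)
    then show ?thesis by (simp add: f_def power_mult_distrib)
  qed (simp add: f_def beta_weight_def)
  then have sums: "(\<lambda>k. f k t) sums (beta_weight a t * cos (x * sqrt t))" for t
    by (simp only:) (intro sums_mult cos_paired)
  have integrable_f: "integrable lborel (f k)" for k
    unfolding f_def by (intro integrable_mult_right integrable_beta_weight_mult_power a)
  have integral_f:
    "(LINT t|lborel. f k t) = sqrt pi * Gamma a * (bessel_coeff (a + 1/2) k * (x\<^sup>2) ^ k)" for k
    using arg_cong[OF Beta_half_eq_bessel_coeff[OF a, of k], of "\<lambda>z. z * (x\<^sup>2) ^ k"]
    unfolding f_def power_mult[of x] integral_mult_right_zero integral_beta_weight_mult_power[OF a]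
    by (simp only: mult_ac times_divide_eq_left times_divide_eq_right)
  have "(LINT t|lborel. norm (f k t)) = \<bar>LINT t|lborel. f k t\<bar>" for k
    unfolding f_def real_norm_def abs_mult[of "_ * _ ^ _"] integral_mult_right_zero
    by (simp only: abs_of_nonneg[OF beta_weight_mult_power_nonneg]
        abs_of_nonneg[OF Bochner_Integration.integral_nonneg[OF beta_weight_mult_power_nonneg]])
  then have summable: "summable (\<lambda>k. LINT t|lborel. norm (f k t))"
    using a
    by (simp add: integral_f abs_mult[of "sqrt pi * Gamma a"] summable_mult summable_abs_bessel)
  have "(\<lambda>k. LINT t|lborel. f k t) sums (LINT t|lborel. beta_weight a t * cos (x * sqrt t))"
    by (rule sums_integral_if_summable_norm(2)[OF integrable_f summable _ AE_I2[OF sums]]) measurable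
  moreover have "(\<lambda>k. LINT t|lborel. f k t) sums (sqrt pi * Gamma a * bessel (a + 1/2) (x\<^sup>2))"
    unfolding integral_f using a by (intro sums_mult bessel_sums) auto
  ultimately show ?thesis by (rule sums_unique2)
qed

section \<open>The Fourier transform on the line\<close>

lemma (in pair_sigma_finite) integrable_mult_pair:
  fixes f g :: "_ \<Rightarrow> _::{real_normed_field, banach, second_countable_topology}"
  assumes f: "integrable M1 f" and g: "integrable M2 g"
  shows "integrable (M1 \<Otimes>\<^sub>M M2) (\<lambda>(x, y). f x * g y)"
proof (rule Fubini_integrable)
  note [measurable] = borel_measurable_integrable[OF f] borel_measurable_integrable[OF g]
  show "(\<lambda>(x, y). f x * g y) \<in> borel_measurable (M1 \<Otimes>\<^sub>M M2)" by measurable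
  show "integrable M1 (\<lambda>x. LINT y|M2. norm (case (x, y) of (x, y) \<Rightarrow> f x * g y))"
    using f by (simp add: norm_mult)
  show "AE x in M1. integrable M2 (\<lambda>y. case (x, y) of (x, y) \<Rightarrow> f x * g y)" using g by simp
qed

lemma (in pair_sigma_finite) integral_mult_pair:
  fixes f g :: "_ \<Rightarrow> _::{real_normed_field, banach, second_countable_topology}"
  assumes "integrable M1 f" "integrable M2 g"
  shows "(LINT z|(M1 \<Otimes>\<^sub>M M2). f (fst z) * g (snd z)) = (LINT x|M1. f x) * (LINT y|M2. g y)"
  using integral_fst[of "\<lambda>x y. f x * g y"] integrable_mult_pair[OF assms]
  by (simp add: case_prod_beta')

definition fourier :: "(real \<Rightarrow> complex) \<Rightarrow> real \<Rightarrow> complex" where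
  "fourier f \<xi> = (LINT x|lborel. f x * exp (- (\<i> * of_real (x * \<xi>))))"

lemma fourier_measurable[measurable (raw)]:
  assumes [measurable]: "f \<in> borel_measurable lborel" shows "fourier f \<in> borel_measurable borel"
  unfolding fourier_def by measurable

lemma norm_fourier_le: "norm (fourier f \<xi>) \<le> (LINT x|lborel. norm (f x))"
  unfolding fourier_def
  using integral_norm_bound[of lborel "\<lambda>x. f x * exp (- (\<i> * of_real (x * \<xi>)))"]
  by (simp add: norm_mult)

lemma integrable_mult_unimodular:
  fixes f e :: "_ \<Rightarrow> complex"
  assumes f: "integrable M f" and e: "e \<in> borel_measurable M" and norm_e: "\<And>x. norm (e x) = 1"
  shows "integrable M (\<lambda>x. f x * e x)"
  by (rule Bochner_Integration.integrable_bound[OF f]) (use f e in \<open>auto simp: norm_mult norm_e\<close>)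

lemma fourier_diff:
  assumes "integrable lborel f" "integrable lborel g"
  shows "fourier (\<lambda>x. f x - g x) \<xi> = fourier f \<xi> - fourier g \<xi>"
  unfolding fourier_def left_diff_distrib
  by (intro Bochner_Integration.integral_diff integrable_mult_unimodular assms)
    (auto simp: norm_exp_eq_Re)

lemma fourier_mult_character: "fourier (\<lambda>x. f x * exp (\<i> * of_real (u * x))) \<xi> = fourier f (\<xi> - u)"
  unfolding fourier_def mult.assoc exp_add[symmetric] by (simp add: algebra_simps)

lemma integral_fourier_mult:
  assumes f: "integrable lborel f" and g: "integrable lborel g"
  shows "(LINT \<xi>|lborel. fourier f \<xi> * g \<xi>) = (LINT x|lborel. f x * fourier g x)"
proof -
  let ?H = "\<lambda>x \<xi>. f x * g \<xi> * exp (- (\<i> * of_real (x * \<xi>)))"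
  note [measurable] = borel_measurable_integrable[OF f] borel_measurable_integrable[OF g]
  have "integrable (lborel \<Otimes>\<^sub>M lborel) (\<lambda>z. (case z of (x, \<xi>) \<Rightarrow> f x * g \<xi>) *
      exp (- (\<i> * of_real (fst z * snd z))))"
    by (rule integrable_mult_unimodular[OF lborel_pair.integrable_mult_pair[OF f g]])
       (auto simp: norm_exp_eq_Re)
  then have H: "integrable (lborel \<Otimes>\<^sub>M lborel) (case_prod ?H)" by (simp add: case_prod_beta')
  have "(LINT \<xi>|lborel. fourier f \<xi> * g \<xi>) = (LINT \<xi>|lborel. LINT x|lborel. ?H x \<xi>)"
    unfolding fourier_def integral_mult_left_zero[symmetric] by (simp only: mult_ac)
  also have "\<dots> = (LINT x|lborel. LINT \<xi>|lborel. ?H x \<xi>)" by (rule lborel_pair.Fubini_integral[OF H])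
  also have "\<dots> = (LINT x|lborel. f x * fourier g x)"
    unfolding fourier_def integral_mult_right_zero[symmetric] by (simp only: mult_ac)
  finally show ?thesis .
qed

definition gaussian :: "real \<Rightarrow> real \<Rightarrow> complex" where
  "gaussian e \<xi> = complex_of_real (exp (- (e * \<xi>)\<^sup>2 / 2))"

lemma gaussian_measurable[measurable]: "gaussian e \<in> borel_measurable borel"
  unfolding gaussian_def by measurable

lemma norm_gaussian_le: "norm (gaussian e \<xi>) \<le> 1"
  by (simp add: gaussian_def)

lemma gaussian_eq_std_normal_density:
  "gaussian e \<xi> = complex_of_real (sqrt (2 * pi) * std_normal_density (0 + e * \<xi>))"
  by (simp add: gaussian_def std_normal_density_def)

lemma integrable_gaussian: "e \<noteq> 0 \<Longrightarrow> integrable lborel (gaussian e)"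
  unfolding gaussian_eq_std_normal_density[abs_def]
  by (intro integrable_of_real integrable_mult_right lborel_integrable_real_affine) auto

lemma fourier_gaussian:
  assumes e: "e > 0"
  shows "fourier (gaussian e) x = complex_of_real (2 * pi * normal_density 0 e x)"
proof -
  let ?f = "\<lambda>s. complex_of_real (std_normal_density s) * exp (\<i> * of_real (- x / e * s))"
  have "complex_of_real (exp (- (- x / e)\<^sup>2 / 2)) =
      (LINT s|lborel. std_normal_density s *\<^sub>R exp (\<i> * of_real (- x / e * s)))"
    unfolding fun_cong[OF char_std_normal_distribution, symmetric] char_def
    by (subst integral_density) auto
  also have "\<dots> = \<bar>e\<bar> *\<^sub>R (LINT \<xi>|lborel. ?f (0 + e * \<xi>))"
    unfolding scaleR_conv_of_real[of "std_normal_density _"] using e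
    by (intro lborel_integral_real_affine) auto
  also have "(LINT \<xi>|lborel. ?f (0 + e * \<xi>)) =
      fourier (gaussian e) x / complex_of_real (sqrt (2 * pi))"
    unfolding fourier_def integral_divide_zero[symmetric] gaussian_eq_std_normal_density
    using e by (intro Bochner_Integration.integral_cong) (auto simp: mult_ac)
  finally have "complex_of_real (exp (- (- x / e)\<^sup>2 / 2) * (sqrt (2 * pi) / e)) =
      fourier (gaussian e) x"
    using e by (simp add: scaleR_conv_of_real field_simps)
  moreover have "exp (- (- x / e)\<^sup>2 / 2) * (sqrt (2 * pi) / e) = 2 * pi * normal_density 0 e x"
    using e by (simp add: normal_density_def real_sqrt_mult power_divide field_simps)
  ultimately show ?thesis by (simp only:)
qed

lemma integrable_gaussian_wave:
  assumes "e \<noteq> 0" shows "integrable lborel (\<lambda>\<xi>. gaussian e \<xi> * exp (\<i> * of_real (u * \<xi>)))"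
  by (intro integrable_mult_unimodular integrable_gaussian assms) auto

lemma integral_fourier_gaussian_wave:
  assumes f: "integrable lborel f" and e: "e > 0"
  shows "(LINT \<xi>|lborel. fourier f \<xi> * (gaussian e \<xi> * exp (\<i> * of_real (u * \<xi>)))) =
    complex_of_real (2 * pi) * (LINT y|lborel. f (u + e * y) * complex_of_real (std_normal_density y))"
proof -
  note [measurable] = borel_measurable_integrable[OF f]
  have "integrable lborel (\<lambda>\<xi>. gaussian e \<xi> * exp (\<i> * of_real (u * \<xi>)))"
    using e by (intro integrable_gaussian_wave) simp
  then have "(LINT \<xi>|lborel. fourier f \<xi> * (gaussian e \<xi> * exp (\<i> * of_real (u * \<xi>)))) =
      (LINT x|lborel. f x * complex_of_real (2 * pi * normal_density 0 e (x - u)))"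
    by (subst integral_fourier_mult[OF f])
      (simp_all only: fourier_mult_character fourier_gaussian[OF e])
  also have "\<dots> =
      \<bar>e\<bar> *\<^sub>R (LINT y|lborel. f (u + e * y) * of_real (2 * pi * normal_density 0 e (u + e * y - u)))"
    using e by (intro lborel_integral_real_affine) auto
  also have "\<dots> =
      (LINT y|lborel.
          complex_of_real (2 * pi) * (f (u + e * y) * complex_of_real (std_normal_density y)))"
    unfolding integral_scaleR_right[symmetric] using e
    by (intro Bochner_Integration.integral_cong)
       (auto simp: normal_density_def real_sqrt_mult power_mult_distrib scaleR_conv_of_real)
  finally show ?thesis by simp
qed

lemma norm_integral_fourier_gaussian_wave_le:
  assumes f: "integrable lborel f" and B: "\<And>x. norm (f x) \<le> B" and e: "e > 0"
  shows "norm (LINT \<xi>|lborel. fourier f \<xi> * (gaussian e \<xi> * exp (\<i> * of_real (u * \<xi>)))) \<le>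
      2 * pi * B"
proof -
  have "norm (LINT y|lborel. f (u + e * y) * complex_of_real (std_normal_density y)) \<le>
      (LINT y|lborel. norm (f (u + e * y) * complex_of_real (std_normal_density y)))"
    by (rule integral_norm_bound)
  also have "\<dots> \<le> (LINT y|lborel. B * std_normal_density y)"
    using order_trans[OF norm_ge_zero B[of 0]] B
    by (intro integral_mono_AE') (auto simp: norm_mult intro!: mult_right_mono)
  finally show ?thesis unfolding integral_fourier_gaussian_wave[OF f e] by (simp add: norm_mult)
qed

lemma gaussian_tendsto_1:
  assumes "e \<longlonglongrightarrow> 0" shows "(\<lambda>n. gaussian (e n) \<xi>) \<longlonglongrightarrow> 1"
proof -
  have "(\<lambda>n. gaussian (e n) \<xi>) \<longlonglongrightarrow> complex_of_real (exp (- (0 * \<xi>)\<^sup>2 / 2))"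
    unfolding gaussian_def by (intro tendsto_intros assms) auto
  then show ?thesis by simp
qed

lemma normal_average_tendsto:
  fixes f :: "real \<Rightarrow> complex"
  assumes cont: "isCont f u" and [measurable]: "f \<in> borel_measurable borel"
    and B: "\<And>x. norm (f x) \<le> B" and e: "e \<longlonglongrightarrow> 0"
  shows "(\<lambda>n. LINT y|lborel. f (u + e n * y) * complex_of_real (std_normal_density y)) \<longlonglongrightarrow> f u"
proof -
  have "(\<lambda>n. LINT y|lborel. f (u + e n * y) * complex_of_real (std_normal_density y)) \<longlonglongrightarrow>
      (LINT y|lborel. f u * complex_of_real (std_normal_density y))"
  proof (rule integral_dominated_convergence[where w="\<lambda>y. B * std_normal_density y"])
    have "(\<lambda>n. u + e n * y) \<longlonglongrightarrow> u + 0 * y" for y by (intro tendsto_intros e)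
    then have "(\<lambda>n. f (u + e n * y)) \<longlonglongrightarrow> f u" for y
      by (intro isCont_tendsto_compose[OF cont]) simp
    then show "AE y in lborel. (\<lambda>n. f (u + e n * y) *
        complex_of_real (std_normal_density y)) \<longlonglongrightarrow> f u * complex_of_real (std_normal_density y)"
      by (intro AE_I2 tendsto_mult_right)
    show "AE y in lborel. norm (f (u + e n * y) * complex_of_real (std_normal_density y)) \<le>
        B * std_normal_density y" for n
      using B by (auto simp: norm_mult intro!: mult_right_mono)
  qed auto
  then show ?thesis by simp
qed

theorem fourier_inversion:
  fixes f :: "real \<Rightarrow> complex"
  assumes f: "integrable lborel f" and cont: "isCont f u" and B: "\<And>x. norm (f x) \<le> B"
    and fourier_f: "integrable lborel (fourier f)"
  shows "(LINT \<xi>|lborel. fourier f \<xi> * exp (\<i> * of_real (u * \<xi>))) = 2 * pi * f u"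
proof (rule LIMSEQ_unique)
  define e where "e n = inverse (real (Suc n))" for n
  have e: "e n > 0" "e \<longlonglongrightarrow> 0" for n
    unfolding e_def using LIMSEQ_inverse_real_of_nat by auto
  note [measurable] = borel_measurable_integrable[OF f] borel_measurable_integrable[OF fourier_f]
  let ?I = "\<lambda>n. LINT \<xi>|lborel. fourier f \<xi> * (gaussian (e n) \<xi> * exp (\<i> * of_real (u * \<xi>)))"
  show "?I \<longlonglongrightarrow> (LINT \<xi>|lborel. fourier f \<xi> * exp (\<i> * of_real (u * \<xi>)))"
  proof (rule integral_dominated_convergence[where w="\<lambda>\<xi>. norm (fourier f \<xi>)"])
    have "(\<lambda>n. fourier f \<xi> * (gaussian (e n) \<xi> * exp (\<i> * of_real (u * \<xi>)))) \<longlonglongrightarrow>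
        fourier f \<xi> * (1 * exp (\<i> * of_real (u * \<xi>)))" for \<xi>
      by (intro tendsto_mult_left tendsto_mult_right gaussian_tendsto_1 e)
    then show "AE \<xi> in lborel. (\<lambda>n. fourier f \<xi> * (gaussian (e n) \<xi> * exp (\<i> * of_real (u * \<xi>)))) \<longlonglongrightarrow>
        fourier f \<xi> * exp (\<i> * of_real (u * \<xi>))" by simp
    show "AE \<xi> in lborel. norm (fourier f \<xi> * (gaussian (e n) \<xi> * exp (\<i> * of_real (u * \<xi>)))) \<le>
        norm (fourier f \<xi>)" for n
      using norm_gaussian_le by (auto simp: norm_mult intro!: mult_left_le)
  qed (use fourier_f in auto)
  show "?I \<longlonglongrightarrow> 2 * pi * f u"
    unfolding integral_fourier_gaussian_wave[OF f e(1)]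
    by (intro tendsto_mult_left normal_average_tendsto[where B = B] cont B e(2)) simp
qed

lemma integral_norm_fourier_square_gaussian_le:
  assumes f: "integrable lborel f" and B: "\<And>x. norm (f x) \<le> B" and e: "e > 0"
  shows "integrable lborel (\<lambda>\<xi>. (norm (fourier f \<xi>))\<^sup>2 * exp (- (e * \<xi>)\<^sup>2 / 2))"
    and "(LINT \<xi>|lborel. (norm (fourier f \<xi>))\<^sup>2 * exp (- (e * \<xi>)\<^sup>2 / 2)) \<le>
        2 * pi * B * (LINT x|lborel. norm (f x))"
proof -
  define g where "g \<xi> = cnj (fourier f \<xi>) * gaussian e \<xi>" for \<xi>
  note [measurable] = borel_measurable_integrable[OF f]
  have dominated: "integrable lborel (\<lambda>\<xi>. h \<xi> * gaussian e \<xi>)"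
    if [measurable]: "h \<in> borel_measurable borel" and "\<And>\<xi>. norm (h \<xi>) \<le> K" for h K
    by (rule Bochner_Integration.integrable_bound[where f="\<lambda>\<xi>. of_real K * gaussian e \<xi>"])
       (use that order_trans[OF norm_ge_zero that(2)] e in
         \<open>auto simp: norm_mult intro!: mult_right_mono integrable_gaussian integrable_mult_right\<close>)
  have g: "integrable lborel g"
    unfolding g_def by (rule dominated) (use norm_fourier_le[of f] in auto)
  have product:
    "fourier f \<xi> * g \<xi> = complex_of_real ((norm (fourier f \<xi>))\<^sup>2 * exp (- (e * \<xi>)\<^sup>2 / 2))" for \<xi>
    unfolding g_def gaussian_def of_real_mult complex_norm_square by (simp add: mult_ac)
  have "integrable lborel (\<lambda>\<xi>. fourier f \<xi> * cnj (fourier f \<xi>) * gaussian e \<xi>)"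
    by (rule dominated[of _ "(LINT x|lborel. norm (f x))\<^sup>2"])
       (auto simp: norm_mult power2_eq_square intro!: mult_mono norm_fourier_le)
  then have "integrable lborel (\<lambda>\<xi>. complex_of_real ((norm (fourier f \<xi>))\<^sup>2 * exp (- (e * \<xi>)\<^sup>2 / 2)))"
    by (simp only: product[symmetric] g_def mult.assoc)
  then show "integrable lborel (\<lambda>\<xi>. (norm (fourier f \<xi>))\<^sup>2 * exp (- (e * \<xi>)\<^sup>2 / 2))"
    by (simp only: complex_of_real_integrable_eq)
  have "fourier g x =
      cnj (LINT \<xi>|lborel. fourier f \<xi> * (gaussian e \<xi> * exp (\<i> * of_real (x * \<xi>))))" for x
    by (subst Bochner_Integration.integral_cnj[symmetric])
      (simp add: fourier_def[of g] g_def exp_cnj gaussian_def mult_ac del: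
          Bochner_Integration.integral_cnj)
  then have fourier_g: "norm (fourier g x) \<le> 2 * pi * B" for x
    using norm_integral_fourier_gaussian_wave_le[OF f B e] by simp
  have "(LINT \<xi>|lborel. (norm (fourier f \<xi>))\<^sup>2 * exp (- (e * \<xi>)\<^sup>2 / 2)) \<le>
      norm (LINT \<xi>|lborel. fourier f \<xi> * g \<xi>)"
    unfolding product integral_complex_of_real norm_of_real by simp
  also have "\<dots> \<le> (LINT x|lborel. norm (f x * fourier g x))"
    unfolding integral_fourier_mult[OF f g] by (rule integral_norm_bound)
  also have "\<dots> \<le> (LINT x|lborel. 2 * pi * B * norm (f x))"
    using f order_trans[OF norm_ge_zero B[of 0]] fourier_g
    by (intro integral_mono_AE') (auto simp: norm_mult mult.commute intro!: mult_left_mono)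
  finally show "(LINT \<xi>|lborel. (norm (fourier f \<xi>))\<^sup>2 * exp (- (e * \<xi>)\<^sup>2 / 2)) \<le>
      2 * pi * B * (LINT x|lborel. norm (f x))"
    by simp
qed

theorem nn_integral_norm_fourier_square_le:
  assumes f: "integrable lborel f" and B: "\<And>x. norm (f x) \<le> B"
  shows "(\<integral>\<^sup>+\<xi>. ennreal ((norm (fourier f \<xi>))\<^sup>2) \<partial>lborel) \<le>
      ennreal (2 * pi * B * (LINT x|lborel. norm (f x)))"
proof -
  define e where "e n = inverse (real (Suc n))" for n
  have e: "e n > 0" "e \<longlonglongrightarrow> 0" for n
    unfolding e_def using LIMSEQ_inverse_real_of_nat by auto
  let ?f = "\<lambda>n \<xi>. ennreal ((norm (fourier f \<xi>))\<^sup>2 * exp (- (e n * \<xi>)\<^sup>2 / 2))"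
  note damped = integral_norm_fourier_square_gaussian_le[OF f B e(1)]
  note [measurable] = borel_measurable_integrable[OF f]
  have "(\<lambda>n. ?f n \<xi>) \<longlonglongrightarrow> ennreal ((norm (fourier f \<xi>))\<^sup>2 * exp (- (0 * \<xi>)\<^sup>2 / 2))" for \<xi>
    by (intro tendsto_ennrealI tendsto_intros e) auto
  then have "ennreal ((norm (fourier f \<xi>))\<^sup>2) = liminf (\<lambda>n. ?f n \<xi>)" for \<xi>
    by (subst lim_imp_Liminf) auto
  then have "(\<integral>\<^sup>+\<xi>. ennreal ((norm (fourier f \<xi>))\<^sup>2) \<partial>lborel) \<le> liminf (\<lambda>n. \<integral>\<^sup>+\<xi>. ?f n \<xi> \<partial>lborel)"
    by (simp only:) (rule nn_integral_liminf, measurable)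
  also have "\<dots> \<le> liminf (\<lambda>n::nat. ennreal (2 * pi * B * (LINT x|lborel. norm (f x))))"
    using damped(2) by (intro Liminf_mono always_eventually allI)
      (simp only: nn_integral_eq_integral[OF damped(1)] AE_I2 mult_nonneg_nonneg zero_le_power2
          exp_ge_zero ennreal_leI)
  finally show ?thesis by (simp add: Liminf_const)
qed

section \<open>The Fourier--Plancherel transform and Sobolev norms\<close>

lemma integrable_bounded_imp_L2:
  assumes f: "integrable M f" and B: "\<And>x. norm (f x) \<le> B" shows "f \<in> Lp M 2"
proof -
  have "integrable M (\<lambda>x. (norm (f x))\<^sup>2)"
    by (rule
        Bochner_Integration.integrable_bound[OF integrable_mult_right[OF integrable_norm[OF f], of B]])
       (use f B order_trans[OF norm_ge_zero B]
           in \<open>auto simp: power2_eq_square abs_mult intro!: mult_right_mono\<close>)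
  then show ?thesis using f by (simp add: Lp_2_iff)
qed

lemma finite_exhaustion_lborel: "finite_exhaustion lborel (\<lambda>n. {- real n..real n})"
  unfolding finite_exhaustion_def incseq_def
  by (auto simp: emeasure_lborel_Icc_eq) (meson abs_le_iff minus_le_iff real_arch_simple)

lemma fourier_minus_truncated_fourier:
  assumes f: "integrable lborel f"
  shows "fourier f \<xi> - (LINT x:{- r..r}|lborel. f x * exp (- (\<i> * of_real (x * \<xi>)))) =
    fourier (\<lambda>x. (1 - indicator {- r..r} x) * f x) \<xi>"
proof -
  have "integrable lborel (\<lambda>x. indicator {- r..r} x * f x)"
    by (rule Bochner_Integration.integrable_bound[OF f]) (use f in \<open>auto simp: indicator_def\<close>)
  then have "fourier (\<lambda>x. f x - indicator {- r..r} x * f x) \<xi> =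
      fourier f \<xi> - fourier (\<lambda>x. indicator {- r..r} x * f x) \<xi>"
    by (rule fourier_diff[OF f])
  moreover have "fourier (\<lambda>x. indicator {- r..r} x * f x) \<xi> =
      (LINT x:{- r..r}|lborel. f x * exp (- (\<i> * of_real (x * \<xi>))))"
    unfolding fourier_def set_lebesgue_integral_def
    by (intro Bochner_Integration.integral_cong) (auto simp: indicator_def)
  ultimately show ?thesis by (simp add: left_diff_distrib)
qed

lemma is_plancherel_transform_fourier:
  assumes f: "integrable lborel f" and B: "\<And>x. norm (f x) \<le> B"
  shows "is_plancherel_transform f (\<lambda>\<xi>. complex_of_real (1 / sqrt (2 * pi)) * fourier f \<xi>)"
    (is "is_plancherel_transform f (\<lambda>\<xi>. ?c * fourier f \<xi>)")
  unfolding is_plancherel_transform_def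
proof (intro conjI)
  note [measurable] = borel_measurable_integrable[OF f]
  show "f \<in> Lp lborel 2" by (rule integrable_bounded_imp_L2[OF f B])
  have "integrable lborel (\<lambda>\<xi>. (norm (fourier f \<xi>))\<^sup>2)"
    using nn_integral_norm_fourier_square_le[OF f B]
    by (auto simp: integrable_iff_bounded intro: le_less_trans)
  then show "(\<lambda>\<xi>. ?c * fourier f \<xi>) \<in> Lp lborel 2" by (intro L2_scale) (simp add: Lp_2_iff)
  define tail where "tail n x = (1 - indicator {- real n..real n} x) * f x" for n x
  have norm_tail: "norm (tail n x) \<le> norm (f x)" for n x by (simp add: tail_def indicator_def)
  have tail: "integrable lborel (tail n)" for n
    by (rule Bochner_Integration.integrable_bound[OF f])
      (use norm_tail in \<open>auto simp: tail_def[abs_def]\<close>)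
  have bound:
    "(\<integral>\<^sup>+\<xi>. ennreal ((norm (?c * fourier (tail n) \<xi>))\<^sup>2) \<partial>lborel) \<le>
        ennreal (B * Lp_norm lborel 1 (tail n))" for n
  proof -
    have "(\<integral>\<^sup>+\<xi>. ennreal ((norm (?c * fourier (tail n) \<xi>))\<^sup>2) \<partial>lborel) =
        ennreal (1 / (2 * pi)) * (\<integral>\<^sup>+\<xi>. ennreal ((norm (fourier (tail n) \<xi>))\<^sup>2) \<partial>lborel)"
      using borel_measurable_integrable[OF tail, of n]
      by (subst nn_integral_cmult[symmetric])
         (auto simp: norm_mult norm_divide power_mult_distrib power_divide ennreal_mult[symmetric])
    also have "\<dots> \<le> ennreal (1 / (2 * pi)) * ennreal (2 * pi * B * (LINT x|lborel. norm (tail n x)))"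
      using norm_tail B
      by (intro mult_left_mono nn_integral_norm_fourier_square_le tail) (auto intro: order_trans)
    finally show ?thesis
      using tail by (simp add: ennreal_mult'[symmetric] Lp_norm_1 Lp_1_iff)
  qed
  have "(\<lambda>n. Lp_norm lborel 1 (tail n)) \<longlonglongrightarrow> 0"
    unfolding tail_def
    by (rule L1_norm_tail_tendsto_0[OF _ finite_exhaustion_lborel]) (use f in \<open>simp add: Lp_1_iff\<close>)
  then have "(\<lambda>n. ennreal (B * Lp_norm lborel 1 (tail n))) \<longlonglongrightarrow> ennreal (B * 0)"
    by (intro tendsto_ennrealI tendsto_mult_left)
  then have "(\<lambda>n. \<integral>\<^sup>+\<xi>. ennreal ((norm (?c * fourier (tail n) \<xi>))\<^sup>2) \<partial>lborel) \<longlonglongrightarrow> 0"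
    by (intro tendsto_sandwich[OF _ always_eventually[OF allI[OF bound]] tendsto_const]) auto
  then show "(\<lambda>n. \<integral>\<^sup>+\<xi>. ennreal ((norm (?c * fourier f \<xi> -
      ?c * (LINT x:{- real n..real n}|lborel. f x * exp (- (\<i> * of_real (x * \<xi>))))))\<^sup>2) \<partial>lborel) \<longlonglongrightarrow> 0"
    unfolding right_diff_distrib[symmetric] fourier_minus_truncated_fourier[OF f] tail_def .
qed

lemma is_plancherel_transform_unique:
  assumes G: "is_plancherel_transform F G" and H: "is_plancherel_transform F H"
  shows "AE \<xi> in lborel. G \<xi> = H \<xi>"
proof -
  let ?T = "\<lambda>n \<xi>. complex_of_real (1 / sqrt (2 * pi)) *
      (LINT x:{- real n..real n}|lborel. F x * exp (- (\<i> * of_real (x * \<xi>))))"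
  let ?d = "\<lambda>G n. \<integral>\<^sup>+\<xi>. ennreal ((norm (G \<xi> - ?T n \<xi>))\<^sup>2) \<partial>lborel"
  have [measurable]: "F \<in> borel_measurable borel" "G \<in> borel_measurable borel"
    "H \<in> borel_measurable borel"
    using G H by (auto simp: is_plancherel_transform_def Lp_2_iff)
  have "(\<integral>\<^sup>+\<xi>. ennreal ((norm (G \<xi> - H \<xi>))\<^sup>2) \<partial>lborel) \<le> 2 * ?d G n + 2 * ?d H n" for n
  proof -
    have "(norm (x - y))\<^sup>2 \<le> 2 * (norm (x - z))\<^sup>2 + 2 * (norm (y - z))\<^sup>2" for x y z :: complex
      using norm_add_power2_le[of "x - z" "z - y"] by (simp add: norm_minus_commute)
    then have "ennreal ((norm (G \<xi> - H \<xi>))\<^sup>2) \<le>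
        2 * ennreal ((norm (G \<xi> - ?T n \<xi>))\<^sup>2) + 2 * ennreal ((norm (H \<xi> - ?T n \<xi>))\<^sup>2)" for \<xi>
      by (simp add: ennreal_numeral[symmetric] ennreal_mult[symmetric] ennreal_plus[symmetric]
          ennreal_leI
          del: ennreal_numeral ennreal_plus)
    then have "(\<integral>\<^sup>+\<xi>. ennreal ((norm (G \<xi> - H \<xi>))\<^sup>2) \<partial>lborel) \<le>
        (\<integral>\<^sup>+\<xi>. 2 * ennreal ((norm (G \<xi> - ?T n \<xi>))\<^sup>2) + 2 * ennreal ((norm (H \<xi> - ?T n \<xi>))\<^sup>2) \<partial>lborel)"
      by (rule nn_integral_mono)
    also have "\<dots> = 2 * ?d G n + 2 * ?d H n"
      unfolding set_lebesgue_integral_def by (subst nn_integral_add) (auto simp: nn_integral_cmult)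
    finally show ?thesis .
  qed
  moreover have "(\<lambda>n. 2 * ?d G n + 2 * ?d H n) \<longlonglongrightarrow> 2 * 0 + 2 * 0"
    using G H by (intro tendsto_add ennreal_tendsto_cmult) (auto simp: is_plancherel_transform_def)
  ultimately have "(\<integral>\<^sup>+\<xi>. ennreal ((norm (G \<xi> - H \<xi>))\<^sup>2) \<partial>lborel) \<le> 2 * 0 + 2 * 0"
    by (intro LIMSEQ_le_const) auto
  then show ?thesis by (simp add: nn_integral_0_iff_AE ennreal_eq_0_iff)
qed

lemma plancherel_transform_eq_fourier:
  assumes f: "integrable lborel f" and B: "\<And>x. norm (f x) \<le> B"
  shows "plancherel_transform f \<in> Lp lborel 2"
    and "AE \<xi> in lborel. plancherel_transform f \<xi> =
        complex_of_real (1 / sqrt (2 * pi)) * fourier f \<xi>"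
proof -
  note fourier = is_plancherel_transform_fourier[OF f B]
  then have "is_plancherel_transform f (plancherel_transform f)"
    unfolding plancherel_transform_def by (rule someI[of "is_plancherel_transform f"])
  then show "plancherel_transform f \<in> Lp lborel 2"
    and "AE \<xi> in lborel. plancherel_transform f \<xi> =
        complex_of_real (1 / sqrt (2 * pi)) * fourier f \<xi>"
    using is_plancherel_transform_unique[OF _ fourier] by (auto simp: is_plancherel_transform_def)
qed

lemma sobolev_norm_nonneg: "sobolev_norm s f \<ge> 0"
  unfolding sobolev_norm_def by (auto intro!: integral_nonneg_AE)

lemma
  assumes f: "integrable lborel f" and B: "\<And>x. norm (f x) \<le> B" and s: "f \<in> sobolev_space s"
  shows integrable_sobolev_density:
    "integrable lborel (\<lambda>\<xi>. (1 + \<xi>\<^sup>2) powr s * (norm (fourier f \<xi>))\<^sup>2)"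
    and integral_sobolev_density:
      "(LINT \<xi>|lborel. (1 + \<xi>\<^sup>2) powr s * (norm (fourier f \<xi>))\<^sup>2) = 2 * pi * (sobolev_norm s f)\<^sup>2"
proof -
  let ?d = "\<lambda>\<xi>. (1 + \<xi>\<^sup>2) powr s * (norm (plancherel_transform f \<xi>))\<^sup>2"
  note transform = plancherel_transform_eq_fourier[OF f B]
  note [measurable] = Lp_measurable[OF transform(1)] borel_measurable_integrable[OF f]
  have d: "integrable lborel ?d"
    using s by (intro integrableI_nonneg) (auto simp: sobolev_space_def)
  have density_eq: "AE \<xi> in lborel. 2 * pi * ?d \<xi> = (1 + \<xi>\<^sup>2) powr s * (norm (fourier f \<xi>))\<^sup>2"
    using transform(2)
    by eventually_elim (simp add: norm_mult norm_divide power_mult_distrib power_divide)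
  then show "integrable lborel (\<lambda>\<xi>. (1 + \<xi>\<^sup>2) powr s * (norm (fourier f \<xi>))\<^sup>2)"
    by (rule integrable_cong_AE_imp[OF integrable_mult_right[OF d, of "2 * pi"], rotated]) measurable
  have "(LINT \<xi>|lborel. 2 * pi * ?d \<xi>) = (LINT \<xi>|lborel. (1 + \<xi>\<^sup>2) powr s * (norm (fourier f \<xi>))\<^sup>2)"
    by (rule integral_cong_AE) (use density_eq in auto)
  then show "(LINT \<xi>|lborel. (1 + \<xi>\<^sup>2) powr s * (norm (fourier f \<xi>))\<^sup>2) =
      2 * pi * (sobolev_norm s f)\<^sup>2"
    by (simp add: sobolev_norm_def integral_nonneg_AE)
qed

lemma integrable_one_plus_square_powr:
  assumes q: "q > 1/2" shows "integrable lborel (\<lambda>x::real. (1 + x\<^sup>2) powr (- q))"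
proof -
  define h where "h x = indicator {1..} x * x powr (- 2 * q)" for x :: real
  have [measurable]: "h \<in> borel_measurable borel" unfolding h_def by measurable
  have "((\<lambda>x. x powr (- 2 * q)) has_integral - (1 powr (- 2 * q + 1)) / (- 2 * q + 1)) {1::real..}"
    using q by (intro has_integral_powr_to_inf) auto
  from nn_integral_has_integral_lebesgue'[OF _ this]
  have "(\<integral>\<^sup>+x. ennreal (x powr (- 2 * q)) * indicator {1..} x \<partial>lborel) < \<infinity>" by simp
  also have "(\<integral>\<^sup>+x. ennreal (x powr (- 2 * q)) * indicator {1..} x \<partial>lborel) =
      (\<integral>\<^sup>+x. ennreal (h x) \<partial>lborel)"
    by (intro nn_integral_cong) (auto simp: h_def indicator_def)
  finally have "integrable lborel h" by (intro integrableI_nonneg) (auto simp: h_def)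
  moreover from this have "integrable lborel (\<lambda>x. h (- x))"
    using lborel_integrable_real_affine[of h "- 1" 0] by simp
  ultimately have dominating: "integrable lborel (\<lambda>x. indicator {- 1..1} x + (h x + h (- x)))"
    by (intro Bochner_Integration.integrable_add integrable_real_indicator) auto
  have "(1 + x\<^sup>2) powr (- q) \<le> indicator {- 1..1} x + (h x + h (- x))" for x
  proof (cases "\<bar>x\<bar> \<le> 1")
    case True
    then have "(1 + x\<^sup>2) powr (- q) \<le> indicator {- 1..1} x"
      using powr_mono2'[of "- q" 1 "1 + x\<^sup>2"] q by (auto simp: abs_le_iff)
    also have "\<dots> \<le> \<dots> + (h x + h (- x))" by (simp add: h_def)
    finally show ?thesis .
  next
    case False
    have "(1 + x\<^sup>2) powr (- q) \<le> (\<bar>x\<bar> powr 2) powr (- q)"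
      using False q by (intro powr_mono2') auto
    also have "\<dots> = \<bar>x\<bar> powr (- 2 * q)" by (simp only: powr_powr) simp
    also have "\<dots> \<le> indicator {- 1..1} x + (h x + h (- x))"
      using False by (cases "x \<ge> 0") (auto simp: h_def)
    finally show ?thesis .
  qed
  then show ?thesis
    by (intro Bochner_Integration.integrable_bound[OF dominating])
      (auto intro: order_trans[OF _ abs_ge_self])
qed

lemma one_plus_square_powr_half: "((1 + x\<^sup>2) powr (a / 2))\<^sup>2 = (1 + x\<^sup>2) powr a" for x a :: real
  by (simp add: power2_eq_square powr_add[symmetric])

lemma weighted_L1_norm_le:
  assumes [measurable]: "f \<in> borel_measurable borel" and s: "s > 2 * b + 1/2"
    and f: "integrable lborel (\<lambda>\<xi>. (1 + \<xi>\<^sup>2) powr s * (norm (f \<xi> :: complex))\<^sup>2)"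
  shows "integrable lborel (\<lambda>\<xi>. (1 + \<xi>\<^sup>2) powr b * norm (f \<xi>))"
    and "(LINT \<xi>|lborel. (1 + \<xi>\<^sup>2) powr b * norm (f \<xi>)) \<le>
      sqrt (LINT \<xi>|lborel. (1 + \<xi>\<^sup>2) powr (2 * b - s)) * sqrt (LINT \<xi>|lborel. (1 + \<xi>\<^sup>2) powr s * (norm (f \<xi>))\<^sup>2)"
proof -
  define weighted where "weighted \<xi> = complex_of_real ((1 + \<xi>\<^sup>2) powr (s / 2)) * f \<xi>" for \<xi>
  define weight where "weight \<xi> = complex_of_real ((1 + \<xi>\<^sup>2) powr ((2 * b - s) / 2))" for \<xi> :: real
  have norms: "(norm (weighted \<xi>))\<^sup>2 = (1 + \<xi>\<^sup>2) powr s * (norm (f \<xi>))\<^sup>2"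
      "(norm (weight \<xi>))\<^sup>2 = (1 + \<xi>\<^sup>2) powr (2 * b - s)" for \<xi>
    unfolding weighted_def weight_def norm_mult norm_of_real power_mult_distrib power2_abs
      one_plus_square_powr_half by auto
  have weighted_L2: "weighted \<in> Lp lborel 2" "weight \<in> Lp lborel 2"
    unfolding Lp_2_iff norms using f integrable_one_plus_square_powr[of "s - 2 * b"] s
    by (auto simp: weighted_def[abs_def] weight_def[abs_def])
  have "(1 + \<xi>\<^sup>2) powr (s / 2) * (1 + \<xi>\<^sup>2) powr ((2 * b - s) / 2) = (1 + \<xi>\<^sup>2) powr b" for \<xi>
    unfolding powr_add[symmetric] by (simp add: field_simps)
  then have product: "norm (weighted \<xi>) * norm (weight \<xi>) = (1 + \<xi>\<^sup>2) powr b * norm (f \<xi>)" for \<xi>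
    unfolding weighted_def weight_def norm_mult norm_of_real by (simp add: mult_ac)
  show "integrable lborel (\<lambda>\<xi>. (1 + \<xi>\<^sup>2) powr b * norm (f \<xi>))"
    using integrable_norm[OF L2_integrable_mult[OF weighted_L2]] unfolding norm_mult product .
  show "(LINT \<xi>|lborel. (1 + \<xi>\<^sup>2) powr b * norm (f \<xi>)) \<le>
      sqrt (LINT \<xi>|lborel. (1 + \<xi>\<^sup>2) powr (2 * b - s)) * sqrt (LINT \<xi>|lborel. (1 + \<xi>\<^sup>2) powr s * (norm (f \<xi>))\<^sup>2)"
    using L2_Cauchy_Schwarz_norm[OF weighted_L2]
    unfolding product Lp_norm_2[OF weighted_L2(1)] Lp_norm_2[OF weighted_L2(2)] norms
    by (simp add: mult.commute)
qed

theorem sobolev_imp_weighted_fourier_L1: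
  assumes f: "integrable lborel f" and B: "\<And>x. norm (f x) \<le> B" and "f \<in> sobolev_space s"
    and s: "s > 2 * b + 1/2"
  shows "integrable lborel (\<lambda>\<xi>. (1 + \<xi>\<^sup>2) powr b * norm (fourier f \<xi>))"
    and "(LINT \<xi>|lborel. (1 + \<xi>\<^sup>2) powr b * norm (fourier f \<xi>)) \<le>
      sqrt (2 * pi * (LINT \<xi>|lborel. (1 + \<xi>\<^sup>2) powr (2 * b - s))) * sobolev_norm s f"
proof -
  note density = integrable_sobolev_density[OF assms(1-3)] integral_sobolev_density[OF assms(1-3)]
  note weighted =
    weighted_L1_norm_le[OF fourier_measurable[OF borel_measurable_integrable[OF f]] s density(1)]
  then show "integrable lborel (\<lambda>\<xi>. (1 + \<xi>\<^sup>2) powr b * norm (fourier f \<xi>))"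
    and "(LINT \<xi>|lborel. (1 + \<xi>\<^sup>2) powr b * norm (fourier f \<xi>)) \<le>
      sqrt (2 * pi * (LINT \<xi>|lborel. (1 + \<xi>\<^sup>2) powr (2 * b - s))) * sobolev_norm s f"
    using sobolev_norm_nonneg[of s f] unfolding density(2) by (simp_all add: real_sqrt_mult mult_ac)
qed

lemma powr_mult_exp_minus_le:
  assumes "a > 0" "x \<ge> 0" shows "x powr a * exp (- x) \<le> (a::real) powr a"
proof -
  have "x \<le> a * exp (x / a)" using exp_ge_add_one_self[of "x / a"] assms by (simp add: field_simps)
  then have "x powr a \<le> (a * exp (x / a)) powr a" using assms by (intro powr_mono2) auto
  also have "\<dots> = a powr a * exp x" using assms by (simp add: powr_mult exp_powr_real)
  finally show ?thesis by (simp add: exp_minus field_simps)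
qed

lemma fourier_gamma_kernel:
  assumes "b > 0" "Re p > 0"
  shows "fourier (gamma_kernel b p) \<xi> =
      complex_of_real (Gamma b) * (p + \<i> * of_real \<xi>) powr (- complex_of_real b)"
proof -
  have "gamma_kernel b p x * exp (- (\<i> * of_real (x * \<xi>))) =
      gamma_kernel b (p + \<i> * of_real \<xi>) x" for x
    using gamma_kernel_mult_exp[of b p x "- (\<i> * of_real \<xi>)"] by (simp add: mult_ac)
  then show ?thesis unfolding fourier_def using assms
    by (simp only: integral_gamma_kernel plus_complex.sel Re_i_times Im_complex_of_real minus_zero
        add_0_right)
qed

lemma gamma_kernel_one:
  assumes "b > 1" shows "gamma_kernel b 1 x = complex_of_real (max 0 x powr (b - 1) * exp (- x))"
  by (cases "x > 0") (auto simp: gamma_kernel_def max_def exp_of_real[symmetric])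

lemma
  assumes b: "b > 1"
  shows norm_fourier_gamma_kernel_one:
    "norm (fourier (gamma_kernel b 1) \<xi>) = Gamma b * (1 + \<xi>\<^sup>2) powr (- (b / 2))"
    and integrable_fourier_gamma_kernel_one: "integrable lborel (fourier (gamma_kernel b 1))"
    and integral_fourier_gamma_kernel_one:
      "(LINT \<xi>|lborel. fourier (gamma_kernel b 1) \<xi> * exp (\<i> * of_real (u * \<xi>))) =
          2 * pi * gamma_kernel b 1 u"
proof -
  have "norm (1 + \<i> * complex_of_real \<xi>) = (1 + \<xi>\<^sup>2) powr (1/2)" for \<xi>
    by (simp add: cmod_def powr_half_sqrt add_nonneg_nonneg)
  then show norm_eq:
    "norm (fourier (gamma_kernel b 1) \<xi>) = Gamma b * (1 + \<xi>\<^sup>2) powr (- (b / 2))" for \<xi>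
    using b
    by (simp add: fourier_gamma_kernel norm_mult norm_powr_real_powr' powr_powr Gamma_real_nonneg
        del: Gamma_complex_of_real)
  show integrable_fourier: "integrable lborel (fourier (gamma_kernel b 1))"
    by (rule
        Bochner_Integration.integrable_bound[OF
            integrable_mult_right[OF integrable_one_plus_square_powr[of "b / 2"], of "Gamma b"]])
       (use b in \<open>auto simp: norm_eq fourier_measurable\<close>)
  have "continuous_on UNIV (gamma_kernel b 1)"
    unfolding gamma_kernel_one[OF b, abs_def] using b
    by (intro continuous_intros continuous_on_powr') auto
  moreover have "norm (gamma_kernel b 1 x) \<le> (b - 1) powr (b - 1)" for x
    using powr_mult_exp_minus_le[of "b - 1" x] b by (auto simp: norm_gamma_kernel indicator_def)
  ultimately show "(LINT \<xi>|lborel. fourier (gamma_kernel b 1) \<xi> * exp (\<i> * of_real (u * \<xi>))) =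
      2 * pi * gamma_kernel b 1 u"
    using b
    by (intro fourier_inversion[of _ _ "(b - 1) powr (b - 1)"] integrable_fourier
        integrable_gamma_kernel)
       (auto simp: continuous_on_eq_continuous_at)
qed

lemma gamma_kernel_convolution_exp:
  assumes u: "u \<le> 0"
  shows "gamma_kernel 1 1 (- z) * gamma_kernel b 1 (u - z) =
      of_real (exp u) * gamma_kernel b 2 (u - z)"
  using u by (auto simp: gamma_kernel_def indicator_def exp_of_real[symmetric] exp_add[symmetric])

lemma integral_fourier_exp_mult_gamma_kernel:
  assumes b: "b > 1" and u: "u \<le> 0"
  shows "(LINT \<omega>|lborel. fourier (\<lambda>z. gamma_kernel 1 1 (- z)) \<omega> *
      (fourier (gamma_kernel b 1) \<omega> * exp (\<i> * of_real (u * \<omega>)))) =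
    of_real (2 * pi * Gamma b * 2 powr (- b) * exp u)"
proof -
  have exp_integrable: "integrable lborel (\<lambda>z. gamma_kernel 1 1 (- z))"
    using lborel_integrable_real_affine[OF integrable_gamma_kernel[of 1 1], of "- 1" 0] by simp
  have fourier_twice:
    "fourier (\<lambda>\<omega>. fourier (gamma_kernel b 1) \<omega> * exp (\<i> * of_real (u * \<omega>))) z =
        2 * pi * gamma_kernel b 1 (u - z)" for z
    using integral_fourier_gamma_kernel_one[OF b, of "u - z"]
    unfolding fourier_mult_character fourier_def[of "fourier _"] by (simp add: algebra_simps)
  have "(LINT \<omega>|lborel. fourier (\<lambda>z. gamma_kernel 1 1 (- z)) \<omega> *
      (fourier (gamma_kernel b 1) \<omega> * exp (\<i> * of_real (u * \<omega>)))) =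
      (LINT z|lborel. gamma_kernel 1 1 (- z) * (2 * pi * gamma_kernel b 1 (u - z)))"
    unfolding fourier_twice[symmetric]
    by (intro integral_fourier_mult exp_integrable integrable_mult_unimodular
        integrable_fourier_gamma_kernel_one b) auto
  also have "\<dots> = (LINT z|lborel. 2 * pi * of_real (exp u) * gamma_kernel b 2 (u + (- 1) * z))"
    using gamma_kernel_convolution_exp[OF u, of _ b] by (simp add: mult_ac)
  also have "\<dots> = 2 * pi * of_real (exp u) * (LINT y|lborel. gamma_kernel b (of_real 2) y)"
    using lborel_integral_real_affine[of "- 1" "gamma_kernel b 2" u] by simp
  also have "\<dots> = of_real (2 * pi * Gamma b * 2 powr (- b) * exp u)"
    using b by (subst integral_gamma_kernel_of_real) auto
  finally show ?thesis .
qed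

text \<open>Convolving \<open>exp\<close>, cut off on a half line, with a Gamma density leaves it unchanged there up to a factor,
  and gives it as many derivatives as one likes.\<close>
theorem exp_eq_fourier_integral_atMost_1:
  assumes a: "a \<ge> 0"
  obtains h where "h \<in> borel_measurable borel"
    "integrable lborel (\<lambda>\<omega>. (1 + \<omega>\<^sup>2) powr a * norm (h \<omega>))"
    and "\<And>u. u \<le> 1 \<Longrightarrow> (LINT \<omega>|lborel. h \<omega> * exp (\<i> * of_real (u * \<omega>))) = complex_of_real (exp u)"
proof -
  define b where "b = 2 * a + 2"
  have b: "b > 1" using a by (simp add: b_def)
  let ?E = "fourier (\<lambda>z. gamma_kernel 1 1 (- z))" and ?g = "fourier (gamma_kernel b 1)"
  define c where "c = 2 * pi * Gamma b * 2 powr (- b)"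
  have c_pos: "c > 0" unfolding c_def using b by (auto intro!: mult_pos_pos Gamma_real_pos)
  define h where "h \<omega> = of_real (exp 1 / c) * (?E \<omega> * (?g \<omega> * exp (\<i> * of_real (- 1 * \<omega>))))" for \<omega>
  have [measurable]: "?E \<in> borel_measurable borel" "?g \<in> borel_measurable borel"
    by (auto intro!: fourier_measurable)
  have h: "h \<in> borel_measurable borel" unfolding h_def by measurable
  have "norm (?E \<omega>) \<le> 1" for \<omega>
    using norm_fourier_le[of "\<lambda>z. gamma_kernel 1 1 (- z)" \<omega>] integral_norm_gamma_kernel[of 1 1]
      lborel_integral_real_affine[of "- 1" "\<lambda>x. norm (gamma_kernel 1 1 x)" 0] by simp
  moreover have "norm (h \<omega>) =
      exp 1 / c * norm (?E \<omega>) * (Gamma b * (1 + \<omega>\<^sup>2) powr (- (b / 2)))" for \<omega>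
    using c_pos by (simp add: h_def norm_mult norm_divide norm_fourier_gamma_kernel_one[OF b])
  moreover have "(1 + \<omega>\<^sup>2) powr a * (1 + \<omega>\<^sup>2) powr (- (b / 2)) = (1 + \<omega>\<^sup>2) powr (- 1)" for \<omega>
    unfolding powr_add[symmetric] by (simp add: b_def field_simps)
  ultimately have "(1 + \<omega>\<^sup>2) powr a * norm (h \<omega>) \<le> exp 1 / c * Gamma b * (1 + \<omega>\<^sup>2) powr (- 1)" for \<omega>
    using c_pos b mult_right_mono[of "norm (?E \<omega>)" 1 "exp 1 / c * Gamma b * (1 + \<omega>\<^sup>2) powr (- 1)"]
    by (simp add: Gamma_real_nonneg mult_ac)
  then have weighted: "integrable lborel (\<lambda>\<omega>. (1 + \<omega>\<^sup>2) powr a * norm (h \<omega>))"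
    using h b c_pos
    by (intro
        Bochner_Integration.integrable_bound[OF
            integrable_mult_right[OF integrable_one_plus_square_powr[of 1], of "exp 1 / c * Gamma b"]])
       (auto simp: abs_mult Gamma_real_nonneg)
  have "(LINT \<omega>|lborel. h \<omega> * exp (\<i> * of_real (u * \<omega>))) = complex_of_real (exp u)"
    if u: "u \<le> 1" for u
  proof -
    have "h \<omega> * exp (\<i> * of_real (u * \<omega>)) =
        of_real (exp 1 / c) * (?E \<omega> * (?g \<omega> * exp (\<i> * of_real ((u - 1) * \<omega>))))" for \<omega>
      unfolding h_def mult.assoc exp_add[symmetric] by (simp add: algebra_simps)
    then have "(LINT \<omega>|lborel. h \<omega> * exp (\<i> * of_real (u * \<omega>))) =
        of_real (exp 1 / c) * of_real (c * exp (u - 1))"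
      using integral_fourier_exp_mult_gamma_kernel[OF b, of "u - 1"] u by (simp add: c_def)
    also have "\<dots> = complex_of_real (exp u)" using c_pos by (simp add: exp_diff)
    finally show ?thesis .
  qed
  then show thesis using that h weighted by blast
qed

section \<open>Countable covers of metric measure spaces\<close>

lemma ball_subset_ball_if_dist_add_le:
  assumes "dist x y + r \<le> s" shows "ball x r \<subseteq> ball y s"
proof
  fix w assume "w \<in> ball x r"
  then show "w \<in> ball y s" using assms dist_triangle[of y w x] by (simp add: dist_commute)
qed

definition separated :: "real \<Rightarrow> 'a::metric_space set \<Rightarrow> bool" where
  "separated e Z \<longleftrightarrow> (\<forall>x\<in>Z. \<forall>y\<in>Z. x \<noteq> y \<longrightarrow> e \<le> dist x y)"

lemma separated_subset: "separated e Z \<Longrightarrow> Y \<subseteq> Z \<Longrightarrow> separated e Y"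
  by (auto simp: separated_def)

lemma separated_imp_disjoint_balls:
  assumes "separated e Z" shows "disjoint_family_on (\<lambda>z. ball z (e / 2)) Z"
proof -
  have "dist x y < e" if "w \<in> ball x (e / 2)" "w \<in> ball y (e / 2)" for x y w
    using that dist_triangle2[of x y w] by (simp add: dist_commute)
  then show ?thesis using assms by (fastforce simp: separated_def disjoint_family_on_def)
qed

lemma maximal_separated_subset:
  assumes e: "e > 0"
  obtains Z where "Z \<subseteq> S" "separated e Z" "\<And>x. x \<in> S \<Longrightarrow> \<exists>z\<in>Z. dist z x < e"
proof -
  define \<A> where "\<A> = {Z. Z \<subseteq> S \<and> separated e Z}"
  have "\<exists>M\<in>\<A>. \<forall>X\<in>\<A>. M \<subseteq> X \<longrightarrow> X = M"
  proof (rule subset_Zorn')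
    fix \<C> assume "subset.chain \<A> \<C>"
    then have sub: "\<C> \<subseteq> \<A>" and lin: "\<And>X Y. X \<in> \<C> \<Longrightarrow> Y \<in> \<C> \<Longrightarrow> X \<subseteq> Y \<or> Y \<subseteq> X"
      by (auto simp: subset.chain_def)
    have "e \<le> dist x y" if "X \<in> \<C>" "Y \<in> \<C>" "x \<in> X" "y \<in> Y" "x \<noteq> y" for x y X Y
      using lin[OF that(1,2)] that sub unfolding \<A>_def separated_def by blast
    then show "\<Union>\<C> \<in> \<A>" using sub unfolding \<A>_def separated_def by blast
  qed
  then obtain Z where Z: "Z \<in> \<A>" and max: "\<And>X. X \<in> \<A> \<Longrightarrow> Z \<subseteq> X \<Longrightarrow> X = Z" by blast
  have "\<exists>z\<in>Z. dist z x < e" if x: "x \<in> S" for x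
  proof (rule ccontr)
    assume far: "\<not> (\<exists>z\<in>Z. dist z x < e)"
    then have "insert x Z \<in> \<A>" using Z x by (auto simp: \<A>_def separated_def dist_commute not_less)
    with max have "x \<in> Z" by blast
    with far e show False by fastforce
  qed
  with Z show thesis by (intro that[of Z]) (auto simp: \<A>_def)
qed

lemma countable_disjoint_positive_measure:
  assumes W: "W \<in> fmeasurable \<mu>" and A: "\<And>z. z \<in> Z \<Longrightarrow> A z \<in> sets \<mu>" "\<And>z. z \<in> Z \<Longrightarrow> A z \<subseteq> W"
    and pos: "\<And>z. z \<in> Z \<Longrightarrow> 0 < emeasure \<mu> (A z)" and disjoint: "disjoint_family_on A Z"
  shows "countable Z"
proof -
  have A_fin: "A z \<in> fmeasurable \<mu>" if "z \<in> Z" for z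
    by (rule fmeasurableI2[OF W A(2)[OF that] A(1)[OF that]])
  have "(\<Sum>z\<in>F. measure \<mu> (A z)) \<le> measure \<mu> W" if F: "finite F" "F \<subseteq> Z" for F
  proof -
    have "(\<Sum>z\<in>F. measure \<mu> (A z)) = measure \<mu> (\<Union>z\<in>F. A z)"
      using F A_fin disjoint_family_on_mono[OF F(2) disjoint]
      by (intro measure_finite_Union[symmetric]) (auto simp: fmeasurable_def less_top)
    also have "\<dots> \<le> measure \<mu> W"
      using F A W by (intro measure_mono_fmeasurable) (auto intro!: sets.finite_UN)
    finally show ?thesis .
  qed
  then have "(\<lambda>z. measure \<mu> (A z)) summable_on Z"
    by (intro nonneg_bdd_above_summable_on bdd_aboveI2[of _ _ "measure \<mu> W"]) auto
  then have "countable {z \<in> Z. measure \<mu> (A z) \<noteq> 0}" by (rule summable_countable_real)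
  moreover have "measure \<mu> (A z) \<noteq> 0" if "z \<in> Z" for z
    using pos[OF that] A_fin[OF that] by (simp add: emeasure_eq_measure2)
  then have "{z \<in> Z. measure \<mu> (A z) \<noteq> 0} = Z" by auto
  ultimately show ?thesis by simp
qed

locale metric_measure =
  fixes \<mu> :: "'a::metric_space measure"
  assumes metric_measure_space: "metric_measure_space \<mu>"
begin

lemma sets_mu[simp, measurable_cong]: "sets \<mu> = sets borel"
  and ball_finite: "0 < r \<Longrightarrow> emeasure \<mu> (ball x r) < \<infinity>"
  and AE_ball_pos: "AE x in \<mu>. \<forall>r>0. 0 < emeasure \<mu> (ball x r)"
  using metric_measure_space by (auto simp: metric_measure_space_def)

lemma ball_fmeasurable: "0 < r \<Longrightarrow> ball x r \<in> fmeasurable \<mu>"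
  using ball_finite by (auto simp: fmeasurable_def)

lemma sigma_finite_mu: "sigma_finite_measure \<mu>"
proof
  let ?A = "range (\<lambda>n::nat. ball (undefined::'a) (real (Suc n)))"
  have "\<exists>n. x \<in> ball undefined (real (Suc n))" for x :: 'a
  proof -
    obtain n where "dist undefined x < real n" using reals_Archimedean2 by blast
    then show ?thesis by (intro exI[of _ n]) simp
  qed
  then have "\<Union>?A = UNIV" by blast
  moreover have "space \<mu> = UNIV" using sets_eq_imp_space_eq[OF sets_mu] by simp
  ultimately show "\<exists>A. countable A \<and> A \<subseteq> sets \<mu> \<and> \<Union>A = space \<mu> \<and> (\<forall>a\<in>A. emeasure \<mu> a \<noteq> \<infinity>)"
    using ball_finite by (intro exI[of _ ?A]) (force simp: less_top)
qed

lemma countable_separated: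
  assumes Z: "separated e Z" and e: "e > 0"
    and pos: "\<And>z r. z \<in> Z \<Longrightarrow> r > 0 \<Longrightarrow> 0 < emeasure \<mu> (ball z r)"
  shows "countable Z"
proof -
  have "countable (Z \<inter> ball undefined (real n))" for n
  proof (rule countable_disjoint_positive_measure)
    show "ball undefined (real n + e) \<in> fmeasurable \<mu>" using e by (intro ball_fmeasurable) simp
    show "disjoint_family_on (\<lambda>z. ball z (e / 2)) (Z \<inter> ball undefined (real n))"
      by (intro separated_imp_disjoint_balls separated_subset[OF Z]) auto
    fix z assume z: "z \<in> Z \<inter> ball undefined (real n)"
    then show "0 < emeasure \<mu> (ball z (e / 2))" using pos e by simp
    show "ball z (e / 2) \<subseteq> ball undefined (real n + e)"
      using z e by (intro ball_subset_ball_if_dist_add_le) (simp add: dist_commute)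
  qed simp
  then have "countable (\<Union>n. Z \<inter> ball undefined (real n))" by (intro countable_UN) auto
  moreover have "Z \<subseteq> (\<Union>n. Z \<inter> ball undefined (real n))" using reals_Archimedean2 by auto
  ultimately show ?thesis by (rule countable_subset[rotated])
qed

lemma AE_countable_cover:
  assumes e: "e > 0"
  obtains Z where "countable Z" "AE x in \<mu>. \<exists>z\<in>Z. dist z x < e"
proof -
  define S where "S = {x. \<forall>r>0. 0 < emeasure \<mu> (ball x r)}"
  obtain Z where Z: "Z \<subseteq> S" "separated e Z" "\<And>x. x \<in> S \<Longrightarrow> \<exists>z\<in>Z. dist z x < e"
    using maximal_separated_subset[OF e] by blast
  then have "countable Z" using e by (intro countable_separated) (auto simp: S_def)
  moreover have "AE x in \<mu>. \<exists>z\<in>Z. dist z x < e"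
    using AE_ball_pos Z(3) by (auto simp: S_def elim!: eventually_mono)
  ultimately show thesis by (rule that)
qed

end

section \<open>Finite propagation speed\<close>

locale metric_operator_calculus = operator_calculus \<mu> D L + metric_measure \<mu>
  for \<mu> :: "'a::metric_space measure" and D L
begin

definition propagates :: "real \<Rightarrow> (real \<Rightarrow> complex) \<Rightarrow> bool" where
  "propagates r F \<longleftrightarrow> (\<forall>x1 r1 x2 r2. setdist (ball x1 r1) (ball x2 r2) > r \<longrightarrow>
     (\<forall>f\<in>Lp \<mu> 2. \<forall>g\<in>Lp \<mu> 2. (\<forall>x. x \<notin> ball x1 r1 \<longrightarrow> f x = 0) \<longrightarrow> (\<forall>x. x \<notin> ball x2 r2 \<longrightarrow> g x = 0) \<longrightarrow>
        form (half_line F) f g = 0))"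

lemma propagatesD:
  assumes "propagates r F" "setdist (ball y e) (ball z e') > r" "f \<in> Lp \<mu> 2" "g \<in> Lp \<mu> 2"
    and "\<And>x. x \<notin> ball y e \<Longrightarrow> f x = 0" "\<And>x. x \<notin> ball z e' \<Longrightarrow> g x = 0"
  shows "form (half_line F) f g = 0"
  using assms unfolding propagates_def by blast

lemma setdist_ball_gt:
  assumes e: "e > 0" and far_apart: "r + 3 * e \<le> dist y z"
  shows "setdist (ball y e) (ball z e) > r"
proof -
  have "r + e \<le> setdist (ball y e) (ball z e)"
  proof (rule le_setdistI)
    fix x x' assume "x \<in> ball y e" "x' \<in> ball z e"
    then show "r + e \<le> dist x x'"
      using far_apart dist_triangle[of y z x] dist_triangle[of x z x'] by (simp add: dist_commute)
  qed (use e in auto)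
  then show ?thesis using e by simp
qed

lemma propagates_mono: "propagates r F \<Longrightarrow> r \<le> r' \<Longrightarrow> propagates r' F"
  unfolding propagates_def by (meson le_less_trans)

lemma propagates_zero: "propagates r (\<lambda>u. 0)"
  by (simp add: propagates_def half_line_def form_def)

lemma propagates_scale: "propagates r F \<Longrightarrow> propagates r (\<lambda>u. c * F u)"
  by (simp add: propagates_def half_line_scale form_scale)

lemma propagates_superposition:
  fixes G :: "'i \<Rightarrow> real \<Rightarrow> complex"
  assumes N: "sigma_finite_measure N"
    and G: "(\<lambda>(v, u). G v u) \<in> borel_measurable (N \<Otimes>\<^sub>M borel)"
    and w: "integrable N w" and G_le: "\<And>v u. v \<in> space N \<Longrightarrow> 0 \<le> u \<Longrightarrow> norm (G v u) \<le> w v"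
    and F: "\<And>u. 0 \<le> u \<Longrightarrow> F u = (LINT v|N. G v u)"
    and propagates: "\<And>v. v \<in> space N \<Longrightarrow> propagates r (G v)"
  shows "propagates r F"
  unfolding propagates_def
proof (intro allI impI ballI)
  fix x1 r1 x2 r2 f g assume far_apart: "setdist (ball x1 r1) (ball x2 r2) > r" and f: "f \<in> Lp \<mu> 2"
    and g: "g \<in> Lp \<mu> 2"
    and support: "\<forall>x. x \<notin> ball x1 r1 \<longrightarrow> f x = 0" "\<forall>x. x \<notin> ball x2 r2 \<longrightarrow> g x = 0"
  have "form (half_line F) f g = (LINT v|N. form (half_line (G v)) f g)"
    using form_half_line_superposition(2)[OF N G w _ _ f g] G_le F by blast
  also have "\<dots> = (LINT v|N. 0)"
    using support
    by (intro Bochner_Integration.integral_cong refl propagatesD[OF propagates far_apart f g]) auto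
  finally show "form (half_line F) f g = 0" by simp
qed

lemma propagates_cnj:
  assumes F: "propagates r F" and b: "bounded_borel (half_line F)"
  shows "propagates r (\<lambda>u. cnj (F u))"
  unfolding propagates_def half_line_cnj
proof (intro allI impI ballI)
  fix x1 r1 x2 r2 f g assume "setdist (ball x1 r1) (ball x2 r2) > r"
    and fg: "f \<in> Lp \<mu> 2" "g \<in> Lp \<mu> 2" "\<forall>x. x \<notin> ball x1 r1 \<longrightarrow> f x = 0" "\<forall>x. x \<notin> ball x2 r2 \<longrightarrow> g x = 0"
  then have "form (half_line F) g f = 0"
    by (intro propagatesD[OF F, of x2 r2 x1 r1]) (auto simp: setdist_sym)
  then show "form (\<lambda>u. cnj (half_line F u)) f g = 0" using form_cnj[OF b fg(2,1)] by simp
qed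

lemma fc_vanishes_on_far_ball:
  assumes F: "propagates r F" "bounded_borel (half_line F)" and e: "e > 0"
    and far_apart: "r + 3 * e \<le> dist y z"
    and f: "f \<in> Lp \<mu> 2" "\<And>x. x \<notin> ball y e \<Longrightarrow> f x = 0"
  shows "AE x in \<mu>. x \<in> ball z e \<longrightarrow> fc F f x = 0"
proof (rule AE_zero_on_if_L2_orthogonal_restriction[OF fc_L2[OF F(2) f(1)]])
  have restriction_L2: "(\<lambda>x. indicator (ball z e) x * fc F f x) \<in> Lp \<mu> 2"
    by (intro Lp_indicator fc_L2 F f) simp
  show "L2_inner \<mu> (fc F f) (\<lambda>x. indicator (ball z e) x * fc F f x) = 0"
    unfolding fc_inner[OF F(2) f(1) restriction_L2]
    by (rule propagatesD[OF F(1) setdist_ball_gt[OF e far_apart] f(1) restriction_L2 f(2)]) auto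
qed simp

lemma fc_vanishes_outside_ball:
  assumes F: "propagates r F" "bounded_borel (half_line F)" and e: "e > 0"
    and f: "f \<in> Lp \<mu> 2" "\<And>x. x \<notin> ball y e \<Longrightarrow> f x = 0"
  shows "AE x in \<mu>. x \<notin> ball y (r + 4 * e) \<longrightarrow> fc F f x = 0"
proof -
  obtain Z where Z: "countable Z" "AE x in \<mu>. \<exists>z\<in>Z. dist z x < e" using AE_countable_cover[OF e] .
  have "AE x in \<mu>. x \<in> ball z e \<longrightarrow> fc F f x = 0" if "r + 3 * e \<le> dist y z" for z
    by (rule fc_vanishes_on_far_ball[OF F e that f(1)]) (rule f(2))
  then have "AE x in \<mu>. \<forall>z\<in>{z\<in>Z. r + 3 * e \<le> dist y z}. x \<in> ball z e \<longrightarrow> fc F f x = 0"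
    by (subst AE_ball_countable) (use Z(1) in auto)
  with Z(2) show ?thesis
  proof eventually_elim
    case (elim x)
    then obtain z where z: "z \<in> Z" "dist z x < e" by blast
    show ?case
    proof
      assume "x \<notin> ball y (r + 4 * e)"
      then have "r + 3 * e \<le> dist y z" using z(2) dist_triangle[of y x z] by simp
      then show "fc F f x = 0" using elim(2)[rule_format, of z] z by simp
    qed
  qed
qed

lemma fc_vanishes_inside_ball:
  assumes F: "propagates r F" "bounded_borel (half_line F)" and e: "e > 0"
    and g: "g \<in> Lp \<mu> 2" "\<And>x. x \<in> ball z (r + 4 * e) \<Longrightarrow> g x = 0"
  shows "AE x in \<mu>. x \<in> ball z e \<longrightarrow> fc F g x = 0"
proof (rule AE_zero_on_if_L2_orthogonal_restriction[OF fc_L2[OF F(2) g(1)]])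
  let ?F' = "\<lambda>u. cnj (F u)" and ?h = "\<lambda>x. indicator (ball z e) x * fc F g x"
  have h: "?h \<in> Lp \<mu> 2" by (intro Lp_indicator fc_L2 F g) simp
  have F': "propagates r ?F'" "bounded_borel (half_line ?F')"
    using F by (auto simp: propagates_cnj half_line_cnj bounded_borel_cnj)
  have "AE x in \<mu>. x \<notin> ball z (r + 4 * e) \<longrightarrow> fc ?F' ?h x = 0"
    by (rule fc_vanishes_outside_ball[OF F' e h]) auto
  then have "AE x in \<mu>. g x * cnj (fc ?F' ?h x) = 0" by eventually_elim (use g(2) in auto)
  then have "L2_inner \<mu> g (fc ?F' ?h) = 0" unfolding L2_inner_def by (rule integral_eq_zero_AE)
  then show "L2_inner \<mu> (fc F g) ?h = 0" by (simp only: fc_adjoint[OF F(2) g(1) h])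
qed simp

lemma L2_norm_restriction_le:
  assumes A: "A \<in> fmeasurable \<mu>" and g: "g \<in> Lp \<mu> 2" and B: "AE x in \<mu>. norm (g x) \<le> B" "B \<ge> 0"
  shows "Lp_norm \<mu> 2 (\<lambda>x. indicator A x * g x) \<le> B * sqrt (measure \<mu> A)"
proof -
  have h: "(\<lambda>x. indicator A x * g x) \<in> Lp \<mu> 2" using A g by (intro Lp_indicator) auto
  have "(LINT x|\<mu>. (norm (indicator A x * g x))\<^sup>2) \<le> (LINT x|\<mu>. B\<^sup>2 * indicator A x)"
  proof (rule integral_mono_AE)
    show "integrable \<mu> (\<lambda>x. (norm (indicator A x * g x))\<^sup>2)" using h by (simp add: Lp_2_iff)
    show "integrable \<mu> (\<lambda>x. B\<^sup>2 * indicator A x)" using A by (auto simp: fmeasurable_def)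
    show "AE x in \<mu>. (norm (indicator A x * g x))\<^sup>2 \<le> B\<^sup>2 * indicator A x"
      using B(1) by eventually_elim (auto simp: indicator_def intro: power_mono)
  qed
  also have "\<dots> = B\<^sup>2 * measure \<mu> A" using A by (simp add: fmeasurable_def)
  finally show ?thesis
    unfolding Lp_norm_2[OF h] using B(2)
    by (metis real_sqrt_abs abs_of_nonneg real_sqrt_le_iff real_sqrt_mult)
qed

text \<open>Near \<open>z\<close> only the restriction of \<open>g\<close> to a ball of radius less than \<open>2 r\<close> is seen, and its
  \<open>L\<^sup>2\<close> norm is at most \<open>B\<close> times the square root of the volume in the hypothesis.\<close>
lemma fc_locally_bounded:
  assumes F: "propagates r F" "bounded_borel (half_line F)" and r: "r > 0" and M: "M \<ge> 0"
    and diagonal: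
      "\<And>h. h \<in> Lp \<mu> 2 \<Longrightarrow> AE x in \<mu>. sqrt (vol \<mu> (2 * r) x) * norm (fc F h x) \<le> M * Lp_norm \<mu> 2 h"
    and e: "e > 0" "5 * e \<le> r" and g: "g \<in> Lp \<mu> 2" "AE x in \<mu>. norm (g x) \<le> B" "B \<ge> 0"
  shows "AE x in \<mu>. x \<in> ball z e \<longrightarrow> norm (fc F g x) \<le> M * B"
proof -
  define A where "A = ball z (r + 4 * e)"
  have A: "A \<in> fmeasurable \<mu>" using r e unfolding A_def by (intro ball_fmeasurable) simp
  define near where "near x = indicator A x * g x" for x
  define far where "far x = indicator (- A) x * g x" for x
  have parts_L2: "near \<in> Lp \<mu> 2" "far \<in> Lp \<mu> 2"
    unfolding near_def far_def A_def by (auto intro!: Lp_indicator g)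
  have "(\<lambda>x. near x + far x) = g" by (auto simp: near_def far_def indicator_def)
  with linear_op_add[OF fc_linear[OF F(2)] parts_L2]
  have split: "AE x in \<mu>. fc F g x = fc F near x + fc F far x" by simp
  have far: "AE x in \<mu>. x \<in> ball z e \<longrightarrow> fc F far x = 0"
    by (rule fc_vanishes_inside_ball[OF F e(1) parts_L2(2)]) (simp add: far_def A_def)
  have near: "Lp_norm \<mu> 2 near \<le> B * sqrt (measure \<mu> A)"
    unfolding near_def by (rule L2_norm_restriction_le[OF A g])
  from diagonal[OF parts_L2(1)] split far AE_ball_pos show ?thesis
  proof eventually_elim
    case (elim x)
    show ?case
    proof
      assume x: "x \<in> ball z e"
      have V: "ball x (2 * r) \<in> fmeasurable \<mu>" using r by (intro ball_fmeasurable) simp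
      have "0 < emeasure \<mu> (ball x (2 * r))" using elim(4) r by simp
      then have pos: "0 < sqrt (vol \<mu> (2 * r) x)"
        using V by (simp add: vol_def emeasure_eq_measure2)
      have "A \<subseteq> ball x (2 * r)"
        unfolding A_def using x e by (intro ball_subset_ball_if_dist_add_le) simp
      then have "sqrt (measure \<mu> A) \<le> sqrt (vol \<mu> (2 * r) x)"
        unfolding vol_def using A V by (intro real_sqrt_le_mono measure_mono_fmeasurable) auto
      then have "M * Lp_norm \<mu> 2 near \<le> M * (B * sqrt (vol \<mu> (2 * r) x))"
        using near g(3) by (intro mult_left_mono[OF _ M] order_trans[OF near] mult_left_mono)
      then have "sqrt (vol \<mu> (2 * r) x) * norm (fc F near x) \<le> sqrt (vol \<mu> (2 * r) x) * (M * B)"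
        using elim(1) by (simp add: mult_ac)
      then have "norm (fc F near x) \<le> M * B" using pos by simp
      then show "norm (fc F g x) \<le> M * B" using elim(2,3) x by simp
    qed
  qed
qed

lemma fc_AE_bounded:
  assumes F: "propagates r F" "bounded_borel (half_line F)" and r: "r > 0" and M: "M \<ge> 0"
    and diagonal:
      "\<And>h. h \<in> Lp \<mu> 2 \<Longrightarrow> AE x in \<mu>. sqrt (vol \<mu> (2 * r) x) * norm (fc F h x) \<le> M * Lp_norm \<mu> 2 h"
    and g: "g \<in> Lp \<mu> 2" "AE x in \<mu>. norm (g x) \<le> B" "B \<ge> 0"
  shows "AE x in \<mu>. norm (fc F g x) \<le> M * B"
proof -
  have e: "r / 5 > 0" using r by simp
  obtain Z where Z: "countable Z" "AE x in \<mu>. \<exists>z\<in>Z. dist z x < r / 5"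
    using AE_countable_cover[OF e] .
  have "AE x in \<mu>. \<forall>z\<in>Z. x \<in> ball z (r / 5) \<longrightarrow> norm (fc F g x) \<le> M * B"
    unfolding AE_ball_countable[OF Z(1)] using fc_locally_bounded[OF F r M diagonal e _ g] by simp
  with Z(2) show ?thesis by eventually_elim auto
qed

theorem L1_Linfinity_bounded_if_propagates:
  assumes F: "propagates r F" "bounded_borel (half_line F)" and real: "\<And>u. cnj (F u) = F u"
    and r: "r > 0" and M: "M \<ge> 0"
    and diagonal:
      "\<And>h. h \<in> Lp \<mu> 2 \<Longrightarrow> AE x in \<mu>. sqrt (vol \<mu> (2 * r) x) * norm (fc F h x) \<le> M * Lp_norm \<mu> 2 h"
  shows "L1_Linfinity_bounded F M"
  unfolding L1_Linfinity_bounded_def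
proof (intro conjI ballI F(2))
  fix f g assume f: "f \<in> Lp \<mu> 2 \<inter> Lp \<mu> 1" and g: "g \<in> Lp \<mu> 2 \<inter> Lp \<mu> \<infinity>"
  have Fg: "fc F g \<in> borel_measurable \<mu>" "AE x in \<mu>. norm (fc F g x) \<le> M * Lp_norm \<mu> \<infinity> g"
    using f g fc_AE_bounded[OF F r M diagonal _ AE_norm_le_Lp_norm_infinity Lp_norm_nonneg]
    by (auto intro: Lp_measurable[OF fc_L2[OF F(2)]])
  have "norm (LINT x|\<mu>. f x * cnj (fc F g x)) \<le> Lp_norm \<mu> 1 f * Lp_norm \<mu> \<infinity> (fc F g)"
    using f Lp_infinityI[OF Fg] L1_Linfinity_Holder[of f \<mu> "\<lambda>x. cnj (fc F g x)"]
    by (simp add: Lp_cnj)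
  also have "\<dots> \<le> Lp_norm \<mu> 1 f * (M * Lp_norm \<mu> \<infinity> g)"
    using M by (intro mult_left_mono Lp_norm_infinity_le Fg mult_nonneg_nonneg Lp_norm_nonneg)
  finally have bound: "norm (L2_inner \<mu> f (fc F g)) \<le> M * (Lp_norm \<mu> 1 f * Lp_norm \<mu> \<infinity> g)"
    by (simp add: L2_inner_def mult_ac)
  have "form (half_line F) f g = L2_inner \<mu> f (fc F g)"
    using fc_adjoint[OF F(2), of f g] fc_inner[OF F(2), of f g] f g by (simp add: real)
  then show "norm (form (half_line F) f g) \<le> M * (Lp_norm \<mu> 1 f * Lp_norm \<mu> \<infinity> g)"
    using bound by simp
  have "form (half_line F) g f = cnj (L2_inner \<mu> f (fc F g))"
    using fc_inner[OF F(2), of g f] f g by (simp add: L2_inner_cnj)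
  then show "norm (form (half_line F) g f) \<le> M * (Lp_norm \<mu> 1 f * Lp_norm \<mu> \<infinity> g)"
    using bound by simp
qed

end

section \<open>The complex-time heat semigroup\<close>

lemma AE_norm_le_if_op_norm_less:
  assumes T: "op_norm \<mu> p \<infinity> T < ennreal M" and h: "h \<in> Lp \<mu> 2 \<inter> Lp \<mu> p"
  shows "AE x in \<mu>. norm (T h x) \<le> M * Lp_norm \<mu> p h"
proof -
  obtain C S where C_less: "0 \<le> C" "ennreal C < ennreal M" and S: "linear_op \<mu> (Lp \<mu> p) (Lp \<mu> \<infinity>) S"
      "AE x in \<mu>. S h x = T h x" "Lp_norm \<mu> \<infinity> (S h) \<le> C * Lp_norm \<mu> p h"
    using T h unfolding op_norm_def Inf_less_iff by auto
  have "C * Lp_norm \<mu> p h \<le> M * Lp_norm \<mu> p h"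
    using C_less by (intro mult_right_mono Lp_norm_nonneg) (simp add: ennreal_less_iff)
  with S have "Lp_norm \<mu> \<infinity> (S h) \<le> M * Lp_norm \<mu> p h" by simp
  moreover have "AE x in \<mu>. norm (S h x) \<le> Lp_norm \<mu> \<infinity> (S h)"
    using S(1) h by (intro AE_norm_le_Lp_norm_infinity linear_op_maps[OF S(1)]) auto
  ultimately show ?thesis using S(2) by (auto elim: eventually_elim2 intro: order_trans)
qed

locale propagation = metric_operator_calculus \<mu> D L
  for \<mu> :: "'a::metric_space measure" and D :: "('a \<Rightarrow> complex) set"
    and L :: "('a \<Rightarrow> complex) \<Rightarrow> ('a \<Rightarrow> complex)" +
  fixes \<sigma> \<kappa> C\<^sub>0 :: real
  assumes finite_propagation_speed: "finite_propagation_speed \<mu> D L" and \<sigma>: "\<sigma> > 0" and \<kappa>: "\<kappa> \<ge> 0"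
    and diagonal_bound: "\<forall>t>0. op_norm \<mu> 2 \<infinity>
           (\<lambda>f x. complex_of_real (sqrt (vol \<mu> t x)) * fc (\<lambda>u. complex_of_real ((1 + t\<^sup>2 * u) powr (- \<sigma>))) f x)
         \<le> ennreal (C\<^sub>0 * (1 + t\<^sup>2) powr \<kappa>)"
begin

abbreviation "resolvent t \<equiv> (\<lambda>u. complex_of_real ((1 + t\<^sup>2 * u) powr (- \<sigma>)))"

lemma bounded_borel_resolvent: "bounded_borel (half_line (resolvent t))"
proof (rule bounded_borel_half_line[of _ 1])
  fix u :: real assume "u \<ge> 0"
  then have "(1 + t\<^sup>2 * u) powr (- \<sigma>) \<le> 1 powr (- \<sigma>)" using \<sigma> by (intro powr_mono2') auto
  then show "norm (resolvent t u) \<le> 1" by simp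
qed measurable

lemma AE_resolvent_le:
  assumes t: "t > 0" and h: "h \<in> Lp \<mu> 2"
  shows "AE x in \<mu>. sqrt (vol \<mu> t x) * norm (fc (resolvent t) h x) \<le>
      (\<bar>C\<^sub>0\<bar> + 1) * (1 + t\<^sup>2) powr \<kappa> * Lp_norm \<mu> 2 h"
proof -
  let ?T = "\<lambda>f x. complex_of_real (sqrt (vol \<mu> t x)) * fc (resolvent t) f x"
  have "0 < 1 + t\<^sup>2" by (simp add: add_pos_nonneg)
  then have "C\<^sub>0 * (1 + t\<^sup>2) powr \<kappa> < (\<bar>C\<^sub>0\<bar> + 1) * (1 + t\<^sup>2) powr \<kappa>"
    by (intro mult_strict_right_mono) auto
  then have "ennreal (C\<^sub>0 * (1 + t\<^sup>2) powr \<kappa>) < ennreal ((\<bar>C\<^sub>0\<bar> + 1) * (1 + t\<^sup>2) powr \<kappa>)"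
    using \<open>0 < 1 + t\<^sup>2\<close> by (intro ennreal_lessI) auto
  then have "op_norm \<mu> 2 \<infinity> ?T < ennreal ((\<bar>C\<^sub>0\<bar> + 1) * (1 + t\<^sup>2) powr \<kappa>)"
    using diagonal_bound t le_less_trans by blast
  from AE_norm_le_if_op_norm_less[OF this, of h] h show ?thesis
    by (auto simp: norm_mult vol_def)
qed

lemma AE_resolvent_mult_le:
  assumes t: "t > 0" and h: "h \<in> Lp \<mu> 2"
    and m: "m \<in> borel_measurable borel" "\<And>u. u \<ge> 0 \<Longrightarrow> norm (m u) \<le> K"
    and F: "bounded_borel (half_line F)" "\<And>u. u \<ge> 0 \<Longrightarrow> F u = resolvent t u * m u"
  shows "AE x in \<mu>. sqrt (vol \<mu> t x) * norm (fc F h x) \<le>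
      (\<bar>C\<^sub>0\<bar> + 1) * (1 + t\<^sup>2) powr \<kappa> * K * Lp_norm \<mu> 2 h"
proof -
  have m_bounded: "bounded_borel (half_line m)" by (rule bounded_borel_half_line[OF m])
  have "half_line (\<lambda>u. resolvent t u * m u) = half_line F" using F(2) by (auto simp: half_line_def)
  then have "represents (half_line F) h (fc (resolvent t) (fc m h))"
    using fc_mult_represents[OF bounded_borel_resolvent[of t] m_bounded h] by simp
  then have "AE x in \<mu>. fc F h x = fc (resolvent t) (fc m h) x"
    by (rule represents_cong_AE[OF fc_represents[OF F(1) h]])
  with AE_resolvent_le[OF t fc_L2[OF m_bounded h]] show ?thesis
  proof eventually_elim
    case (elim x)
    then have "sqrt (vol \<mu> t x) * norm (fc F h x) \<le>
        (\<bar>C\<^sub>0\<bar> + 1) * (1 + t\<^sup>2) powr \<kappa> * Lp_norm \<mu> 2 (fc m h)" by simp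
    also have "\<dots> \<le> (\<bar>C\<^sub>0\<bar> + 1) * (1 + t\<^sup>2) powr \<kappa> * (K * Lp_norm \<mu> 2 h)"
      using fc_norm_le[OF m_bounded h m(2)] by (intro mult_left_mono) auto
    finally show ?case by (simp add: mult.assoc)
  qed
qed

abbreviation bessel_multiplier :: "real \<Rightarrow> real \<Rightarrow> complex" where
  "bessel_multiplier v u \<equiv> complex_of_real (bessel (2 * \<sigma> + 1/2) (v * u))"

lemma bessel_two_sigma_half_measurable[measurable]: "bessel (2 * \<sigma> + 1/2) \<in> borel_measurable borel"
  using \<sigma> by (intro bessel_measurable) simp

lemma propagates_cos:
  assumes "r > 0" shows "propagates r (\<lambda>u. complex_of_real (cos (r * sqrt u)))"
proof -
  have "bounded_borel (half_line (\<lambda>u. complex_of_real (cos (r * sqrt u))))"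
    by (rule bounded_borel_half_line[of _ 1]) auto
  then show ?thesis
    using finite_propagation_speed assms unfolding finite_propagation_speed_def propagates_def
    by (metis fc_inner)
qed

lemma propagates_bessel_multiplier:
  assumes v: "v > 0" shows "propagates (sqrt v) (bessel_multiplier v)"
proof (rule propagates_superposition)
  define c where "c = sqrt pi * Gamma (2 * \<sigma>)"
  have c_pos: "c > 0" using \<sigma> by (simp add: c_def Gamma_real_pos)
  let ?G = "\<lambda>s u. complex_of_real (beta_weight (2 * \<sigma>) s / c) *
      complex_of_real (cos (sqrt (v * s) * sqrt u))"
  show "sigma_finite_measure (lborel :: real measure)" by (rule lborel.sigma_finite_measure_axioms)
  show "(\<lambda>(s, u). ?G s u) \<in> borel_measurable (lborel \<Otimes>\<^sub>M borel)" by measurable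
  show "integrable lborel (\<lambda>s. beta_weight (2 * \<sigma>) s / c)"
    using integrable_beta_weight_mult_power[of "2 * \<sigma>" 0] \<sigma> by simp
  show "norm (?G s u) \<le> beta_weight (2 * \<sigma>) s / c" for s u
    using beta_weight_mult_power_nonneg[of "2 * \<sigma>" s 0] c_pos
    by (auto simp: norm_mult norm_divide intro!: divide_right_mono mult_left_le)
  show "bessel_multiplier v u = (LINT s|lborel. ?G s u)" if "u \<ge> 0" for u
  proof -
    have "?G s u = complex_of_real (beta_weight (2 * \<sigma>) s * cos (sqrt (v * u) * sqrt s) / c)" for s
      using that by (simp add: real_sqrt_mult mult_ac)
    then have "(LINT s|lborel. ?G s u) =
        complex_of_real ((LINT s|lborel. beta_weight (2 * \<sigma>) s * cos (sqrt (v * u) * sqrt s)) / c)"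
      by (simp only: integral_complex_of_real integral_divide_zero)
    also have "(LINT s|lborel. beta_weight (2 * \<sigma>) s * cos (sqrt (v * u) * sqrt s)) =
        c * bessel (2 * \<sigma> + 1/2) ((sqrt (v * u))\<^sup>2)"
      unfolding c_def using \<sigma> by (intro bessel_eq_cosine_integral) simp
    finally show ?thesis using that v c_pos by simp
  qed
  show "propagates (sqrt v) (?G s)" for s
  proof (cases "0 < s \<and> s < 1")
    case True
    then have "propagates (sqrt (v * s)) (?G s)"
      using v by (intro propagates_scale propagates_cos) simp
    then show ?thesis by (rule propagates_mono) (use True v in simp)
  next
    case False
    then have "?G s = (\<lambda>u. 0)" by (auto simp: beta_weight_def indicator_def)
    then show ?thesis by (simp only: propagates_zero)
  qed
qed

lemma bessel_bounded: "\<exists>K\<ge>0. \<forall>y\<ge>0. \<bar>bessel (2 * \<sigma> + 1/2) y\<bar> \<le> K"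
proof -
  obtain K where K: "K \<ge> 0" "(1 + 4 * y) powr \<sigma> * \<bar>bessel (2 * \<sigma> + 1/2) y\<bar> \<le> K" if "y \<ge> 0" for y
    using bessel_decay[OF \<sigma>] by blast
  have "\<bar>bessel (2 * \<sigma> + 1/2) y\<bar> \<le> K" if "y \<ge> 0" for y
  proof -
    have "1 * \<bar>bessel (2 * \<sigma> + 1/2) y\<bar> \<le> (1 + 4 * y) powr \<sigma> * \<bar>bessel (2 * \<sigma> + 1/2) y\<bar>"
      using that \<sigma> by (intro mult_right_mono ge_one_powr_ge_zero) auto
    with K(2)[OF that] show ?thesis by simp
  qed
  with K(1)[of 0] show ?thesis by auto
qed

lemma bounded_borel_bessel_multiplier:
  assumes "v \<ge> 0" shows "bounded_borel (half_line (bessel_multiplier v))"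
proof -
  obtain K where "\<And>y. y \<ge> 0 \<Longrightarrow> \<bar>bessel (2 * \<sigma> + 1/2) y\<bar> \<le> K" using bessel_bounded by blast
  then show ?thesis using assms by (intro bounded_borel_half_line[of _ K]) auto
qed

lemma bessel_multiplier_L1_Linfinity_bounded:
  "\<exists>K\<ge>0. \<forall>v>0. L1_Linfinity_bounded (bessel_multiplier v) (K * (1 + v) powr \<kappa>)"
proof -
  obtain K where K: "K \<ge> 0" "(1 + 4 * y) powr \<sigma> * \<bar>bessel (2 * \<sigma> + 1/2) y\<bar> \<le> K" if "y \<ge> 0" for y
    using bessel_decay[OF \<sigma>] by blast
  have K_nonneg: "K \<ge> 0" using K(1)[of 0] by simp
  let ?M = "\<lambda>v. (\<bar>C\<^sub>0\<bar> + 1) * (1 + (2 * sqrt v)\<^sup>2) powr \<kappa> * K"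
  have "L1_Linfinity_bounded (bessel_multiplier v) (?M v)" if v: "v > 0" for v
  proof (rule L1_Linfinity_bounded_if_propagates[OF propagates_bessel_multiplier[OF v]])
    show "bounded_borel (half_line (bessel_multiplier v))"
      using v by (intro bounded_borel_bessel_multiplier) simp
    fix h assume h: "h \<in> Lp \<mu> 2"
    let ?m = "\<lambda>u. complex_of_real ((1 + 4 * (v * u)) powr \<sigma> * bessel (2 * \<sigma> + 1/2) (v * u))"
    show "AE x in \<mu>. sqrt (vol \<mu> (2 * sqrt v) x) * norm (fc (bessel_multiplier v) h x) \<le>
        ?M v * Lp_norm \<mu> 2 h"
    proof (rule AE_resolvent_mult_le[OF _ h, where m = ?m])
      show "norm (?m u) \<le> K" if "u \<ge> 0" for u using K(2)[of "v * u"] v that by (simp add: norm_mult)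
      show "bessel_multiplier v u = resolvent (2 * sqrt v) u * ?m u" if "u \<ge> 0" for u
      proof -
        have "(1 + (2 * sqrt v)\<^sup>2 * u) powr (- \<sigma>) * (1 + 4 * (v * u)) powr \<sigma> = 1"
          using v that
          by (simp add: power_mult_distrib powr_add[symmetric] add_nonneg_eq_0_iff mult.assoc)
        then show ?thesis by (simp only: of_real_mult[symmetric] mult.assoc[symmetric] mult_1)
      qed
    qed (use v in \<open>auto intro!: bounded_borel_bessel_multiplier\<close>)
  qed (use v K_nonneg in auto)
  moreover have "?M v \<le> (\<bar>C\<^sub>0\<bar> + 1) * 4 powr \<kappa> * K * (1 + v) powr \<kappa>" if "v > 0" for v
  proof -
    have "(1 + (2 * sqrt v)\<^sup>2) powr \<kappa> \<le> (4 * (1 + v)) powr \<kappa>"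
      using that \<kappa> by (intro powr_mono2) (auto simp: power_mult_distrib)
    also have "\<dots> = 4 powr \<kappa> * (1 + v) powr \<kappa>" by (rule powr_mult)
    finally have "(\<bar>C\<^sub>0\<bar> + 1) * K * (1 + (2 * sqrt v)\<^sup>2) powr \<kappa> \<le>
        (\<bar>C\<^sub>0\<bar> + 1) * K * (4 powr \<kappa> * (1 + v) powr \<kappa>)"
      using K_nonneg by (intro mult_left_mono) auto
    then show ?thesis by (simp only: mult_ac)
  qed
  ultimately have "\<forall>v>0. L1_Linfinity_bounded (bessel_multiplier v) ((\<bar>C\<^sub>0\<bar> + 1) * 4 powr \<kappa> * K *
      (1 + v) powr \<kappa>)"
    using L1_Linfinity_bounded_mono by blast
  then show ?thesis using K_nonneg by (intro exI[of _ "(\<bar>C\<^sub>0\<bar> + 1) * 4 powr \<kappa> * K"]) auto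
qed

end

lemma one_plus_powr_le:
  fixes v a :: real assumes "v \<ge> 0" "a \<ge> 0" shows "(1 + v) powr a \<le> 2 powr a * (1 + v powr a)"
proof -
  have "(1 + v) powr a \<le> (2 * max 1 v) powr a" using assms by (intro powr_mono2) auto
  also have "\<dots> = 2 powr a * max 1 v powr a" using assms by (simp add: powr_mult)
  also have "\<dots> \<le> 2 powr a * (1 + v powr a)"
    using assms by (intro mult_left_mono) (auto simp: max_def)
  finally show ?thesis .
qed

lemma norm_gamma_kernel_weighted_le:
  assumes a: "a \<ge> 0"
  shows "norm (gamma_kernel b p v) * (1 + v) powr a \<le>
    2 powr a * (norm (gamma_kernel b p v) + norm (gamma_kernel (b + a) p v))"
proof (cases "v > 0")
  case True
  have "v powr (b - 1) * v powr a = v powr (b + a - 1)"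
    by (simp add: powr_add[symmetric] algebra_simps)
  then have norm_eq: "norm (gamma_kernel b p v) * v powr a = norm (gamma_kernel (b + a) p v)"
    unfolding norm_gamma_kernel using True by (simp add: mult_ac)
  have "norm (gamma_kernel b p v) * (1 + v) powr a \<le>
      norm (gamma_kernel b p v) * (2 powr a * (1 + v powr a))"
    using True a by (intro mult_left_mono one_plus_powr_le) auto
  then show ?thesis unfolding norm_eq[symmetric] by (simp add: algebra_simps)
qed (simp add: gamma_kernel_def)

lemma
  assumes b: "b > 0" and a: "a \<ge> 0" and p: "Re p > 0"
  shows integrable_gamma_kernel_weighted:
    "integrable lborel (\<lambda>v. norm (gamma_kernel b p v) * (1 + v) powr a)"
    and integral_gamma_kernel_weighted_le:
      "(LINT v|lborel. norm (gamma_kernel b p v) * (1 + v) powr a) \<le>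
      2 powr (a + 1) * (Gamma b + Gamma (b + a)) * Re p powr (- b) * (1 + 1 / Re p) powr a"
proof -
  let ?w = "\<lambda>v. 2 powr a * (norm (gamma_kernel b p v) + norm (gamma_kernel (b + a) p v))"
  have w: "integrable lborel ?w"
    using b a p
    by (intro integrable_mult_right Bochner_Integration.integrable_add integrable_norm
        integrable_gamma_kernel) auto
  note pointwise_le = norm_gamma_kernel_weighted_le[OF a, of b p]
  show integrable: "integrable lborel (\<lambda>v. norm (gamma_kernel b p v) * (1 + v) powr a)"
    by (rule Bochner_Integration.integrable_bound[OF w]) (use pointwise_le in auto)
  have Gamma_nonneg: "Gamma b \<ge> 0" "Gamma (b + a) \<ge> 0" using b a by (auto intro!: Gamma_real_nonneg)
  have powr_split: "Re p powr (- (b + a)) = Re p powr (- b) * (1 / Re p) powr a"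
    using p by (simp add: powr_add[symmetric] powr_divide flip: powr_minus_divide)
  have "1 \<le> (1 + 1 / Re p) powr a" "(1 / Re p) powr a \<le> (1 + 1 / Re p) powr a"
    using a p by (auto intro!: powr_mono2 ge_one_powr_ge_zero)
  then have "Gamma b * 1 + Gamma (b + a) * (1 / Re p) powr a \<le>
      Gamma b * (1 + 1 / Re p) powr a + Gamma (b + a) * (1 + 1 / Re p) powr a"
    using Gamma_nonneg by (intro add_mono mult_left_mono)
  then have "2 powr a * Re p powr (- b) * (Gamma b + Gamma (b + a) * (1 / Re p) powr a) \<le>
      2 powr a * Re p powr (- b) * ((Gamma b + Gamma (b + a)) * (1 + 1 / Re p) powr a)"
    by (intro mult_left_mono) (auto simp: algebra_simps)
  also have "\<dots> \<le> 2 * \<dots>" using Gamma_nonneg by simp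
  finally have "2 powr a * Re p powr (- b) * (Gamma b + Gamma (b + a) * (1 / Re p) powr a) \<le>
      2 powr (a + 1) * (Gamma b + Gamma (b + a)) * Re p powr (- b) * (1 + 1 / Re p) powr a"
    by (simp add: powr_add mult_ac)
  moreover have "(LINT v|lborel. ?w v) =
      2 powr a * Re p powr (- b) * (Gamma b + Gamma (b + a) * (1 / Re p) powr a)"
    using b a p
    by (simp add: integral_norm_gamma_kernel integrable_gamma_kernel powr_split del: minus_add_distrib)
      (simp add: algebra_simps)
  ultimately show "(LINT v|lborel. norm (gamma_kernel b p v) * (1 + v) powr a) \<le>
      2 powr (a + 1) * (Gamma b + Gamma (b + a)) * Re p powr (- b) * (1 + 1 / Re p) powr a"
    using integral_mono[OF integrable w pointwise_le] by simp
qed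

lemma
  assumes z: "Re z > 0"
  shows Re_inverse_4: "Re (1 / (4 * z)) = Re z / (4 * (norm z)\<^sup>2)"
    and Re_inverse_4_pos: "Re (1 / (4 * z)) > 0"
    and norm_Re_inverse_4: "norm (1 / (4 * z)) / Re (1 / (4 * z)) = norm z / Re z"
proof -
  have "z \<noteq> 0" using z by auto
  have "Re (1 / (4 * z)) = Re (4 * z) / (norm (4 * z))\<^sup>2"
    unfolding cmod_power2 by (simp add: Re_divide)
  then show Re_eq: "Re (1 / (4 * z)) = Re z / (4 * (norm z)\<^sup>2)"
    by (simp add: norm_mult power_mult_distrib)
  show "Re (1 / (4 * z)) > 0" unfolding Re_eq using z \<open>z \<noteq> 0\<close> by simp
  show "norm (1 / (4 * z)) / Re (1 / (4 * z)) = norm z / Re z"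
    unfolding Re_eq using \<open>z \<noteq> 0\<close> by (simp add: norm_divide norm_mult power2_eq_square)
qed

lemma exp_eq_bessel_superposition:
  assumes b: "b > 0" and z: "Re z > 0" and p: "p = 1 / (4 * z)"
  shows "exp (- (z * complex_of_real u)) =
    (LINT v|lborel. p powr complex_of_real b * gamma_kernel b p v * complex_of_real (bessel b (v * u)))"
proof -
  have Re_p: "Re p > 0" unfolding p by (rule Re_inverse_4_pos[OF z])
  have "p \<noteq> 0" "z \<noteq> 0" using z Re_p by auto
  have "(LINT v|lborel. p powr complex_of_real b * gamma_kernel b p v *
      complex_of_real (bessel b (v * u))) =
      p powr complex_of_real b * (p powr (- complex_of_real b) * exp (- complex_of_real u / (4 * p)))"
    by (simp only: mult.assoc integral_mult_right_zero integral_gamma_kernel_bessel[OF b Re_p])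
  also have "\<dots> = exp (- complex_of_real u / (4 * p))"
    using \<open>p \<noteq> 0\<close> by (simp add: mult.assoc[symmetric] powr_add[symmetric])
  also have "- complex_of_real u / (4 * p) = - (z * complex_of_real u)"
    using \<open>z \<noteq> 0\<close> by (simp add: p)
  finally show ?thesis ..
qed

context propagation begin

lemma exp_L1_Linfinity_bounded_integral:
  assumes K: "\<And>v. v > 0 \<Longrightarrow> L1_Linfinity_bounded (bessel_multiplier v) (K * (1 + v) powr \<kappa>)"
    and z: "Re z > 0" and p: "p = 1 / (4 * z)" and b: "b = 2 * \<sigma> + 1/2"
  shows "L1_Linfinity_bounded (\<lambda>u. exp (- (z * complex_of_real u)))
    (LINT v|lborel. norm (p powr complex_of_real b) * K * (norm (gamma_kernel b p v) * (1 + v) powr \<kappa>))"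
proof -
  have b_pos: "b > 0" using \<sigma> by (simp add: b)
  have Re_p: "Re p > 0" unfolding p by (rule Re_inverse_4_pos[OF z])
  obtain B where B: "\<And>y. y \<ge> 0 \<Longrightarrow> \<bar>bessel b y\<bar> \<le> B" using bessel_bounded b by blast
  let ?G = "\<lambda>v u. p powr complex_of_real b * gamma_kernel b p v *
      complex_of_real (bessel b (v * u))"
  let ?n = "norm (p powr complex_of_real b)"
  show ?thesis
  proof (rule L1_Linfinity_bounded_superposition)
    show "sigma_finite_measure (lborel :: real measure)"
      by (rule lborel.sigma_finite_measure_axioms)
    show "(\<lambda>(v, u). ?G v u) \<in> borel_measurable (lborel \<Otimes>\<^sub>M borel)" unfolding b by measurable
    show "integrable lborel (\<lambda>v. ?n * B * norm (gamma_kernel b p v))"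
      by (intro integrable_mult_right integrable_norm integrable_gamma_kernel b_pos Re_p)
    show "norm (?G v u) \<le> ?n * B * norm (gamma_kernel b p v)" if "0 \<le> u" for v u
    proof (cases "v > 0")
      case True
      then show ?thesis
        using mult_left_mono[OF B[of "v * u"], of "?n * norm (gamma_kernel b p v)"] that
        by (simp add: norm_mult mult_ac)
    qed (simp add: gamma_kernel_def)
    show "bounded_borel (half_line (\<lambda>u. exp (- (z * complex_of_real u))))"
      using z by (intro bounded_borel_half_line[of _ 1]) (auto simp: norm_exp_eq_Re)
    show "exp (- (z * complex_of_real u)) = (LINT v|lborel. ?G v u)" for u
      by (rule exp_eq_bessel_superposition[OF b_pos z p])
    show "integrable lborel (\<lambda>v. ?n * K * (norm (gamma_kernel b p v) * (1 + v) powr \<kappa>))"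
      by (intro integrable_mult_right integrable_gamma_kernel_weighted b_pos \<kappa> Re_p)
    show "L1_Linfinity_bounded (?G v) (?n * K * (norm (gamma_kernel b p v) * (1 + v) powr \<kappa>))" for v
    proof (cases "v > 0")
      case True
      from L1_Linfinity_bounded_scale[OF K[OF True], of "p powr complex_of_real b * gamma_kernel b p v"]
      show ?thesis by (simp add: norm_mult mult_ac b)
    qed (use L1_Linfinity_bounded_zero in \<open>simp add: gamma_kernel_def\<close>)
  qed
qed

theorem heat_L1_Linfinity_bounded:
  "\<exists>C\<ge>0. \<forall>z. Re z > 0 \<longrightarrow> L1_Linfinity_bounded (\<lambda>u. exp (- (z * complex_of_real u)))
     (C * (norm z / Re z) powr (2 * \<sigma> + 1/2) * (1 + (norm z)\<^sup>2 / Re z) powr \<kappa>)"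
proof -
  let ?b = "2 * \<sigma> + 1/2"
  have b: "?b > 0" using \<sigma> by simp
  obtain K where K: "K \<ge> 0"
    "\<And>v. v > 0 \<Longrightarrow> L1_Linfinity_bounded (bessel_multiplier v) (K * (1 + v) powr \<kappa>)"
    using bessel_multiplier_L1_Linfinity_bounded by blast
  define C where "C = K * (2 powr (\<kappa> + 1) * (Gamma ?b + Gamma (?b + \<kappa>)))"
  have C: "C \<ge> 0"
    unfolding C_def using K(1) b \<kappa>
    by (auto intro!: mult_nonneg_nonneg add_nonneg_nonneg Gamma_real_nonneg)
  have "L1_Linfinity_bounded (\<lambda>u. exp (- (z * complex_of_real u)))
     (C * 4 powr \<kappa> * (norm z / Re z) powr ?b * (1 + (norm z)\<^sup>2 / Re z) powr \<kappa>)" if z: "Re z > 0" for z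
  proof (rule L1_Linfinity_bounded_mono[OF exp_L1_Linfinity_bounded_integral[OF K(2) z refl refl]])
    let ?p = "1 / (4 * z)" and ?Y = "1 + (norm z)\<^sup>2 / Re z"
    let ?n = "norm (?p powr complex_of_real ?b)"
    note Re_p = Re_inverse_4_pos[OF z]
    have "?n = norm ?p powr ?b" by (subst norm_powr_real_powr') auto
    then have ratio: "?n * Re ?p powr (- ?b) = (norm z / Re z) powr ?b"
      unfolding norm_Re_inverse_4[OF z, symmetric] powr_minus_divide[of "Re ?p"]
      using Re_p by (simp add: powr_divide del: divide_inverse_commute)
    have "(1 + 1 / Re ?p) powr \<kappa> \<le> (4 * ?Y) powr \<kappa>"
      unfolding Re_inverse_4[OF z] using z \<kappa> by (intro powr_mono2) auto
    then have Y: "(1 + 1 / Re ?p) powr \<kappa> \<le> 4 powr \<kappa> * ?Y powr \<kappa>" by (simp only: powr_mult)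
    have "(LINT v|lborel. ?n * K * (norm (gamma_kernel ?b ?p v) * (1 + v) powr \<kappa>)) \<le>
        ?n * K * (2 powr (\<kappa> + 1) * (Gamma ?b + Gamma (?b + \<kappa>)) * Re ?p powr (- ?b) * (1 + 1 / Re ?p) powr \<kappa>)"
      unfolding integral_mult_right_zero
      by (intro mult_left_mono integral_gamma_kernel_weighted_le b \<kappa> Re_p mult_nonneg_nonneg K
          norm_ge_zero)
    also have "\<dots> = C * (?n * Re ?p powr (- ?b)) * (1 + 1 / Re ?p) powr \<kappa>"
      by (simp only: C_def mult_ac)
    also have "\<dots> \<le> C * (norm z / Re z) powr ?b * (4 powr \<kappa> * ?Y powr \<kappa>)"
      unfolding ratio using C by (intro mult_left_mono Y mult_nonneg_nonneg) auto
    finally show "(LINT v|lborel. ?n * K * (norm (gamma_kernel ?b ?p v) * (1 + v) powr \<kappa>)) \<le>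
        C * 4 powr \<kappa> * (norm z / Re z) powr ?b * ?Y powr \<kappa>" by (simp only: mult_ac)
  qed
  then show ?thesis using C by (intro exI[of _ "C * 4 powr \<kappa>"]) auto
qed

end

section \<open>Spectral multipliers\<close>

lemma one_plus_square_add_powr:
  fixes x y b :: real assumes "b \<ge> 0"
  shows "(1 + (x + y)\<^sup>2) powr b \<le> 2 powr b * (1 + x\<^sup>2) powr b * (1 + y\<^sup>2) powr b"
proof -
  have "(x + y)\<^sup>2 \<le> 2 * x\<^sup>2 + 2 * y\<^sup>2" using sum_squares_bound[of x y] by (simp add: power2_sum)
  moreover have "2 * (1 + x\<^sup>2) * (1 + y\<^sup>2) = 2 + 2 * x\<^sup>2 + 2 * y\<^sup>2 + 2 * (x * y)\<^sup>2"
    by (simp add: algebra_simps power_mult_distrib)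
  ultimately have "1 + (x + y)\<^sup>2 \<le> 2 * (1 + x\<^sup>2) * (1 + y\<^sup>2)"
    using zero_le_power2[of "x * y"] by linarith
  then have "(1 + (x + y)\<^sup>2) powr b \<le> (2 * (1 + x\<^sup>2) * (1 + y\<^sup>2)) powr b"
    using assms by (intro powr_mono2) auto
  then show ?thesis by (simp only: powr_mult)
qed

lemma one_plus_square_powr_ge_1: "b \<ge> 0 \<Longrightarrow> 1 \<le> (1 + x\<^sup>2) powr b" for x b :: real
  by (intro ge_one_powr_ge_zero) auto

lemma integrable_if_weighted_integrable:
  fixes f :: "'a \<Rightarrow> complex" and \<phi> :: "'a \<Rightarrow> real"
  assumes f: "f \<in> borel_measurable M"
    and weighted: "integrable M (\<lambda>x. (1 + (\<phi> x)\<^sup>2) powr b * norm (f x))" and b: "b \<ge> 0"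
  shows "integrable M f"
proof (rule Bochner_Integration.integrable_bound[OF weighted f])
  have "1 * norm (f x) \<le> (1 + (\<phi> x)\<^sup>2) powr b * norm (f x)" for x
    by (intro mult_right_mono one_plus_square_powr_ge_1 b) simp
  then show "AE x in M. norm (f x) \<le> norm ((1 + (\<phi> x)\<^sup>2) powr b * norm (f x))" by simp
qed

lemma
  fixes a h :: "real \<Rightarrow> complex"
  assumes [measurable]: "a \<in> borel_measurable borel" "h \<in> borel_measurable borel" and b: "b \<ge> 0"
    and a: "integrable lborel (\<lambda>\<xi>. (1 + \<xi>\<^sup>2) powr b * norm (a \<xi>))"
    and h: "integrable lborel (\<lambda>\<omega>. (1 + \<omega>\<^sup>2) powr b * norm (h \<omega>))"
  defines "w \<equiv> \<lambda>z. (1 + (fst z + snd z)\<^sup>2) powr b * norm (a (fst z) * h (snd z))"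
  shows integrable_convolution_weight: "integrable (lborel \<Otimes>\<^sub>M lborel) w"
    and integral_convolution_weight_le: "(LINT z|(lborel \<Otimes>\<^sub>M lborel). w z) \<le>
      2 powr b * (LINT \<xi>|lborel. (1 + \<xi>\<^sup>2) powr b * norm (a \<xi>)) * (LINT \<omega>|lborel. (1 + \<omega>\<^sup>2) powr b * norm (h \<omega>))"
proof -
  let ?N = "lborel \<Otimes>\<^sub>M lborel :: (real \<times> real) measure"
  let ?a = "\<lambda>\<xi>. (1 + \<xi>\<^sup>2) powr b * norm (a \<xi>)" and ?h = "\<lambda>\<omega>. (1 + \<omega>\<^sup>2) powr b * norm (h \<omega>)"
  have w_le: "w z \<le> 2 powr b * (?a (fst z) * ?h (snd z))" for z
    using mult_right_mono[OF one_plus_square_add_powr[OF b],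
        of "norm (a (fst z) * h (snd z))" "fst z" "snd z"]
    by (simp add: w_def norm_mult mult_ac)
  have dominating: "integrable ?N (\<lambda>z. 2 powr b * (?a (fst z) * ?h (snd z)))"
    using lborel_pair.integrable_mult_pair[OF a h] by (simp add: case_prod_beta')
  show integrable_w: "integrable ?N w"
  proof (rule Bochner_Integration.integrable_bound[OF dominating])
    show "w \<in> borel_measurable ?N" unfolding w_def by measurable
    have "norm (w z) \<le> norm (2 powr b * (?a (fst z) * ?h (snd z)))" for z
      using order_trans[OF w_le[of z] abs_ge_self] by (simp add: w_def abs_mult)
    then show "AE z in ?N. norm (w z) \<le> norm (2 powr b * (?a (fst z) * ?h (snd z)))" by simp
  qed
  have "(LINT z|?N. w z) \<le> (LINT z|?N. 2 powr b * (?a (fst z) * ?h (snd z)))"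
    by (rule integral_mono[OF integrable_w dominating w_le])
  also have "\<dots> = 2 powr b * (LINT \<xi>|lborel. ?a \<xi>) * (LINT \<omega>|lborel. ?h \<omega>)"
    using lborel_pair.integral_mult_pair[OF a h] by simp
  finally show "(LINT z|?N. w z) \<le> 2 powr b * (LINT \<xi>|lborel. ?a \<xi>) * (LINT \<omega>|lborel. ?h \<omega>)" .
qed

abbreviation damped_wave :: "real \<Rightarrow> real \<Rightarrow> complex" where
  "damped_wave \<xi> s \<equiv> exp (\<i> * complex_of_real (\<xi> * s)) * exp (- complex_of_real s)"

context propagation begin

abbreviation "\<beta> \<equiv> \<sigma> + \<kappa> + 1/4"

lemma damped_wave_L1_Linfinity_bounded:
  "\<exists>C\<ge>0. \<forall>t>0. \<forall>\<xi>. L1_Linfinity_bounded (\<lambda>u. damped_wave \<xi> (t * u)) (C * (1 + t) powr \<kappa> *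
      (1 + \<xi>\<^sup>2) powr \<beta>)"
proof -
  obtain C where C: "C \<ge> 0"
    and heat: "\<And>z. Re z > 0 \<Longrightarrow> L1_Linfinity_bounded (\<lambda>u. exp (- (z * complex_of_real u)))
      (C * (norm z / Re z) powr (2 * \<sigma> + 1/2) * (1 + (norm z)\<^sup>2 / Re z) powr \<kappa>)"
    using heat_L1_Linfinity_bounded by blast
  have "L1_Linfinity_bounded (\<lambda>u. damped_wave \<xi> (t * u)) (C * (1 + t) powr \<kappa> * (1 + \<xi>\<^sup>2) powr \<beta>)"
    if t: "t > 0" for t \<xi>
  proof (rule L1_Linfinity_bounded_mono)
    define z where "z = complex_of_real t * (1 - \<i> * complex_of_real \<xi>)"
    have "norm (1 - \<i> * complex_of_real \<xi>) = (1 + \<xi>\<^sup>2) powr (1/2)"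
      by (simp add: cmod_def powr_half_sqrt add_nonneg_nonneg)
    then have norm_z: "norm z = t * (1 + \<xi>\<^sup>2) powr (1/2)" using t by (simp add: z_def norm_mult)
    have Re_z: "Re z = t" by (simp add: z_def)
    have "damped_wave \<xi> (t * u) = exp (- (z * complex_of_real u))" for u
      unfolding exp_add[symmetric] by (simp add: z_def algebra_simps)
    then show "L1_Linfinity_bounded (\<lambda>u. damped_wave \<xi> (t * u))
        (C * (norm z / Re z) powr (2 * \<sigma> + 1/2) * (1 + (norm z)\<^sup>2 / Re z) powr \<kappa>)"
      using heat[of z] t by (simp only: Re_z)
    have "(norm z)\<^sup>2 / Re z = t * (1 + \<xi>\<^sup>2)"
      using t one_plus_square_powr_half[of \<xi> 1]
      by (simp add: norm_z Re_z power_mult_distrib power2_eq_square[of t])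
    then have "1 + (norm z)\<^sup>2 / Re z \<le> (1 + t) * (1 + \<xi>\<^sup>2)" by (simp add: algebra_simps)
    then have "(1 + (norm z)\<^sup>2 / Re z) powr \<kappa> \<le> ((1 + t) * (1 + \<xi>\<^sup>2)) powr \<kappa>"
      using t \<kappa> by (intro powr_mono2) (auto simp: Re_z)
    moreover have "(norm z / Re z) powr (2 * \<sigma> + 1/2) = (1 + \<xi>\<^sup>2) powr (\<sigma> + 1/4)"
      using t by (simp add: norm_z Re_z powr_powr add_divide_distrib)
    ultimately have "C * (norm z / Re z) powr (2 * \<sigma> + 1/2) * (1 + (norm z)\<^sup>2 / Re z) powr \<kappa> \<le>
        C * (1 + \<xi>\<^sup>2) powr (\<sigma> + 1/4) * ((1 + t) * (1 + \<xi>\<^sup>2)) powr \<kappa>"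
      using C by (intro mult_mono) auto
    also have "\<dots> = C * (1 + t) powr \<kappa> * ((1 + \<xi>\<^sup>2) powr (\<sigma> + 1/4) * (1 + \<xi>\<^sup>2) powr \<kappa>)"
      by (simp only: powr_mult mult_ac)
    also have "(1 + \<xi>\<^sup>2) powr (\<sigma> + 1/4) * (1 + \<xi>\<^sup>2) powr \<kappa> = (1 + \<xi>\<^sup>2) powr \<beta>"
      by (simp add: powr_add[symmetric] algebra_simps)
    finally show "C * (norm z / Re z) powr (2 * \<sigma> + 1/2) * (1 + (norm z)\<^sup>2 / Re z) powr \<kappa> \<le>
        C * (1 + t) powr \<kappa> * (1 + \<xi>\<^sup>2) powr \<beta>" .
  qed
  with C show ?thesis by blast
qed

theorem op_norm_damped_wave_le:
  "\<exists>C>0. \<forall>t>0. \<forall>\<xi>::real. \<forall>p\<ge>1. op_norm \<mu> p p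
      (fc (\<lambda>u. exp (\<i> * of_real (\<xi> * t * u))) \<circ> fc (\<lambda>u. exp (- of_real (t * u))))
    \<le> ennreal (C * (1 + \<xi>\<^sup>2) powr \<beta> * (1 + t) powr \<kappa>)"
proof -
  obtain C where C: "C \<ge> 0" and wave: "\<And>t \<xi>. t > 0 \<Longrightarrow>
      L1_Linfinity_bounded (\<lambda>u. damped_wave \<xi> (t * u)) (C * (1 + t) powr \<kappa> * (1 + \<xi>\<^sup>2) powr \<beta>)"
    using damped_wave_L1_Linfinity_bounded by blast
  have "op_norm \<mu> p p (fc (\<lambda>u. exp (\<i> * of_real (\<xi> * t * u))) \<circ> fc (\<lambda>u. exp (- of_real (t * u))))
      \<le> ennreal ((C + 1) * (1 + \<xi>\<^sup>2) powr \<beta> * (1 + t) powr \<kappa>)"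
    if t: "t > 0" and p: "1 \<le> p" for t \<xi> :: real and p
  proof (rule op_norm_le_if_L1_Linfinity_bounded[OF sigma_finite_mu _ _ p])
    have "C * (1 + t) powr \<kappa> * (1 + \<xi>\<^sup>2) powr \<beta> \<le> (C + 1) * (1 + \<xi>\<^sup>2) powr \<beta> * (1 + t) powr \<kappa>"
      by (simp add: algebra_simps)
    from L1_Linfinity_bounded_mono[OF wave[OF t] this]
    show "L1_Linfinity_bounded (\<lambda>u. exp (\<i> * of_real (\<xi> * t * u)) * exp (- of_real (t * u)))
        ((C + 1) * (1 + \<xi>\<^sup>2) powr \<beta> * (1 + t) powr \<kappa>)" by (simp add: mult.assoc)
    show "represents (half_line (\<lambda>u. exp (\<i> * of_real (\<xi> * t * u)) * exp (- of_real (t * u)))) f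
        ((fc (\<lambda>u. exp (\<i> * of_real (\<xi> * t * u))) \<circ> fc (\<lambda>u. exp (- of_real (t * u)))) f)"
      if "f \<in> Lp \<mu> 2" for f
      unfolding comp_def
      by (rule fc_mult_represents[OF _ _ that])
         (rule bounded_borel_half_line[of _ 1], use t in \<open>auto simp: norm_exp_eq_Re\<close>)+
  qed (use C in auto)
  then show ?thesis using C by (intro exI[of _ "C + 1"]) auto
qed

lemma superposition_of_damped_waves_L1_Linfinity_bounded:
  fixes c :: "'i \<Rightarrow> complex" and \<phi> :: "'i \<Rightarrow> real"
  assumes wave: "\<And>\<xi>. L1_Linfinity_bounded (\<lambda>u. damped_wave \<xi> (t * u)) (C * (1 + \<xi>\<^sup>2) powr \<beta>)"
    and t: "t > 0"
    and N: "sigma_finite_measure N"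
    and [measurable]: "c \<in> borel_measurable N" "\<phi> \<in> borel_measurable N"
    and weighted: "integrable N (\<lambda>i. (1 + (\<phi> i)\<^sup>2) powr \<beta> * norm (c i))"
    and F: "bounded_borel (half_line F)"
      "\<And>u. u \<ge> 0 \<Longrightarrow> F u = (LINT i|N. c i * damped_wave (\<phi> i) (t * u))"
  shows "L1_Linfinity_bounded F (C * (LINT i|N. (1 + (\<phi> i)\<^sup>2) powr \<beta> * norm (c i)))"
proof -
  have c_integrable: "integrable N c"
    using \<sigma> \<kappa> by (intro integrable_if_weighted_integrable[OF _ weighted]) auto
  have "L1_Linfinity_bounded F (LINT i|N. C * ((1 + (\<phi> i)\<^sup>2) powr \<beta> * norm (c i)))"
  proof (rule L1_Linfinity_bounded_superposition[OF N _ integrable_norm[OF c_integrable] _ F])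
    show "(\<lambda>(i, u). c i * damped_wave (\<phi> i) (t * u)) \<in> borel_measurable (N \<Otimes>\<^sub>M borel)" by measurable
    show "norm (c i * damped_wave (\<phi> i) (t * u)) \<le> norm (c i)" if "0 \<le> u" for i u
      using t that by (auto simp: norm_mult norm_exp_eq_Re intro!: mult_left_le)
    show "integrable N (\<lambda>i. C * ((1 + (\<phi> i)\<^sup>2) powr \<beta> * norm (c i)))" using weighted by simp
    show "L1_Linfinity_bounded (\<lambda>u. c i * damped_wave (\<phi> i) (t * u)) (C *
        ((1 + (\<phi> i)\<^sup>2) powr \<beta> * norm (c i)))" for i
      using L1_Linfinity_bounded_scale[OF wave, of "c i" "\<phi> i"] by (simp only: mult_ac)
  qed
  then show ?thesis by simp
qed

lemma product_of_fourier_integrals_L1_Linfinity_bounded: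
  fixes a h :: "real \<Rightarrow> complex"
  assumes wave: "\<And>\<xi>. L1_Linfinity_bounded (\<lambda>u. damped_wave \<xi> (t * u)) (C * (1 + \<xi>\<^sup>2) powr \<beta>)"
    and t: "t > 0" and C: "C \<ge> 0"
    and measurable_ah[measurable]: "a \<in> borel_measurable borel" "h \<in> borel_measurable borel"
    and a: "integrable lborel (\<lambda>\<xi>. (1 + \<xi>\<^sup>2) powr \<beta> * norm (a \<xi>))"
    and h: "integrable lborel (\<lambda>\<omega>. (1 + \<omega>\<^sup>2) powr \<beta> * norm (h \<omega>))"
    and F: "bounded_borel (half_line (\<lambda>u. F (t * u)))"
      "\<And>s. s \<ge> 0 \<Longrightarrow> F s = (LINT \<xi>|lborel. a \<xi> * exp (\<i> * of_real (s * \<xi>))) *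
         (LINT \<omega>|lborel. h \<omega> * exp (\<i> * of_real (s * \<omega>))) * exp (- of_real s)"
  shows "L1_Linfinity_bounded (\<lambda>u. F (t * u))
    (C * (2 powr \<beta> * (LINT \<xi>|lborel. (1 + \<xi>\<^sup>2) powr \<beta> * norm (a \<xi>)) *
      (LINT \<omega>|lborel. (1 + \<omega>\<^sup>2) powr \<beta> * norm (h \<omega>))))"
proof (rule L1_Linfinity_bounded_mono)
  let ?N = "lborel \<Otimes>\<^sub>M lborel :: (real \<times> real) measure"
  let ?w = "\<lambda>z. (1 + (fst z + snd z)\<^sup>2) powr \<beta> * norm (a (fst z) * h (snd z))"
  have \<beta>: "\<beta> \<ge> 0" using \<sigma> \<kappa> by simp
  have ah: "integrable lborel a" "integrable lborel h"
    using integrable_if_weighted_integrable[OF _ a \<beta>] integrable_if_weighted_integrable[OF _ h \<beta>]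
    by simp_all
  note weight = integrable_convolution_weight[OF measurable_ah \<beta> a h]
    integral_convolution_weight_le[OF measurable_ah \<beta> a h]
  show "L1_Linfinity_bounded (\<lambda>u. F (t * u)) (C * (LINT z|?N. ?w z))"
  proof (rule superposition_of_damped_waves_L1_Linfinity_bounded[OF wave t _ _ _ weight(1) F(1)])
    show "sigma_finite_measure ?N"
      by (rule sigma_finite_pair_measure) (rule lborel.sigma_finite_measure_axioms)+
    fix u :: real assume "u \<ge> 0"
    let ?e = "\<lambda>\<xi>. exp (\<i> * of_real (t * u * \<xi>))"
    have "integrable lborel (\<lambda>\<xi>. a \<xi> * ?e \<xi>)" "integrable lborel (\<lambda>\<omega>. h \<omega> * ?e \<omega>)"
      by (intro integrable_mult_unimodular ah; simp add: norm_exp_eq_Re)+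
    note product = lborel_pair.integral_mult_pair[OF this]
    have "a (fst z) * h (snd z) * damped_wave (fst z + snd z) (t * u) =
        a (fst z) * ?e (fst z) * (h (snd z) * ?e (snd z)) * exp (- of_real (t * u))" for z
      by (simp add: distrib_right distrib_left exp_add mult_ac)
    then show "F (t * u) = (LINT z|?N. a (fst z) * h (snd z) * damped_wave (fst z + snd z) (t * u))"
      using t \<open>u \<ge> 0\<close>
      by (simp only: F(2) mult_nonneg_nonneg less_imp_le product integral_mult_left_zero)
  qed measurable
  show "C * (LINT z|?N. ?w z) \<le> C * (2 powr \<beta> * (LINT \<xi>|lborel. (1 + \<xi>\<^sup>2) powr \<beta> * norm (a \<xi>)) *
      (LINT \<omega>|lborel. (1 + \<omega>\<^sup>2) powr \<beta> * norm (h \<omega>)))"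
    using weight(2) C by (rule mult_left_mono)
qed

lemma eq_product_of_fourier_integrals:
  assumes F: "integrable lborel F" "continuous_on UNIV F" "bounded (range F)"
    "integrable lborel (fourier F)" "\<forall>x>1. F x = 0"
    and h: "\<And>u. u \<le> 1 \<Longrightarrow> (LINT \<omega>|lborel. h \<omega> * exp (\<i> * of_real (u * \<omega>))) = complex_of_real (exp u)"
  shows "F u = (LINT \<xi>|lborel. fourier F \<xi> / (2 * pi) * exp (\<i> * of_real (u * \<xi>))) *
    (LINT \<omega>|lborel. h \<omega> * exp (\<i> * of_real (u * \<omega>))) * exp (- of_real u)"
proof -
  obtain B where B: "\<And>x. norm (F x) \<le> B" using F(3) unfolding bounded_iff by blast
  have "(LINT \<xi>|lborel. fourier F \<xi> * exp (\<i> * of_real (u * \<xi>))) = 2 * pi * F u"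
    using F(2)
    by (intro fourier_inversion[OF F(1) _ B F(4)]) (auto simp: continuous_on_eq_continuous_at)
  then have "(LINT \<xi>|lborel. fourier F \<xi> / (2 * pi) * exp (\<i> * of_real (u * \<xi>))) = F u" by simp
  then show ?thesis using F(5) h[of u] by (cases "u \<le> 1") (auto simp: exp_of_real exp_minus)
qed

lemma dilated_sobolev_multiplier_L1_Linfinity_bounded:
  assumes wave: "\<And>\<xi>. L1_Linfinity_bounded (\<lambda>u. damped_wave \<xi> (t * u)) (C * (1 + \<xi>\<^sup>2) powr \<beta>)"
    and t: "t > 0" and C: "C \<ge> 0" and s: "s > 2 * \<beta> + 1/2"
    and h: "h \<in> borel_measurable borel" "integrable lborel (\<lambda>\<omega>. (1 + \<omega>\<^sup>2) powr \<beta> * norm (h \<omega>))"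
      "\<And>u. u \<le> 1 \<Longrightarrow> (LINT \<omega>|lborel. h \<omega> * exp (\<i> * of_real (u * \<omega>))) = complex_of_real (exp u)"
    and F: "integrable lborel F" "bounded (range F)" "continuous_on UNIV F" "\<forall>x>1. F x = 0"
      "F \<in> sobolev_space s"
  shows "L1_Linfinity_bounded (\<lambda>u. F (t * u)) (C * (2 powr \<beta> *
    (sqrt (2 * pi * (LINT \<xi>|lborel. (1 + \<xi>\<^sup>2) powr (2 * \<beta> - s))) * sobolev_norm s F / (2 * pi)) *
    (LINT \<omega>|lborel. (1 + \<omega>\<^sup>2) powr \<beta> * norm (h \<omega>))))"
proof (rule L1_Linfinity_bounded_mono)
  let ?A = "LINT \<xi>|lborel. (1 + \<xi>\<^sup>2) powr \<beta> * norm (fourier F \<xi>)"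
  let ?J = "LINT \<omega>|lborel. (1 + \<omega>\<^sup>2) powr \<beta> * norm (h \<omega>)"
  obtain B where B: "\<And>x. norm (F x) \<le> B" using F(2) unfolding bounded_iff by blast
  note [measurable] = borel_measurable_integrable[OF F(1)]
  note weighted = sobolev_imp_weighted_fourier_L1[OF F(1) B F(5) s]
  have "integrable lborel (fourier F)"
    using \<sigma> \<kappa> by (intro integrable_if_weighted_integrable[OF _ weighted(1)]) simp_all
  note F_eq = eq_product_of_fourier_integrals[OF F(1,3,2) this F(4) h(3)]
  have "bounded_borel (half_line (\<lambda>u. F (t * u)))"
    using B by (intro bounded_borel_half_line[of _ B]) auto
  from product_of_fourier_integrals_L1_Linfinity_bounded[OF wave t C _ h(1) _ h(2) this F_eq]
  show "L1_Linfinity_bounded (\<lambda>u. F (t * u)) (C * (2 powr \<beta> * (?A / (2 * pi)) * ?J))"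
    using weighted(1) by (simp add: norm_divide)
  show "C * (2 powr \<beta> * (?A / (2 * pi)) * ?J) \<le> C * (2 powr \<beta> *
      (sqrt (2 * pi * (LINT \<xi>|lborel. (1 + \<xi>\<^sup>2) powr (2 * \<beta> - s))) * sobolev_norm s F / (2 * pi)) * ?J)"
    using C weighted(2) by (intro mult_left_mono mult_right_mono divide_right_mono) auto
qed

lemma sobolev_multiplier_L1_Linfinity_bounded:
  assumes s: "s > 2 * \<sigma> + 2 * \<kappa> + 1"
  shows "\<exists>C>0. \<forall>F t. integrable lborel F \<longrightarrow> bounded (range F) \<longrightarrow> continuous_on UNIV F \<longrightarrow>
      (\<forall>x>1. F x = 0) \<longrightarrow> F \<in> sobolev_space s \<longrightarrow> t > 0 \<longrightarrow>
    L1_Linfinity_bounded (\<lambda>u. F (t * u)) (C * (1 + t) powr \<kappa> * sobolev_norm s F)"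
proof -
  have \<beta>: "\<beta> \<ge> 0" "s > 2 * \<beta> + 1/2" using \<sigma> \<kappa> s by auto
  obtain C where C: "C \<ge> 0" and wave: "\<And>t \<xi>. t > 0 \<Longrightarrow>
      L1_Linfinity_bounded (\<lambda>u. damped_wave \<xi> (t * u)) (C * (1 + t) powr \<kappa> * (1 + \<xi>\<^sup>2) powr \<beta>)"
    using damped_wave_L1_Linfinity_bounded by blast
  obtain h where h: "h \<in> borel_measurable borel"
    "integrable lborel (\<lambda>\<omega>. (1 + \<omega>\<^sup>2) powr \<beta> * norm (h \<omega>))"
    and h_exp:
      "\<And>u. u \<le> 1 \<Longrightarrow> (LINT \<omega>|lborel. h \<omega> * exp (\<i> * of_real (u * \<omega>))) = complex_of_real (exp u)"
    using exp_eq_fourier_integral_atMost_1[OF \<beta>(1)] by blast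
  define J where "J = (LINT \<omega>|lborel. (1 + \<omega>\<^sup>2) powr \<beta> * norm (h \<omega>))"
  define W where "W = sqrt (2 * pi * (LINT \<xi>|lborel. (1 + \<xi>\<^sup>2) powr (2 * \<beta> - s)))"
  define K where "K = C * (2 powr \<beta> * (W / (2 * pi)) * J)"
  have K: "K \<ge> 0"
    unfolding K_def W_def J_def using C
    by (intro mult_nonneg_nonneg divide_nonneg_nonneg real_sqrt_ge_zero
        Bochner_Integration.integral_nonneg) auto
  have "L1_Linfinity_bounded (\<lambda>u. F (t * u)) ((K + 1) * (1 + t) powr \<kappa> * sobolev_norm s F)"
    if F: "integrable lborel F" "bounded (range F)" "continuous_on UNIV F" "\<forall>x>1. F x = 0"
      "F \<in> sobolev_space s" and t: "t > 0"
    for F t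
  proof (rule L1_Linfinity_bounded_mono)
    show "L1_Linfinity_bounded (\<lambda>u. F (t * u))
        (C * (1 + t) powr \<kappa> * (2 powr \<beta> * (W * sobolev_norm s F / (2 * pi)) * J))"
      unfolding W_def J_def using C
      by (intro dilated_sobolev_multiplier_L1_Linfinity_bounded[OF wave[OF t] t _ \<beta>(2) h h_exp F]) auto
    have "C * (1 + t) powr \<kappa> * (2 powr \<beta> * (W * sobolev_norm s F / (2 * pi)) * J) =
        K * (1 + t) powr \<kappa> * sobolev_norm s F" by (simp add: K_def)
    also have "\<dots> \<le> (K + 1) * (1 + t) powr \<kappa> * sobolev_norm s F"
      using sobolev_norm_nonneg[of s F] by (intro mult_right_mono) auto
    finally show "C * (1 + t) powr \<kappa> * (2 powr \<beta> * (W * sobolev_norm s F / (2 * pi)) * J) \<le>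
        (K + 1) * (1 + t) powr \<kappa> * sobolev_norm s F" .
  qed
  then show ?thesis using K by (intro exI[of _ "K + 1"]) auto
qed

lemma continuous_compact_support_integrable:
  fixes F :: "real \<Rightarrow> complex"
  assumes "continuous_on UNIV F" "closure {x. F x \<noteq> 0} \<subseteq> {a..b}"
  shows "integrable lborel F"
proof -
  have "indicator {a..b} x *\<^sub>R F x = F x" for x
    using assms(2) closure_subset[of "{x. F x \<noteq> 0}"] by (auto simp: indicator_def)
  then show ?thesis
    using borel_integrable_compact[of "{a..b}" F] continuous_on_subset[OF assms(1)] by simp
qed

theorem op_norm_sobolev_multiplier_le:
  assumes s: "s > 2 * \<sigma> + 2 * \<kappa> + 1"
  shows "\<exists>C>0. \<forall>F :: real \<Rightarrow> complex.
            F \<in> borel_measurable borel \<longrightarrow> bounded (range F) \<longrightarrow>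
            closure {u. F u \<noteq> 0} \<subseteq> {-1..1} \<longrightarrow>
            F \<in> sobolev_space s \<longrightarrow> continuous_on UNIV F \<longrightarrow>
            (\<forall>p::ennreal. 1 \<le> p \<longrightarrow>
               op_norm \<mu> p p (fc F) < \<infinity> \<and>
               (\<forall>t>0. op_norm \<mu> p p (fc (\<lambda>u. F (t * u)))
                  \<le> ennreal (C * (1 + t) powr \<kappa> * sobolev_norm s F)))"
proof -
  obtain C where C: "C > 0"
    and bounded: "\<And>F t. integrable lborel F \<Longrightarrow> bounded (range F) \<Longrightarrow> continuous_on UNIV F \<Longrightarrow>
      \<forall>x>1. F x = 0 \<Longrightarrow> F \<in> sobolev_space s \<Longrightarrow> t > 0 \<Longrightarrow>
      L1_Linfinity_bounded (\<lambda>u. F (t * u)) (C * (1 + t) powr \<kappa> * sobolev_norm s F)"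
    using sobolev_multiplier_L1_Linfinity_bounded[OF s] by blast
  have dilated:
    "op_norm \<mu> p p (fc (\<lambda>u. F (t * u))) \<le> ennreal (C * (1 + t) powr \<kappa> * sobolev_norm s F)"
    if F: "bounded (range F)" "closure {u. F u \<noteq> 0} \<subseteq> {-1..1}" "F \<in> sobolev_space s"
      "continuous_on UNIV F"
      and p: "1 \<le> p" and t: "t > 0" for F p t
  proof (rule op_norm_le_if_L1_Linfinity_bounded[OF sigma_finite_mu _ _ p])
    have "\<forall>x>1. F x = 0" using F(2) closure_subset[of "{u. F u \<noteq> 0}"] by fastforce
    then show bounded_F:
      "L1_Linfinity_bounded (\<lambda>u. F (t * u)) (C * (1 + t) powr \<kappa> * sobolev_norm s F)"
      using F t by (intro bounded continuous_compact_support_integrable[OF F(4,2)])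
    then show "represents (half_line (\<lambda>u. F (t * u))) f (fc (\<lambda>u. F (t * u)) f)"
      if "f \<in> Lp \<mu> 2" for f
      using that by (intro fc_represents) (auto simp: L1_Linfinity_bounded_def)
  qed (use C sobolev_norm_nonneg in auto)
  have "op_norm \<mu> p p (fc F) < \<infinity>"
    if "bounded (range F)" "closure {u. F u \<noteq> 0} \<subseteq> {-1..1}" "F \<in> sobolev_space s"
      "continuous_on UNIV F" "1 \<le> p" for F p
    using le_less_trans[OF dilated[OF that zero_less_one] ennreal_less_top] by simp
  with dilated C show ?thesis by blast
qed

end

theorem theorem1p1:
  fixes \<mu> :: "'a::metric_space measure"
    and D :: "('a \<Rightarrow> complex) set"
    and L :: "('a \<Rightarrow> complex) \<Rightarrow> ('a \<Rightarrow> complex)"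
    and \<sigma> \<kappa> C\<^sub>0 :: real
  assumes "metric_measure_space \<mu>"
    and "self_adjoint_op \<mu> D L"
    and "nonneg_op \<mu> D L"
    and "finite_propagation_speed \<mu> D L"
    and "\<sigma> > 0" and "\<kappa> \<ge> 0"
    and "\<forall>t>0. op_norm \<mu> 2 \<infinity>
           (\<lambda>f x. complex_of_real (sqrt (vol \<mu> t x)) *
              func_calc \<mu> D L (\<lambda>u. complex_of_real ((1 + t\<^sup>2 * u) powr (- \<sigma>))) f x)
         \<le> ennreal (C\<^sub>0 * (1 + t\<^sup>2) powr \<kappa>)"
  shows "(\<exists>C>0. \<forall>t>0. \<forall>\<xi>::real.
            op_norm \<mu> 1 1
              (func_calc \<mu> D L (\<lambda>u. exp (\<i> * of_real (\<xi> * t * u))) \<circ>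
               func_calc \<mu> D L (\<lambda>u. exp (- of_real (t * u))))
            \<le> ennreal (C * (1 + \<xi>\<^sup>2) powr (\<sigma> + \<kappa> + 1/4) * (1 + t) powr \<kappa>)) \<and>
         (\<forall>s > 2 * \<sigma> + 2 * \<kappa> + 1. \<exists>C>0. \<forall>F :: real \<Rightarrow> complex.
            F \<in> borel_measurable borel \<longrightarrow> bounded (range F) \<longrightarrow>
            closure {u. F u \<noteq> 0} \<subseteq> {-1..1} \<longrightarrow>
            F \<in> sobolev_space s \<longrightarrow> continuous_on UNIV F \<longrightarrow>
            (\<forall>p::ennreal. 1 \<le> p \<longrightarrow>
               op_norm \<mu> p p (func_calc \<mu> D L F) < \<infinity> \<and>
               (\<forall>t>0. op_norm \<mu> p p (func_calc \<mu> D L (\<lambda>u. F (t * u)))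
                  \<le> ennreal (C * (1 + t) powr \<kappa> * sobolev_norm s F))))"
proof -
  interpret propagation \<mu> D L \<sigma> \<kappa> C\<^sub>0
    using assms by unfold_locales
  obtain C where "C > 0" and heat: "\<forall>t>0. \<forall>\<xi>::real. \<forall>p\<ge>1. op_norm \<mu> p p
      (fc (\<lambda>u. exp (\<i> * of_real (\<xi> * t * u))) \<circ> fc (\<lambda>u. exp (- of_real (t * u))))
      \<le> ennreal (C * (1 + \<xi>\<^sup>2) powr \<beta> * (1 + t) powr \<kappa>)"
    using op_norm_damped_wave_le by blast
  show ?thesis
  proof (intro conjI allI impI op_norm_sobolev_multiplier_le)
    show "\<exists>C>0. \<forall>t>0. \<forall>\<xi>::real.
        op_norm \<mu> 1 1
          (fc (\<lambda>u. exp (\<i> * of_real (\<xi> * t * u))) \<circ> fc (\<lambda>u. exp (- of_real (t * u))))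
        \<le> ennreal (C * (1 + \<xi>\<^sup>2) powr \<beta> * (1 + t) powr \<kappa>)"
      using \<open>C > 0\<close> heat by auto
  qed
qed

end
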